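(* Let $A_N=(X^{(N)}_{i\wedge j,i\vee j})$ be generalised Wigner matrices, all defined on a common probability space, with $\mathbb EX^{(N)}_{i,j}=0$ for all $1\le i\le j\le N$, satisfying (S.1), (S.2), (S.3), and let $\Delta_N$ be the Laplacian of $A_N$. Then, with $A_1=\inf\sigma^2$ and $A_2=\sup\sigma^2$ as in (S.1), $$\liminf_{N\to\infty}\frac{\|\Delta_N\|}{\sqrt{2N\log N}}\ge A_1^{1/2}\ \text{a.s.},\qquad \limsup_{N\to\infty}\frac{\|\Delta_N\|}{\sqrt{2N\log N}}\le(2A_2)^{1/2}\ \text{a.s.},$$ where $\|\cdot\|$ is the spectral (operator $\ell^2$) norm.
   Context: For each $N$, $\{X^{(N)}_{i,j}:1\le i\le j\le N\}$ are independent real random variables, $A_N(i,j)=X^{(N)}_{i\wedge j,i\vee j}$, and $\Delta_N(i,j)=A_N(i,j)$ ($i\ne j$), $\Delta_N(i,i)=-\sum_{k\ne i}A_N(i,k)$. Let $\sigma_N(i,j)^2=\mathrm{Var}(X^{(N)}_{i\wedge j,i\vee j})$. Assumptions: (S.1) $A_1:=\inf_{N,i,j}\sigma_N(i,j)^2>0$ and $A_2:=\sup_{N,i,j}\sigma_N(i,j)^2\le1$. (S.2) There are $\delta>0$, $K<\infty$ with $\mathbb E|X^{(N)}_{i,j}-\mathbb EX^{(N)}_{i,j}|^{6+\delta}\le K$ for all $i,j,N$. (S.3) The empirical graphon $W_N$ ($W_N(x,y)=\sigma_N(i,j)^2$ on $I_i\times I_j$, $I_j=[\frac{j-1}N,\frac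 jN)$, $I_N$ closed) satisfies $\delta_\Box(W_N,W)\to0$ for some graphon $W$ (measurable symmetric $[0,1]^2\to[0,1]$), $\delta_\Box$ the cut metric $\inf_\sigma\sup_{S,T}|\int_{S\times T}(W_N-W^\sigma)|$ over measure-preserving bijections $\sigma$. *)

theory Defs
  imports "HOL-Probability.Probability"
begin

text \<open>Matrices of varying size N are functions nat => nat => real, indices in {1..N}.\<close>

definition spec_norm :: "nat \<Rightarrow> (nat \<Rightarrow> nat \<Rightarrow> real) \<Rightarrow> real" where
  "spec_norm N B = Sup {sqrt (\<Sum>i\<in>{1..N}. (\<Sum>j\<in>{1..N}. B i j * x j)\<^sup>2) | x.
                        (\<Sum>j\<in>{1..N}. (x j)\<^sup>2) = 1}"

definition sym_mat :: "(nat \<Rightarrow> nat \<Rightarrow> real) \<Rightarrow> nat \<Rightarrow> nat \<Rightarrow> real" where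
  "sym_mat Y i j = Y (min i j) (max i j)"

definition laplacian :: "nat \<Rightarrow> (nat \<Rightarrow> nat \<Rightarrow> real) \<Rightarrow> nat \<Rightarrow> nat \<Rightarrow> real" where
  "laplacian N A i j = (if i \<noteq> j then A i j else - (\<Sum>k\<in>{1..N} - {i}. A i k))"

text \<open>Index of the block I_j = [(j-1)/N, j/N) containing x (I_N closed).\<close>
definition block_idx :: "nat \<Rightarrow> real \<Rightarrow> nat" where
  "block_idx N x = (if x = 1 then N else nat \<lfloor>x * real N\<rfloor> + 1)"

definition emp_graphon :: "nat \<Rightarrow> (nat \<Rightarrow> nat \<Rightarrow> real) \<Rightarrow> real \<Rightarrow> real \<Rightarrow> real" where
  "emp_graphon N s x y =
     (if x \<in> {0..1} \<and> y \<in> {0..1} then s (block_idx N x) (block_idx N y) else 0)"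

definition graphon :: "(real \<Rightarrow> real \<Rightarrow> real) \<Rightarrow> bool" where
  "graphon W \<longleftrightarrow> (\<lambda>z. W (fst z) (snd z)) \<in> borel_measurable borel
     \<and> (\<forall>x\<in>{0..1}. \<forall>y\<in>{0..1}. W x y = W y x \<and> 0 \<le> W x y \<and> W x y \<le> 1)"

definition meas_pres_bij :: "(real \<Rightarrow> real) \<Rightarrow> bool" where
  "meas_pres_bij \<sigma> \<longleftrightarrow> bij_betw \<sigma> {0..1} {0..1}
     \<and> \<sigma> \<in> measurable (restrict_space lborel {0..1}) (restrict_space lborel {0..1})
     \<and> distr (restrict_space lborel {0..1}) (restrict_space lborel {0..1}) \<sigma>
           = restrict_space lborel {0..1::real}"

definition cut_norm :: "(real \<Rightarrow> real \<Rightarrow> real) \<Rightarrow> real" where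
  "cut_norm f = (SUP ST\<in>{(S,T). S \<in> sets borel \<and> T \<in> sets borel \<and> S \<subseteq> {0..1} \<and> T \<subseteq> {0..1}}.
        \<bar>LINT z:(fst ST \<times> snd ST)|lborel. f (fst z) (snd z)\<bar>)"

definition cut_dist :: "(real \<Rightarrow> real \<Rightarrow> real) \<Rightarrow> (real \<Rightarrow> real \<Rightarrow> real) \<Rightarrow> real" where
  "cut_dist U W = (INF \<sigma>\<in>{\<sigma>. meas_pres_bij \<sigma>}. cut_norm (\<lambda>x y. U x y - W (\<sigma> x) (\<sigma> y)))"

end

theory Submission
  imports Defs "HOL-Real_Asymp.Real_Asymp"
begin

text \<open>
  Write $\Delta = A - D$ with $D$ the diagonal matrix of full row sums of $A$. The entries are truncated
  at $N^g$ with $3/p < g < 1/2$, where $p = 6 + \delta$; by Borel--Cantelli this almost surely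
  changes only finitely many of the matrices.

  The diagonal: a row sum $S$ satisfies
  $\log E \exp (c S \sqrt{\log N / N}) = (c^2 v / 2 + o(1)) \log N$, with $v$ its variance divided by $N$, uniformly
  for bounded $c$. Chernoff's bound, a union bound over the rows and Borel--Cantelli (with a further factor
  $N$ to pay for summability) give the upper constant. For the lower bound, exponential
  tilting turns the same estimate into $P(S \ge y \sqrt{N \log N}) \ge N^{\xi - 1}$ when $y^2 < 2v$, and
  $\kappa N$ rows become independent once their columns $j \le \kappa N$ are dropped.

  The off-diagonal part has norm $o(\sqrt{N \log N})$: split $A$ at a large constant $R$. The part
  bounded by $R$ is handled by Hoeffding's inequality on a net of $\exp(O(N))$ lattice points, since
  $N \log N$ beats the entropy $N$. The part above $R$ has small variance, so a crude bound on the
  trace moments of order $\log N$, which loses only a constant against $\sqrt{N \log N}$, suffices.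
\<close>

subsection \<open>Matrix powers\<close>

text \<open>Moments of order above 6 make two demands on N^g compatible: the union bound over N^2
  entries, summed over N, wants g p > 3, while tilts of order sqrt(log N / N) times N^g must tend to
  0, so g < 1/2. The two constants differ even for equal variances because nothing relates matrices
  of different sizes. The exponent y^2/(2v) of a row tail has to exceed 1 to control the N rows of
  one matrix, but 2 to make the exceptional probabilities summable in N. In the lower bound the
  failure probability decays like exp(-c N^\<xi>) and is summable anyway. The trace bound counts no
  pairings: it charges s for a fresh entry and u for a repeated one, where s u = h bounds the second
  moment. Optimising u at moment order log N gives a constant times sqrt(h N log N). This has the
  order of the main term, so it helps only for small h; the entries below R need another argument,
  and for them a net costing exp(O(N)) is affordable.\<close>

definition matvec :: "nat \<Rightarrow> (nat \<Rightarrow> nat \<Rightarrow> real) \<Rightarrow> (nat \<Rightarrow> real) \<Rightarrow> nat \<Rightarrow> real" where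
  "matvec N A x i = (\<Sum>j\<in>{1..N}. A i j * x j)"

primrec mat_pow :: "nat \<Rightarrow> (nat \<Rightarrow> nat \<Rightarrow> real) \<Rightarrow> nat \<Rightarrow> nat \<Rightarrow> nat \<Rightarrow> real" where
  "mat_pow N A 0 = (\<lambda>i j. if i = j then 1 else 0)"
| "mat_pow N A (Suc n) = (\<lambda>i j. \<Sum>l\<in>{1..N}. A i l * mat_pow N A n l j)"

lemma mat_pow_add:
  assumes "i \<in> {1..N}"
  shows "mat_pow N A (m + n) i j = (\<Sum>l\<in>{1..N}. mat_pow N A m i l * mat_pow N A n l j)"
  using assms
proof (induction m arbitrary: i)
  case 0
  have "(\<Sum>l\<in>{1..N}. mat_pow N A 0 i l * mat_pow N A n l j) = (\<Sum>l\<in>{1..N}. if i = l then mat_pow N A n l j else 0)"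
    by (intro sum.cong) auto
  then show ?case using 0 by simp
next
  case (Suc m)
  have "mat_pow N A (Suc m + n) i j = (\<Sum>q\<in>{1..N}. A i q * (\<Sum>l\<in>{1..N}. mat_pow N A m q l * mat_pow N A n l j))"
    using Suc.IH by simp
  also have "\<dots> = (\<Sum>q\<in>{1..N}. \<Sum>l\<in>{1..N}. A i q * mat_pow N A m q l * mat_pow N A n l j)"
    by (simp add: sum_distrib_left mult.assoc)
  also have "\<dots> = (\<Sum>l\<in>{1..N}. \<Sum>q\<in>{1..N}. A i q * mat_pow N A m q l * mat_pow N A n l j)"
    by (rule sum.swap)
  also have "\<dots> = (\<Sum>l\<in>{1..N}. mat_pow N A (Suc m) i l * mat_pow N A n l j)"
    by (simp add: sum_distrib_right)
  finally show ?case .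
qed

text \<open>The recursion peels factors off on the left, whereas transposition leaves A on the
  right; additivity of powers closes the induction.\<close>

lemma mat_pow_sym:
  assumes sym: "\<And>i j. A i j = A j i" and "i \<in> {1..N}" "j \<in> {1..N}"
  shows "mat_pow N A n i j = mat_pow N A n j i"
  using assms(2,3)
proof (induction n arbitrary: i j)
  case 0
  then show ?case by auto
next
  case (Suc n)
  have one: "mat_pow N A (Suc 0) l q = A l q" if "l \<in> {1..N}" "q \<in> {1..N}" for l q
  proof -
    have "mat_pow N A (Suc 0) l q = (\<Sum>r\<in>{1..N}. if r = q then A l r else 0)"
      unfolding mat_pow.simps by (intro sum.cong) auto
    then show ?thesis using that by simp
  qed
  have "mat_pow N A (Suc n) i j = (\<Sum>l\<in>{1..N}. A i l * mat_pow N A n l j)" by simp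
  also have "\<dots> = (\<Sum>l\<in>{1..N}. mat_pow N A n j l * mat_pow N A (Suc 0) l i)"
  proof (intro sum.cong refl)
    fix l assume l: "l \<in> {1..N}"
    show "A i l * mat_pow N A n l j = mat_pow N A n j l * mat_pow N A (Suc 0) l i"
      using Suc.IH[OF l Suc.prems(2)] one[OF l Suc.prems(1)] sym[of i l] by (simp only: mult.commute)
  qed
  also have "\<dots> = mat_pow N A (n + Suc 0) j i"
    by (rule mat_pow_add[symmetric]) fact
  finally show ?case by simp
qed

lemma funpow_matvec:
  assumes "i \<in> {1..N}"
  shows "(matvec N A ^^ k) x i = (\<Sum>j\<in>{1..N}. mat_pow N A k i j * x j)"
  using assms
proof (induction k arbitrary: i)
  case 0
  have "(\<Sum>j\<in>{1..N}. mat_pow N A 0 i j * x j) = (\<Sum>j\<in>{1..N}. if i = j then x j else 0)"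
    by (intro sum.cong) auto
  then show ?case using 0 by simp
next
  case (Suc k)
  have "(matvec N A ^^ Suc k) x i = (\<Sum>l\<in>{1..N}. A i l * (\<Sum>j\<in>{1..N}. mat_pow N A k l j * x j))"
    unfolding funpow.simps comp_def matvec_def[of N A "(matvec N A ^^ k) x"]
    using Suc.IH by (intro sum.cong refl) auto
  also have "\<dots> = (\<Sum>l\<in>{1..N}. \<Sum>j\<in>{1..N}. A i l * mat_pow N A k l j * x j)"
    by (simp add: sum_distrib_left mult.assoc)
  also have "\<dots> = (\<Sum>j\<in>{1..N}. \<Sum>l\<in>{1..N}. A i l * mat_pow N A k l j * x j)"
    by (rule sum.swap)
  finally show ?case by (simp add: sum_distrib_right)
qed

lemma matvec_adjoint:
  assumes sym: "\<And>i j. A i j = A j i"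
  shows "(\<Sum>i\<in>{1..N}. matvec N A x i * y i) = (\<Sum>i\<in>{1..N}. x i * matvec N A y i)"
proof -
  have "(\<Sum>i\<in>{1..N}. matvec N A x i * y i) = (\<Sum>i\<in>{1..N}. \<Sum>j\<in>{1..N}. A i j * x j * y i)"
    by (simp add: matvec_def sum_distrib_right)
  also have "\<dots> = (\<Sum>j\<in>{1..N}. \<Sum>i\<in>{1..N}. A i j * x j * y i)" by (rule sum.swap)
  also have "\<dots> = (\<Sum>j\<in>{1..N}. x j * matvec N A y j)"
    unfolding matvec_def sum_distrib_left
    by (intro sum.cong refl) (simp add: sym mult.left_commute mult.commute)
  finally show ?thesis .
qed

lemma L2_set_sq: "(L2_set f A)\<^sup>2 = (\<Sum>i\<in>A. (f i)\<^sup>2)"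
  unfolding L2_set_def by (simp add: sum_nonneg)

lemma sum_mult_le_L2: "(\<Sum>i\<in>A. f i * g i) \<le> L2_set f A * L2_set g A"
proof -
  have "(\<Sum>i\<in>A. f i * g i) \<le> (\<Sum>i\<in>A. \<bar>f i\<bar> * \<bar>g i\<bar>)"
    by (intro sum_mono) (metis abs_ge_self abs_mult)
  also have "\<dots> \<le> L2_set f A * L2_set g A" by (rule L2_set_mult_ineq)
  finally show ?thesis .
qed

text \<open>Cauchy--Schwarz gives $\|A^{k+1}x\|^2 \le \|A^kx\|\,\|A^{k+2}x\|$, so the ratios
  $\|A^{k+1}x\|/\|A^kx\|$ increase.\<close>
lemma norm_matvec_pow_le_trace:
  assumes sym: "\<And>i j. A i j = A j i" and x: "L2_set x {1..N} = 1"
  shows "(L2_set (matvec N A x) {1..N}) ^ (2 * k) \<le> (\<Sum>i\<in>{1..N}. mat_pow N A (2 * k) i i)"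
proof -
  define v where "v k = (matvec N A ^^ k) x" for k
  define n where "n k = L2_set (v k) {1..N}" for k
  have v_Suc: "v (Suc k) = matvec N A (v k)" for k by (simp add: v_def)
  have n_nn: "n k \<ge> 0" for k by (simp add: n_def)
  have n0: "n 0 = 1" using x by (simp add: n_def v_def)
  have logconv: "(n (Suc k))\<^sup>2 \<le> n k * n (Suc (Suc k))" for k
  proof -
    have "(n (Suc k))\<^sup>2 = (\<Sum>i\<in>{1..N}. matvec N A (v k) i * v (Suc k) i)"
      unfolding n_def L2_set_sq v_Suc by (simp add: power2_eq_square)
    also have "\<dots> = (\<Sum>i\<in>{1..N}. v k i * v (Suc (Suc k)) i)"
      unfolding v_Suc by (rule matvec_adjoint[OF sym])
    also have "\<dots> \<le> n k * n (Suc (Suc k))" unfolding n_def by (rule sum_mult_le_L2)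
    finally show ?thesis .
  qed
  have ratio: "n 1 * n k \<le> n (Suc k)" for k
  proof (induction k)
    case 0
    then show ?case using n0 by simp
  next
    case (Suc k)
    show ?case
    proof (cases "n (Suc k) = 0")
      case True
      then show ?thesis using n_nn by simp
    next
      case False
      then have pos: "n k > 0" using logconv[of k] n_nn[of k]
        by (metis less_eq_real_def mult_zero_left not_less power2_less_eq_zero_iff)
      have "n k * (n 1 * n (Suc k)) = (n 1 * n k) * n (Suc k)" by simp
      also have "\<dots> \<le> n (Suc k) * n (Suc k)" using Suc n_nn by (intro mult_right_mono) auto
      also have "\<dots> \<le> n k * n (Suc (Suc k))" using logconv[of k] by (simp add: power2_eq_square)
      finally show ?thesis using pos by simp
    qed
  qed
  have pw: "n 1 ^ k \<le> n k" for k
  proof (induction k)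
    case (Suc k)
    have "n 1 ^ Suc k \<le> n 1 * n k" using Suc n_nn by (simp add: mult_left_mono)
    then show ?case using ratio[of k] by linarith
  qed (simp add: n0)
  have "(L2_set (matvec N A x) {1..N}) ^ (2 * k) = (n 1 ^ k)\<^sup>2"
    by (simp add: n_def v_def power_mult mult.commute flip: power_mult)
  also have "\<dots> \<le> (n k)\<^sup>2" using pw n_nn by (intro power_mono) auto
  also have "\<dots> = (\<Sum>i\<in>{1..N}. (\<Sum>j\<in>{1..N}. mat_pow N A k i j * x j)\<^sup>2)"
    unfolding n_def L2_set_sq v_def by (intro sum.cong refl) (simp add: funpow_matvec)
  \<comment> \<open>Row-wise Cauchy--Schwarz bounds ||A^k x||^2 by the squared Frobenius norm of
    A^k, which for symmetric A is the trace of A^(2k).\<close>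
  also have "\<dots> \<le> (\<Sum>i\<in>{1..N}. (\<Sum>j\<in>{1..N}. (mat_pow N A k i j)\<^sup>2))"
  proof (intro sum_mono)
    fix i
    have "(\<Sum>j\<in>{1..N}. mat_pow N A k i j * x j)\<^sup>2 \<le> (\<Sum>j\<in>{1..N}. (mat_pow N A k i j)\<^sup>2) * (\<Sum>j\<in>{1..N}. (x j)\<^sup>2)"
      by (rule Cauchy_Schwarz_ineq_sum)
    also have "(\<Sum>j\<in>{1..N}. (x j)\<^sup>2) = 1" using x by (metis L2_set_sq one_power2)
    finally show "(\<Sum>j\<in>{1..N}. mat_pow N A k i j * x j)\<^sup>2 \<le> (\<Sum>j\<in>{1..N}. (mat_pow N A k i j)\<^sup>2)" by simp
  qed
  also have "\<dots> = (\<Sum>i\<in>{1..N}. mat_pow N A (k + k) i i)"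
  proof (intro sum.cong refl)
    fix i assume i: "i \<in> {1..N}"
    show "(\<Sum>j\<in>{1..N}. (mat_pow N A k i j)\<^sup>2) = mat_pow N A (k + k) i i"
      unfolding mat_pow_add[OF i] power2_eq_square
      using mat_pow_sym[of A _ N i k, OF sym] i by (intro sum.cong refl) auto
  qed
  finally show ?thesis by (simp add: mult_2)
qed

section \<open>Indices of the independent entries\<close>

definition upper_pairs :: "nat \<Rightarrow> (nat \<times> nat) set" where
  "upper_pairs N = {(i, j). 1 \<le> i \<and> i \<le> j \<and> j \<le> N}"

lemma finite_upper_pairs [simp]: "finite (upper_pairs N)"
  by (rule finite_subset[of _ "{1..N} \<times> {1..N}"]) (auto simp: upper_pairs_def)

lemma card_upper_pairs: "card (upper_pairs N) \<le> N * N"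
proof -
  have "card (upper_pairs N) \<le> card ({1..N} \<times> {1..N})"
    by (intro card_mono) (auto simp: upper_pairs_def)
  then show ?thesis by simp
qed

definition upair :: "nat \<Rightarrow> nat \<Rightarrow> nat \<times> nat" where
  "upair i j = (min i j, max i j)"

lemma upair_commute: "upair i j = upair j i"
  by (simp add: upair_def min.commute max.commute)

lemma upair_in [simp]: "i \<in> {1..N} \<Longrightarrow> j \<in> {1..N} \<Longrightarrow> upair i j \<in> upper_pairs N"
  by (auto simp: upair_def upper_pairs_def min_def max_def)

text \<open>Within one row no variable occurs twice, so row sums are sums of independent variables
  although the matrix is symmetric.\<close>

lemma inj_upair: "inj_on (upair i) A"
  by (auto simp: inj_on_def upair_def min_def max_def split: if_splits)

subsection \<open>Trace moments\<close>

text \<open>The weight of a monomial $\prod_e b_e^{m_e}$ is $\prod_{m_e > 0} s u^{m_e-1}$. If $su$ bounds the second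
  moments and $u$ the variables themselves, it dominates the expectation of the monomial, the exponents
  $m_e = 1$ being harmless because the $b_e$ are centred.\<close>
definition weight1 :: "real \<Rightarrow> real \<Rightarrow> nat \<Rightarrow> real" where
  "weight1 s u m = (if m = 0 then 1 else s * u ^ (m - 1))"

text \<open>Unrolling one factor of the power multiplies the monomial by one more entry, and its
  weight by s if that entry is new and by u if it has been used. At most N choices are new and at
  most D are used, hence the factor N s + D u per step. The monomial in front makes the induction go
  through; the budget D covers the distinct entries used so far and all steps still to come.\<close>

lemma (in prob_space) trace_expansion:
  fixes b :: "nat \<times> nat \<Rightarrow> 'a \<Rightarrow> real"
  assumes ind: "indep_vars (\<lambda>_. borel) b (upper_pairs N)"
    and bd: "\<And>e \<omega>. e \<in> upper_pairs N \<Longrightarrow> \<bar>b e \<omega>\<bar> \<le> u"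
    and ctr: "\<And>e. e \<in> upper_pairs N \<Longrightarrow> expectation (b e) = 0"
    and var: "\<And>e. e \<in> upper_pairs N \<Longrightarrow> expectation (\<lambda>\<omega>. (b e \<omega>)\<^sup>2) \<le> s * u"
    and s: "s \<ge> 0" and u: "u \<ge> 0"
    and "i \<in> {1..N}" "card {e \<in> upper_pairs N. m e \<noteq> 0} + n \<le> D"
  shows "integrable M (\<lambda>\<omega>. (\<Prod>e\<in>upper_pairs N. b e \<omega> ^ m e) * mat_pow N (\<lambda>i j. b (upair i j) \<omega>) n i j) \<and>
    \<bar>expectation (\<lambda>\<omega>. (\<Prod>e\<in>upper_pairs N. b e \<omega> ^ m e) * mat_pow N (\<lambda>i j. b (upair i j) \<omega>) n i j)\<bar>
     \<le> (\<Prod>e\<in>upper_pairs N. weight1 s u (m e)) * (real N * s + real D * u) ^ n"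
  using assms(7,8)
proof (induction n arbitrary: m i)
  case 0
  have rv: "b e \<in> borel_measurable M" if "e \<in> upper_pairs N" for e
    using ind that unfolding indep_vars_def by auto
  have int: "integrable M (\<lambda>\<omega>. b e \<omega> ^ q)" if e: "e \<in> upper_pairs N" for e q
    using rv[OF e] bd[OF e] u
    by (intro integrable_const_bound[where B="u ^ q"]) (auto simp: power_abs intro!: AE_I2 power_mono)
  have one: "\<bar>expectation (\<lambda>\<omega>. b e \<omega> ^ q)\<bar> \<le> weight1 s u q" if e: "e \<in> upper_pairs N" for e q
  proof -
    consider "q = 0" | "q = 1" | k where "q = k + 2"
      by (metis One_nat_def add_2_eq_Suc' not0_implies_Suc)
    then show ?thesis
    proof cases
      case 1
      then show ?thesis by (simp add: weight1_def prob_space)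
    next
      case 2
      then show ?thesis using ctr[OF e] s by (simp add: weight1_def)
    next
      case (3 k)
      \<comment> \<open>All but two factors are bounded by u and the last two by the second moment s
        u, which gives s u^(q-1).\<close>
      have "\<bar>expectation (\<lambda>\<omega>. b e \<omega> ^ q)\<bar> \<le> expectation (\<lambda>\<omega>. \<bar>b e \<omega> ^ q\<bar>)"
        by (rule integral_abs_bound)
      also have "\<dots> \<le> expectation (\<lambda>\<omega>. u ^ k * (b e \<omega>)\<^sup>2)"
      proof (intro integral_mono)
        show "integrable M (\<lambda>\<omega>. \<bar>b e \<omega> ^ q\<bar>)" using int[OF e] by auto
        show "integrable M (\<lambda>\<omega>. u ^ k * (b e \<omega>)\<^sup>2)" using int[OF e, of 2] by auto
        show "\<bar>b e \<omega> ^ q\<bar> \<le> u ^ k * (b e \<omega>)\<^sup>2" for \<omega>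
          unfolding 3 power_add abs_mult
          using bd[OF e, of \<omega>] power_mono[of "\<bar>b e \<omega>\<bar>" u k] by (intro mult_mono) (auto simp: power_abs)
      qed
      also have "\<dots> = u ^ k * expectation (\<lambda>\<omega>. (b e \<omega>)\<^sup>2)" by simp
      also have "\<dots> \<le> u ^ k * (s * u)" using var[OF e] u by (intro mult_left_mono) auto
      also have "\<dots> = weight1 s u q" by (simp add: weight1_def 3)
      finally show ?thesis .
    qed
  qed
  have indp: "indep_vars (\<lambda>_. borel) (\<lambda>e \<omega>. b e \<omega> ^ m e) (upper_pairs N)"
    by (rule indep_vars_compose2[OF ind]) auto
  have I: "integrable M (\<lambda>\<omega>. \<Prod>e\<in>upper_pairs N. b e \<omega> ^ m e)"
    by (rule indep_vars_integrable[OF _ indp]) (auto simp: int)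
  have "expectation (\<lambda>\<omega>. \<Prod>e\<in>upper_pairs N. b e \<omega> ^ m e) = (\<Prod>e\<in>upper_pairs N. expectation (\<lambda>\<omega>. b e \<omega> ^ m e))"
    by (rule indep_vars_lebesgue_integral[OF _ indp]) (auto simp: int)
  then have E: "\<bar>expectation (\<lambda>\<omega>. \<Prod>e\<in>upper_pairs N. b e \<omega> ^ m e)\<bar> \<le> (\<Prod>e\<in>upper_pairs N. weight1 s u (m e))"
    by (simp add: abs_prod prod_mono one)
  have W: "(\<Prod>e\<in>upper_pairs N. weight1 s u (m e)) \<ge> 0"
    using s u by (intro prod_nonneg) (auto simp: weight1_def)
  show ?case using I E W by (cases "i = j") auto
next
  case (Suc n)
  define P where "P = upper_pairs N"
  \<comment> \<open>\<open>m' l\<close> records one further use of the entry between i and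
    l.\<close>
  define m' where "m' l = m(upair i l := Suc (m (upair i l)))" for l
  have P: "finite P" by (simp add: P_def)
  have inP: "upair i l \<in> P" if "l \<in> {1..N}" for l using that Suc.prems by (simp add: P_def)
  have split: "(\<Prod>e\<in>P. f e) = f (upair i l) * (\<Prod>e\<in>P - {upair i l}. f e)"
    if "l \<in> {1..N}" for l and f :: "_ \<Rightarrow> real"
    using prod.remove[OF P inP[OF that]] .
  have eq: "(\<Prod>e\<in>P. b e \<omega> ^ m e) * mat_pow N (\<lambda>i j. b (upair i j) \<omega>) (Suc n) i j
     = (\<Sum>l\<in>{1..N}. (\<Prod>e\<in>P. b e \<omega> ^ m' l e) * mat_pow N (\<lambda>i j. b (upair i j) \<omega>) n l j)" for \<omega>
    unfolding mat_pow.simps sum_distrib_left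
  proof (intro sum.cong refl)
    fix l assume l: "l \<in> {1..N}"
    have "(\<Prod>e\<in>P. b e \<omega> ^ m' l e) = (\<Prod>e\<in>P. b e \<omega> ^ m e) * b (upair i l) \<omega>"
      unfolding split[OF l] by (auto simp: m'_def)
    then show "(\<Prod>e\<in>P. b e \<omega> ^ m e) * (b (upair i l) \<omega> * mat_pow N (\<lambda>i j. b (upair i j) \<omega>) n l j)
      = (\<Prod>e\<in>P. b e \<omega> ^ m' l e) * mat_pow N (\<lambda>i j. b (upair i j) \<omega>) n l j" by simp
  qed
  have IH: "integrable M (\<lambda>\<omega>. (\<Prod>e\<in>P. b e \<omega> ^ m' l e) * mat_pow N (\<lambda>i j. b (upair i j) \<omega>) n l j)"
       "\<bar>expectation (\<lambda>\<omega>. (\<Prod>e\<in>P. b e \<omega> ^ m' l e) * mat_pow N (\<lambda>i j. b (upair i j) \<omega>) n l j)\<bar>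
     \<le> (\<Prod>e\<in>P. weight1 s u (m' l e)) * (real N * s + real D * u) ^ n" if l: "l \<in> {1..N}" for l
  proof -
    have "card {e \<in> P. m' l e \<noteq> 0} \<le> card (insert (upair i l) {e \<in> P. m e \<noteq> 0})"
      using P by (intro card_mono) (auto simp: m'_def)
    also have "\<dots> \<le> Suc (card {e \<in> P. m e \<noteq> 0})" by (rule card_insert_le_m1) auto
    finally have "card {e \<in> P. m' l e \<noteq> 0} + n \<le> D" using Suc.prems by (simp add: P_def)
    then show "integrable M (\<lambda>\<omega>. (\<Prod>e\<in>P. b e \<omega> ^ m' l e) * mat_pow N (\<lambda>i j. b (upair i j) \<omega>) n l j)"
       "\<bar>expectation (\<lambda>\<omega>. (\<Prod>e\<in>P. b e \<omega> ^ m' l e) * mat_pow N (\<lambda>i j. b (upair i j) \<omega>) n l j)\<bar>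
     \<le> (\<Prod>e\<in>P. weight1 s u (m' l e)) * (real N * s + real D * u) ^ n"
      using Suc.IH[OF l, of "m' l"] unfolding P_def by auto
  qed
  let ?Phi = "\<Prod>e\<in>P. weight1 s u (m e)"
  have W: "?Phi \<ge> 0"
    using s u by (intro prod_nonneg) (auto simp: weight1_def)
  have step: "(\<Prod>e\<in>P. weight1 s u (m' l e)) = ?Phi * (if m (upair i l) = 0 then s else u)" if l: "l \<in> {1..N}" for l
  proof -
    have "(\<Prod>e\<in>P - {upair i l}. weight1 s u (m' l e)) = (\<Prod>e\<in>P - {upair i l}. weight1 s u (m e))"
      by (intro prod.cong) (auto simp: m'_def)
    moreover have "weight1 s u (Suc q) = weight1 s u q * (if q = 0 then s else u)" for q
      by (cases q) (auto simp: weight1_def)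
    ultimately show ?thesis unfolding split[OF l] by (simp add: m'_def)
  qed
  \<comment> \<open>Since \<open>upair i\<close> is injective, the columns l leading to a used entry
    are no more numerous than the used entries.\<close>
  have cnt: "(\<Sum>l\<in>{1..N}. (if m (upair i l) = 0 then s else u)) \<le> real N * s + real D * u"
  proof -
    have "(\<Sum>l\<in>{1..N}. (if m (upair i l) = 0 then s else u)) \<le> (\<Sum>l\<in>{1..N}. s + (if m (upair i l) \<noteq> 0 then u else 0))"
      using s u by (intro sum_mono) auto
    also have "\<dots> = real N * s + real (card {l \<in> {1..N}. m (upair i l) \<noteq> 0}) * u"
      unfolding sum.distrib by (subst sum.inter_filter[symmetric]) auto
    also have "card {l \<in> {1..N}. m (upair i l) \<noteq> 0} \<le> card {e \<in> P. m e \<noteq> 0}"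
    proof (rule card_inj_on_le[of "upair i"])
      show "upair i ` {l \<in> {1..N}. m (upair i l) \<noteq> 0} \<subseteq> {e \<in> P. m e \<noteq> 0}" using inP by auto
    qed (use P inj_upair in auto)
    then have "real (card {l \<in> {1..N}. m (upair i l) \<noteq> 0}) * u \<le> real D * u"
      using Suc.prems u by (intro mult_right_mono) (auto simp: P_def)
    finally show ?thesis by simp
  qed
  have c0: "real N * s + real D * u \<ge> 0" using s u by auto
  have int: "integrable M (\<lambda>\<omega>. (\<Prod>e\<in>P. b e \<omega> ^ m e) * mat_pow N (\<lambda>i j. b (upair i j) \<omega>) (Suc n) i j)"
    unfolding eq using IH(1) by auto
  have "\<bar>expectation (\<lambda>\<omega>. (\<Prod>e\<in>P. b e \<omega> ^ m e) * mat_pow N (\<lambda>i j. b (upair i j) \<omega>) (Suc n) i j)\<bar>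
     = \<bar>\<Sum>l\<in>{1..N}. expectation (\<lambda>\<omega>. (\<Prod>e\<in>P. b e \<omega> ^ m' l e) * mat_pow N (\<lambda>i j. b (upair i j) \<omega>) n l j)\<bar>"
    unfolding eq using IH(1) by (subst Bochner_Integration.integral_sum) auto
  also have "\<dots> \<le> (\<Sum>l\<in>{1..N}. (\<Prod>e\<in>P. weight1 s u (m' l e)) * (real N * s + real D * u) ^ n)"
    by (rule order.trans[OF sum_abs]) (intro sum_mono IH(2))
  also have "\<dots> = ?Phi * (\<Sum>l\<in>{1..N}. (if m (upair i l) = 0 then s else u)) * (real N * s + real D * u) ^ n"
    by (simp add: step sum_distrib_left sum_distrib_right)
  also have "\<dots> \<le> ?Phi * (real N * s + real D * u) * (real N * s + real D * u) ^ n"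
    using cnt W c0 by (intro mult_right_mono mult_left_mono) auto
  finally show ?case using int unfolding P_def by (simp add: mult.assoc)
qed

text \<open>Markov's inequality for the trace of an even power. The result is stated through an
  exceptional event defined by the trace, so the supremum over x never has to be measured.\<close>

lemma (in prob_space) trace_tail:
  fixes b :: "nat \<times> nat \<Rightarrow> 'a \<Rightarrow> real"
  assumes ind: "indep_vars (\<lambda>_. borel) b (upper_pairs N)"
    and bd: "\<And>e \<omega>. e \<in> upper_pairs N \<Longrightarrow> \<bar>b e \<omega>\<bar> \<le> u"
    and ctr: "\<And>e. e \<in> upper_pairs N \<Longrightarrow> expectation (b e) = 0"
    and var: "\<And>e. e \<in> upper_pairs N \<Longrightarrow> expectation (\<lambda>\<omega>. (b e \<omega>)\<^sup>2) \<le> s * u"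
    and s: "s \<ge> 0" and u: "u \<ge> 0" and t: "t > 0"
  shows "\<exists>B\<in>events. prob B \<le> real N * ((real N * s + real (2 * k) * u) / t) ^ (2 * k) \<and>
     (\<forall>\<omega>\<in>space M - B. \<forall>x. L2_set x {1..N} = 1 \<longrightarrow>
        L2_set (matvec N (\<lambda>i j. b (upair i j) \<omega>) x) {1..N} \<le> t)"
proof -
  define A where "A \<omega> = (\<lambda>i j. b (upair i j) \<omega>)" for \<omega>
  define T where "T \<omega> = (\<Sum>i\<in>{1..N}. mat_pow N (A \<omega>) (2 * k) i i)" for \<omega>
  define B where "B = {\<omega>\<in>space M. T \<omega> \<ge> t ^ (2 * k)}"
  let ?c = "(real N * s + real (2 * k) * u) ^ (2 * k)"
  have H: "integrable M (\<lambda>\<omega>. mat_pow N (A \<omega>) (2 * k) i i) \<and>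
      \<bar>expectation (\<lambda>\<omega>. mat_pow N (A \<omega>) (2 * k) i i)\<bar> \<le> ?c" if "i \<in> {1..N}" for i
    using trace_expansion[OF ind bd ctr var s u that, of "\<lambda>_. 0" "2 * k" "2 * k" i]
    by (simp add: A_def weight1_def)
  have I: "integrable M T" unfolding T_def using H by auto
  have [measurable]: "T \<in> borel_measurable M" using I by auto
  have "expectation T = (\<Sum>i\<in>{1..N}. expectation (\<lambda>\<omega>. mat_pow N (A \<omega>) (2 * k) i i))"
    unfolding T_def using H by (subst Bochner_Integration.integral_sum) auto
  also have "\<dots> \<le> (\<Sum>i\<in>{1..N}. ?c)" using H by (intro sum_mono) (metis abs_le_D1)
  finally have E: "expectation T \<le> real N * ?c" by simp
  \<comment> \<open>Markov's inequality needs a non-negative trace; comparison with the norm at the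
    first basis vector provides it.\<close>
  have T_nn: "T \<omega> \<ge> 0" for \<omega>
  proof (cases "N = 0")
    case False
    define x where "x = (\<lambda>i::nat. if i = 1 then 1 else (0::real))"
    have "(L2_set x {1..N})\<^sup>2 = (\<Sum>i\<in>{1..N}. if i = 1 then 1 else 0)"
      unfolding L2_set_sq x_def by (intro sum.cong) auto
    also have "\<dots> = 1" using False by simp
    finally have "L2_set x {1..N} = 1" by (metis L2_set_nonneg power2_eq_1_iff zero_le_one neg_0_le_iff_le not_one_le_zero)
    from norm_matvec_pow_le_trace[OF _ this, of "A \<omega>" k]
    have "(L2_set (matvec N (A \<omega>) x) {1..N}) ^ (2 * k) \<le> T \<omega>" by (simp add: T_def A_def upair_commute)
    then show ?thesis by (smt (verit) L2_set_nonneg zero_le_power)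
  qed (simp add: T_def)
  have "B \<in> events" unfolding B_def by measurable
  moreover have "prob B \<le> real N * ((real N * s + real (2 * k) * u) / t) ^ (2 * k)"
  proof -
    have "prob B \<le> expectation T / t ^ (2 * k)"
      unfolding B_def using I T_nn t by (intro integral_Markov_inequality_measure[where A="{}"]) auto
    also have "\<dots> \<le> real N * ?c / t ^ (2 * k)" using E t by (intro divide_right_mono) auto
    finally show ?thesis by (simp add: power_divide)
  qed
  moreover have "L2_set (matvec N (A \<omega>) x) {1..N} \<le> t" if "\<omega> \<in> space M - B" "L2_set x {1..N} = 1" for \<omega> x
  proof (rule ccontr)
    assume "\<not> ?thesis"
    then have "t ^ (2 * k) \<le> (L2_set (matvec N (A \<omega>) x) {1..N}) ^ (2 * k)"
      using t by (intro power_mono) auto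
    also have "\<dots> \<le> T \<omega>" unfolding T_def
      by (rule norm_matvec_pow_le_trace[OF _ that(2)]) (simp add: A_def upair_commute)
    finally show False using that by (auto simp: B_def)
  qed
  ultimately show ?thesis unfolding A_def by blast
qed

subsection \<open>Lattice net\<close>

text \<open>Divided by sqrt N these are the points of a grid of mesh 1/sqrt N in the ball of radius
  2. A unit vector scaled by sqrt N has norm sqrt N and rounding moves it by at most sqrt N, hence
  the bound 4 N. \<open>PiE\<close> fixes the values outside {1..N}, which keeps the set
  finite.\<close>

definition lattice_pts :: "nat \<Rightarrow> (nat \<Rightarrow> int) set" where
  "lattice_pts N = {z \<in> PiE {1..N} (\<lambda>_. UNIV). (\<Sum>i\<in>{1..N}. (z i)\<^sup>2) \<le> 4 * int N}"

text \<open>For n at least 1 the term is at most 2^(-n), so each half contributes at most 1 and the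
  origin contributes 1.\<close>

lemma sum_exp_neg_squares_le: "(\<Sum>n\<in>{- int m..int m}. exp (- (real_of_int n)\<^sup>2)) \<le> 3"
proof -
  let ?f = "\<lambda>n::int. exp (- (real_of_int n)\<^sup>2)"
  have "(\<Sum>n\<in>{0..<m}. (1/2::real) ^ n) = 2 - 2 * (1/2) ^ m"
    by (induction m) auto
  then have geo: "(\<Sum>n\<in>{0..<m}. (1/2::real) ^ n) \<le> 2" by simp
  have half: "(\<Sum>n\<in>{1..int m}. ?f n) \<le> 1"
  proof -
    have "(\<Sum>n\<in>{1..int m}. ?f n) = (\<Sum>n\<in>{0..<m}. exp (- (real n + 1)\<^sup>2))"
      by (rule sum.reindex_bij_witness[of _ "\<lambda>n. int n + 1" "\<lambda>n. nat (n - 1)"]) auto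
    also have "\<dots> \<le> (\<Sum>n\<in>{0..<m}. (1/2) * (1/2) ^ n)"
    proof (intro sum_mono)
      fix n
      have "exp (- (real n + 1)\<^sup>2) \<le> exp (- (real n + 1))"
        by (simp add: power2_eq_square algebra_simps)
      also have "\<dots> = inverse (exp 1 ^ Suc n)"
        unfolding exp_of_nat_mult[symmetric] exp_minus by (simp add: add.commute)
      also have "\<dots> \<le> inverse (2 ^ Suc n)"
        using exp_ge_add_one_self[of 1] by (intro le_imp_inverse_le power_mono) auto
      finally show "exp (- (real n + 1)\<^sup>2) \<le> (1/2) * (1/2) ^ n" by (simp add: power_divide field_simps)
    qed
    also have "\<dots> \<le> 1" using geo by (subst sum_distrib_left[symmetric]) simp
    finally show ?thesis .
  qed
  have half': "(\<Sum>n\<in>{- int m..-1}. ?f n) = (\<Sum>n\<in>{1..int m}. ?f n)"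
    by (rule sum.reindex_bij_witness[of _ uminus uminus]) auto
  have "{- int m..int m} = {- int m..-1} \<union> {0} \<union> {1..int m}" by auto
  also have "sum ?f \<dots> = sum ?f {- int m..-1} + ?f 0 + sum ?f {1..int m}"
    by (subst sum.union_disjoint; (subst sum.union_disjoint)?) auto
  finally show ?thesis using half half' by simp
qed

text \<open>A Gaussian weight replaces a volume count: on the ball, e^(4N) times the product of
  exp(- z_i^2) is at least 1. Summing this weight over a box factorises into N one-dimensional sums,
  each at most 3 and so at most e^2.\<close>

lemma card_lattice_pts:
  shows "finite (lattice_pts N)" "real (card (lattice_pts N)) \<le> exp (6 * real N)"
proof -
  \<comment> \<open>Any finite box containing the ball will do; coordinates are integers, so |z_i|
    is at most z_i^2, hence at most 4 N.\<close>
  let ?Q = "PiE {1..N} (\<lambda>_. {- int (4 * N)..int (4 * N)})"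
  have fin: "finite ?Q" by (intro finite_PiE) auto
  have sub: "lattice_pts N \<subseteq> ?Q"
  proof
    fix z assume z: "z \<in> lattice_pts N"
    have "z i \<in> {- int (4 * N)..int (4 * N)}" if "i \<in> {1..N}" for i
    proof -
      have "\<bar>z i\<bar> \<le> (z i)\<^sup>2" by (metis abs_le_square_iff abs_of_nat abs_square_le_1 int_one_le_iff_zero_less linorder_not_less mult_cancel_left1 nle_le of_nat_0_le_iff power2_abs power2_eq_square self_le_power zero_less_abs_iff abs_ge_zero mult_le_cancel_left1 zero_le_power2 abs_zero pos2)
      also have "\<dots> \<le> (\<Sum>i\<in>{1..N}. (z i)\<^sup>2)" using that by (intro member_le_sum) auto
      also have "\<dots> \<le> 4 * int N" using z by (simp add: lattice_pts_def)
      finally show ?thesis by auto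
    qed
    then show "z \<in> ?Q" using z unfolding lattice_pts_def PiE_iff by blast
  qed
  show "finite (lattice_pts N)" using fin sub by (rule finite_subset[rotated])
  have "real (card (lattice_pts N)) = (\<Sum>z\<in>lattice_pts N. 1)" by simp
  also have "\<dots> \<le> (\<Sum>z\<in>lattice_pts N. exp (4 * real N) * (\<Prod>i\<in>{1..N}. exp (- (real_of_int (z i))\<^sup>2)))"
  proof (intro sum_mono)
    fix z assume "z \<in> lattice_pts N"
    then have "real_of_int (\<Sum>i\<in>{1..N}. (z i)\<^sup>2) \<le> real_of_int (4 * int N)"
      unfolding of_int_le_iff lattice_pts_def by blast
    then have "(\<Sum>i\<in>{1..N}. (real_of_int (z i))\<^sup>2) \<le> 4 * real N" by simp
    then have "1 \<le> exp (4 * real N + (\<Sum>i\<in>{1..N}. - (real_of_int (z i))\<^sup>2))"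
      by (simp add: sum_negf)
    then show "1 \<le> exp (4 * real N) * (\<Prod>i\<in>{1..N}. exp (- (real_of_int (z i))\<^sup>2))"
      by (simp add: exp_add exp_sum)
  qed
  also have "\<dots> \<le> (\<Sum>z\<in>?Q. exp (4 * real N) * (\<Prod>i\<in>{1..N}. exp (- (real_of_int (z i))\<^sup>2)))"
    using fin sub by (intro sum_mono2) (auto intro!: mult_nonneg_nonneg prod_nonneg)
  also have "\<dots> = exp (4 * real N) * (\<Prod>i\<in>{1..N}. \<Sum>n\<in>{- int (4 * N)..int (4 * N)}. exp (- (real_of_int n)\<^sup>2))"
    by (subst prod_sum_PiE) (auto simp: sum_distrib_left)
  also have "\<dots> \<le> exp (4 * real N) * (\<Prod>i\<in>{1..N}. 3)"
    using sum_exp_neg_squares_le[of "4 * N"] by (intro mult_left_mono prod_mono) (auto intro!: sum_nonneg)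
  also have "\<dots> \<le> exp (4 * real N) * exp (2 * real N)"
  proof -
    have "(3::real) ^ N \<le> exp 2 ^ N" using exp_ge_add_one_self[of 2] by (intro power_mono) auto
    then show ?thesis by (simp add: exp_of_nat_mult[symmetric] mult.commute)
  qed
  also have "\<dots> = exp (6 * real N)" by (simp flip: exp_add)
  finally show "real (card (lattice_pts N)) \<le> exp (6 * real N)" .
qed

text \<open>Rounding $x_i$ up or down according to the sign of $f_i$ never decreases $\sum_i f_i x_i$.\<close>
lemma round_to_lattice:
  assumes N: "N > 0" and x: "L2_set x {1..N} = 1"
  shows "\<exists>z\<in>lattice_pts N. (\<Sum>i\<in>{1..N}. f i * x i) \<le> (\<Sum>i\<in>{1..N}. f i * real_of_int (z i)) / sqrt (real N)"
proof -
  let ?r = "sqrt (real N)"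
  have r: "?r > 0" using N by simp
  define z where "z = (\<lambda>i\<in>{1..N}. if f i \<ge> 0 then \<lceil>?r * x i\<rceil> else \<lfloor>?r * x i\<rfloor>)"
  have z1: "\<bar>real_of_int (z i)\<bar> \<le> ?r * \<bar>x i\<bar> + 1" if "i \<in> {1..N}" for i
  proof -
    have "\<bar>real_of_int (z i) - ?r * x i\<bar> \<le> 1" using that unfolding z_def by (simp; linarith)
    moreover have "\<bar>?r * x i\<bar> = ?r * \<bar>x i\<bar>" by (simp add: abs_mult)
    ultimately show ?thesis by linarith
  qed
  have "L2_set (\<lambda>i. real_of_int (z i)) {1..N} = L2_set (\<lambda>i. \<bar>real_of_int (z i)\<bar>) {1..N}"
    by (simp add: L2_set_def)
  also have "\<dots> \<le> L2_set (\<lambda>i. ?r * \<bar>x i\<bar> + 1) {1..N}"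
    by (intro L2_set_mono z1) auto
  also have "\<dots> \<le> L2_set (\<lambda>i. ?r * \<bar>x i\<bar>) {1..N} + L2_set (\<lambda>i. 1) {1..N}"
    by (rule L2_set_triangle_ineq)
  also have "L2_set (\<lambda>i. ?r * \<bar>x i\<bar>) {1..N} = ?r * L2_set (\<lambda>i. \<bar>x i\<bar>) {1..N}"
    by (rule L2_set_right_distrib[symmetric]) simp
  also have "L2_set (\<lambda>i. \<bar>x i\<bar>) {1..N} = 1" using x by (simp add: L2_set_def)
  also have "L2_set (\<lambda>i. 1) {1..N} = ?r" by (simp add: L2_set_def)
  finally have "L2_set (\<lambda>i. real_of_int (z i)) {1..N} \<le> 2 * ?r" by simp
  then have "(L2_set (\<lambda>i. real_of_int (z i)) {1..N})\<^sup>2 \<le> (2 * ?r)\<^sup>2" by (intro power_mono) auto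
  then have "(\<Sum>i\<in>{1..N}. (real_of_int (z i))\<^sup>2) \<le> 4 * real N" unfolding L2_set_sq by simp
  then have "real_of_int (\<Sum>i\<in>{1..N}. (z i)\<^sup>2) \<le> real_of_int (4 * int N)" by simp
  then have "z \<in> lattice_pts N" unfolding of_int_le_iff by (auto simp: lattice_pts_def z_def)
  moreover have "?r * (\<Sum>i\<in>{1..N}. f i * x i) \<le> (\<Sum>i\<in>{1..N}. f i * real_of_int (z i))"
    unfolding sum_distrib_left
  proof (intro sum_mono)
    fix i assume i: "i \<in> {1..N}"
    have "f i * (?r * x i) \<le> f i * real_of_int (z i)"
    proof (cases "f i \<ge> 0")
      case True
      then show ?thesis using i by (intro mult_left_mono) (auto simp: z_def)
    next
      case False
      then show ?thesis using i by (intro mult_left_mono_neg) (auto simp: z_def)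
    qed
    then show "?r * (f i * x i) \<le> f i * real_of_int (z i)" by (simp add: mult.left_commute)
  qed
  ultimately show ?thesis using r by (intro bexI[of _ z]) (simp_all add: field_simps)
qed

text \<open>The norm of A x is the bilinear form at x and y = A x / ||A x||. Each of the two
  roundings can only increase the form, so the net causes no approximation error; the two divisions
  by sqrt N explain the factor N in the hypothesis.\<close>

lemma norm_le_of_lattice:
  assumes N: "N > 0" and t: "t \<ge> 0"
    and Q: "\<And>z w. z \<in> lattice_pts N \<Longrightarrow> w \<in> lattice_pts N \<Longrightarrow>
       (\<Sum>i\<in>{1..N}. \<Sum>j\<in>{1..N}. A i j * real_of_int (z i) * real_of_int (w j)) \<le> real N * t"
    and x: "L2_set x {1..N} = 1"
  shows "L2_set (matvec N A x) {1..N} \<le> t"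
proof (cases "L2_set (matvec N A x) {1..N} = 0")
  case False
  let ?r = "L2_set (matvec N A x) {1..N}"
  have r: "?r > 0" using False by (simp add: order_less_le)
  define y where "y i = (1 / ?r) * matvec N A x i" for i
  have y1: "L2_set y {1..N} = 1"
    unfolding y_def using r by (subst L2_set_right_distrib[symmetric]) auto
  from round_to_lattice[OF N y1, of "matvec N A x"] obtain z where z: "z \<in> lattice_pts N"
    "(\<Sum>i\<in>{1..N}. matvec N A x i * y i) \<le> (\<Sum>i\<in>{1..N}. matvec N A x i * real_of_int (z i)) / sqrt (real N)" by auto
  \<comment> \<open>With z fixed the form is linear in x with coefficients f, so x can be rounded in
    its turn.\<close>
  define f where "f j = (\<Sum>i\<in>{1..N}. A i j * real_of_int (z i))" for j
  have swap: "(\<Sum>i\<in>{1..N}. matvec N A v i * real_of_int (z i)) = (\<Sum>j\<in>{1..N}. f j * v j)" for v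
    unfolding matvec_def f_def sum_distrib_right by (subst sum.swap) (simp add: ac_simps)
  from round_to_lattice[OF N x, of f] obtain w where w: "w \<in> lattice_pts N"
    "(\<Sum>j\<in>{1..N}. f j * x j) \<le> (\<Sum>j\<in>{1..N}. f j * real_of_int (w j)) / sqrt (real N)" by auto
  have "(\<Sum>i\<in>{1..N}. matvec N A x i * y i) = (1 / ?r) * ?r\<^sup>2"
    unfolding L2_set_sq y_def sum_distrib_left by (simp add: power2_eq_square)
  also have "\<dots> = ?r" using r by (simp add: power2_eq_square)
  finally have "?r \<le> (\<Sum>j\<in>{1..N}. f j * x j) / sqrt (real N)" using z(2) unfolding swap by simp
  also have "\<dots> \<le> ((\<Sum>j\<in>{1..N}. f j * real_of_int (w j)) / sqrt (real N)) / sqrt (real N)"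
    using w(2) by (intro divide_right_mono) auto
  also have "\<dots> = (\<Sum>j\<in>{1..N}. f j * real_of_int (w j)) / real N" by simp
  also have "(\<Sum>j\<in>{1..N}. f j * real_of_int (w j)) = (\<Sum>i\<in>{1..N}. \<Sum>j\<in>{1..N}. A i j * real_of_int (z i) * real_of_int (w j))"
    unfolding f_def sum_distrib_right by (rule sum.swap)
  also have "\<dots> / real N \<le> t" using Q[OF z(1) w(1)] N by (simp add: field_simps)
  finally show ?thesis .
qed (use t in simp)

text \<open>Collecting positions that share a variable writes the form as a sum of independent terms
  b_e c_e. At most two positions share a variable, so the sum of c_e^2 is at most 2 (4N)(4N) = 32
  N^2. With ranges 2 R |c_e|, Hoeffding's exponent is 2 (N t)^2 / (4 R^2 32 N^2) = t^2 / (64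
  R^2).\<close>

lemma (in prob_space) bilinear_tail:
  fixes b :: "nat \<times> nat \<Rightarrow> 'a \<Rightarrow> real"
  assumes ind: "indep_vars (\<lambda>_. borel) b (upper_pairs N)"
    and bd: "\<And>e \<omega>. e \<in> upper_pairs N \<Longrightarrow> \<bar>b e \<omega>\<bar> \<le> R"
    and ctr: "\<And>e. e \<in> upper_pairs N \<Longrightarrow> expectation (b e) = 0"
    and R: "R > 0" and t: "t > 0" and N: "N > 0"
    and z: "(\<Sum>i\<in>{1..N}. (z i)\<^sup>2) \<le> 4 * real N" and w: "(\<Sum>i\<in>{1..N}. (w i)\<^sup>2) \<le> 4 * real N"
  shows "prob {\<omega>\<in>space M. (\<Sum>i\<in>{1..N}. \<Sum>j\<in>{1..N}. b (upair i j) \<omega> * z i * w j) \<ge> real N * t} \<le> exp (- (t\<^sup>2 / (64 * R\<^sup>2)))"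
proof -
  let ?S = "{1..N} \<times> {1..N}"
  let ?u = "\<lambda>p. upair (fst p) (snd p)"
  define F where "F e = {p \<in> ?S. ?u p = e}" for e
  define c where "c e = (\<Sum>p\<in>F e. z (fst p) * w (snd p))" for e
  have grp: "(\<Sum>e\<in>upper_pairs N. \<Sum>p\<in>F e. h p) = (\<Sum>p\<in>?S. h p)" for h :: "_ \<Rightarrow> real"
    unfolding F_def by (rule sum.group) auto
  have Q: "(\<Sum>i\<in>{1..N}. \<Sum>j\<in>{1..N}. b (upair i j) \<omega> * z i * w j) = (\<Sum>e\<in>upper_pairs N. b e \<omega> * c e)" for \<omega>
  proof -
    have "(\<Sum>i\<in>{1..N}. \<Sum>j\<in>{1..N}. b (upair i j) \<omega> * z i * w j) = (\<Sum>p\<in>?S. b (?u p) \<omega> * z (fst p) * w (snd p))"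
      by (simp add: sum.cartesian_product case_prod_unfold)
    also have "\<dots> = (\<Sum>e\<in>upper_pairs N. \<Sum>p\<in>F e. b (?u p) \<omega> * z (fst p) * w (snd p))" by (rule grp[symmetric])
    also have "\<dots> = (\<Sum>e\<in>upper_pairs N. b e \<omega> * c e)"
      unfolding c_def sum_distrib_left by (intro sum.cong refl) (auto simp: F_def)
    finally show ?thesis .
  qed
  have cardF: "card (F e) \<le> 2" for e
  proof -
    have "F e \<subseteq> {e, (snd e, fst e)}"
      by (auto simp: F_def upair_def min_def max_def)
    then have "card (F e) \<le> card {e, (snd e, fst e)}" by (intro card_mono) auto
    also have "\<dots> \<le> 2" by (simp add: card_insert_if)
    finally show ?thesis .
  qed
  have csq: "(c e)\<^sup>2 \<le> 2 * (\<Sum>p\<in>F e. (z (fst p))\<^sup>2 * (w (snd p))\<^sup>2)" for e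
  proof -
    have "(c e)\<^sup>2 = (\<Sum>p\<in>F e. 1 * (z (fst p) * w (snd p)))\<^sup>2" by (simp add: c_def)
    also have "\<dots> \<le> (\<Sum>p\<in>F e. 1\<^sup>2) * (\<Sum>p\<in>F e. (z (fst p) * w (snd p))\<^sup>2)"
      by (rule Cauchy_Schwarz_ineq_sum)
    also have "\<dots> \<le> 2 * (\<Sum>p\<in>F e. (z (fst p) * w (snd p))\<^sup>2)"
      using cardF[of e] by (intro mult_right_mono) (auto intro: sum_nonneg)
    finally show ?thesis by (simp add: power_mult_distrib)
  qed
  have sumc: "(\<Sum>e\<in>upper_pairs N. (c e)\<^sup>2) \<le> 32 * (real N)\<^sup>2"
  proof -
    have "(\<Sum>e\<in>upper_pairs N. (c e)\<^sup>2) \<le> 2 * (\<Sum>e\<in>upper_pairs N. \<Sum>p\<in>F e. (z (fst p))\<^sup>2 * (w (snd p))\<^sup>2)"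
      by (subst sum_distrib_left) (intro sum_mono csq)
    also have "\<dots> = 2 * ((\<Sum>i\<in>{1..N}. (z i)\<^sup>2) * (\<Sum>i\<in>{1..N}. (w i)\<^sup>2))"
      unfolding grp by (simp add: sum_product sum.cartesian_product case_prod_unfold)
    also have "\<dots> \<le> 2 * ((4 * real N) * (4 * real N))"
      using z w by (intro mult_left_mono mult_mono) (auto intro: sum_nonneg)
    finally show ?thesis by (simp add: power2_eq_square)
  qed
  show ?thesis
  \<comment> \<open>Hoeffding's inequality divides by the total squared range. If all coefficients
    vanish the form is 0, which is below N t, and the event is empty.\<close>
  proof (cases "(\<Sum>e\<in>upper_pairs N. (c e)\<^sup>2) = 0")
    case True
    then have "c e = 0" if "e \<in> upper_pairs N" for e using that
      by (subst (asm) sum_nonneg_eq_0_iff) auto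
    then have "{\<omega>\<in>space M. (\<Sum>i\<in>{1..N}. \<Sum>j\<in>{1..N}. b (upair i j) \<omega> * z i * w j) \<ge> real N * t} = {}"
      unfolding Q using N t by (auto simp: not_le)
    then show ?thesis by (simp only: measure_empty) simp
  next
    case False
    then have pos: "(\<Sum>e\<in>upper_pairs N. (c e)\<^sup>2) > 0" by (simp add: order_less_le sum_nonneg)
    interpret H: Hoeffding_ineq M "upper_pairs N" "\<lambda>e \<omega>. b e \<omega> * c e" "\<lambda>e. - (R * \<bar>c e\<bar>)" "\<lambda>e. R * \<bar>c e\<bar>"
      "\<Sum>e\<in>upper_pairs N. expectation (\<lambda>\<omega>. b e \<omega> * c e)"
    proof unfold_locales
      show "indep_vars (\<lambda>_. borel) (\<lambda>e \<omega>. b e \<omega> * c e) (upper_pairs N)"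
        by (rule indep_vars_compose2[OF ind]) auto
      show "AE \<omega> in M. b e \<omega> * c e \<in> {- (R * \<bar>c e\<bar>)..R * \<bar>c e\<bar>}" if "e \<in> upper_pairs N" for e
      proof (intro AE_I2)
        fix \<omega>
        have "\<bar>b e \<omega> * c e\<bar> \<le> R * \<bar>c e\<bar>" unfolding abs_mult using bd[OF that] by (intro mult_right_mono) auto
        then show "b e \<omega> * c e \<in> {- (R * \<bar>c e\<bar>)..R * \<bar>c e\<bar>}" by auto
      qed
    qed auto
    have mu: "(\<Sum>e\<in>upper_pairs N. expectation (\<lambda>\<omega>. b e \<omega> * c e)) = 0"
      using ctr by simp
    have wd: "(\<Sum>e\<in>upper_pairs N. (R * \<bar>c e\<bar> - - (R * \<bar>c e\<bar>))\<^sup>2) = 4 * R\<^sup>2 * (\<Sum>e\<in>upper_pairs N. (c e)\<^sup>2)"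
      unfolding sum_distrib_left by (intro sum.cong refl) (simp add: power2_eq_square algebra_simps flip: abs_mult)
    have "prob {\<omega>\<in>space M. (\<Sum>e\<in>upper_pairs N. b e \<omega> * c e) \<ge> 0 + real N * t}
      \<le> exp (-2 * (real N * t)\<^sup>2 / (4 * R\<^sup>2 * (\<Sum>e\<in>upper_pairs N. (c e)\<^sup>2)))"
      using H.Hoeffding_ineq_ge[of "real N * t", unfolded mu wd] t pos R by simp
    also have "\<dots> \<le> exp (- (t\<^sup>2 / (64 * R\<^sup>2)))"
    proof -
      have "t\<^sup>2 / (64 * R\<^sup>2) = 2 * (real N * t)\<^sup>2 / (4 * R\<^sup>2 * (32 * (real N)\<^sup>2))"
        using N R by (simp add: field_simps)
      also have "\<dots> \<le> 2 * (real N * t)\<^sup>2 / (4 * R\<^sup>2 * (\<Sum>e\<in>upper_pairs N. (c e)\<^sup>2))"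
        using sumc pos R N by (intro divide_left_mono mult_left_mono) auto
      finally show ?thesis by simp
    qed
    finally show ?thesis unfolding Q by simp
  qed
qed

text \<open>Union bound over pairs of lattice points: the entropy 12 N is twice the exponent of
  \<open>card_lattice_pts\<close>.\<close>

lemma (in prob_space) bounded_norm_tail:
  fixes b :: "nat \<times> nat \<Rightarrow> 'a \<Rightarrow> real"
  assumes ind: "indep_vars (\<lambda>_. borel) b (upper_pairs N)"
    and bd: "\<And>e \<omega>. e \<in> upper_pairs N \<Longrightarrow> \<bar>b e \<omega>\<bar> \<le> R"
    and ctr: "\<And>e. e \<in> upper_pairs N \<Longrightarrow> expectation (b e) = 0"
    and R: "R > 0" and t: "t > 0" and N: "N > 0"
  shows "\<exists>B\<in>events. prob B \<le> exp (12 * real N - t\<^sup>2 / (64 * R\<^sup>2)) \<and>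
     (\<forall>\<omega>\<in>space M - B. \<forall>x. L2_set x {1..N} = 1 \<longrightarrow>
        L2_set (matvec N (\<lambda>i j. b (upair i j) \<omega>) x) {1..N} \<le> t)"
proof -
  let ?L = "lattice_pts N"
  define E where "E z w = {\<omega>\<in>space M. (\<Sum>i\<in>{1..N}. \<Sum>j\<in>{1..N}. b (upair i j) \<omega> * real_of_int (z i) * real_of_int (w j)) \<ge> real N * t}" for z w :: "nat \<Rightarrow> int"
  define B where "B = (\<Union>p\<in>?L \<times> ?L. E (fst p) (snd p))"
  have rv [measurable]: "b (upair i j) \<in> borel_measurable M" if "i \<in> {1..N}" "j \<in> {1..N}" for i j
    using ind upair_in[OF that] unfolding indep_vars_def by auto
  have Em: "E z w \<in> events" for z w unfolding E_def by measurable
  have fin: "finite (?L \<times> ?L)" using card_lattice_pts by auto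
  have "B \<in> events" unfolding B_def using fin Em by auto
  moreover have "prob B \<le> exp (12 * real N - t\<^sup>2 / (64 * R\<^sup>2))"
  proof -
    have "prob B \<le> (\<Sum>p\<in>?L \<times> ?L. prob (E (fst p) (snd p)))"
      unfolding B_def using fin Em by (intro finite_measure_subadditive_finite) auto
    also have "\<dots> \<le> (\<Sum>p\<in>?L \<times> ?L. exp (- (t\<^sup>2 / (64 * R\<^sup>2))))"
    proof (intro sum_mono)
      fix p assume p: "p \<in> ?L \<times> ?L"
      have le: "(\<Sum>i\<in>{1..N}. (real_of_int (z i))\<^sup>2) \<le> 4 * real N" if "z \<in> ?L" for z
      proof -
        have "real_of_int (\<Sum>i\<in>{1..N}. (z i)\<^sup>2) \<le> real_of_int (4 * int N)"
          using that unfolding of_int_le_iff lattice_pts_def by blast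
        then show ?thesis by simp
      qed
      show "prob (E (fst p) (snd p)) \<le> exp (- (t\<^sup>2 / (64 * R\<^sup>2)))"
        unfolding E_def using p by (intro bilinear_tail[OF ind bd ctr R t N] le) auto
    qed
    also have "\<dots> = (real (card ?L))\<^sup>2 * exp (- (t\<^sup>2 / (64 * R\<^sup>2)))"
      by (simp add: card_cartesian_product power2_eq_square)
    also have "\<dots> \<le> (exp (6 * real N))\<^sup>2 * exp (- (t\<^sup>2 / (64 * R\<^sup>2)))"
      using card_lattice_pts(2)[of N] by (intro mult_right_mono power_mono) auto
    also have "\<dots> = exp (12 * real N - t\<^sup>2 / (64 * R\<^sup>2))"
      by (simp add: power2_eq_square flip: exp_add)
    finally show ?thesis .
  qed
  moreover have "L2_set (matvec N (\<lambda>i j. b (upair i j) \<omega>) x) {1..N} \<le> t"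
    if \<omega>: "\<omega> \<in> space M - B" and x: "L2_set x {1..N} = 1" for \<omega> x
  proof (rule norm_le_of_lattice[OF N _ _ x])
    fix z w assume "z \<in> ?L" "w \<in> ?L"
    then have "\<omega> \<notin> E z w" using \<omega> by (force simp: B_def)
    then show "(\<Sum>i\<in>{1..N}. \<Sum>j\<in>{1..N}. b (upair i j) \<omega> * real_of_int (z i) * real_of_int (w j)) \<le> real N * t"
      using \<omega> by (auto simp: E_def)
  qed (use t in simp)
  ultimately show ?thesis by blast
qed

subsection \<open>Exponential moments\<close>

text \<open>The Lagrange remainder is u^2/2 e^t with |t| at most |u|; the two bounds insert the
  extreme values of t.\<close>

lemma exp_two_sided:
  fixes u :: real
  shows "exp u \<le> 1 + u + u\<^sup>2 / 2 * exp \<bar>u\<bar>" "1 + u + u\<^sup>2 / 2 * exp (- \<bar>u\<bar>) \<le> exp u"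
proof -
  from Maclaurin_exp_le[of u 2] obtain t where t: "\<bar>t\<bar> \<le> \<bar>u\<bar>"
    "exp u = (\<Sum>m<2. u ^ m / fact m) + exp t / fact 2 * u ^ 2" by auto
  then have eq: "exp u = 1 + u + u\<^sup>2 / 2 * exp t" by (simp add: numeral_2_eq_2)
  show "exp u \<le> 1 + u + u\<^sup>2 / 2 * exp \<bar>u\<bar>" "1 + u + u\<^sup>2 / 2 * exp (- \<bar>u\<bar>) \<le> exp u"
    unfolding eq using t(1) by (auto intro!: mult_left_mono)
qed

text \<open>Puts a lower bound 1 + v in exponential form, so that it can be multiplied over
  independent variables; the loss is expressed through w alone.\<close>

lemma exp_le_one_plus:
  fixes v w :: real
  assumes "\<bar>v\<bar> \<le> w" "w \<le> 1/2"
  shows "exp (v - 2 * w\<^sup>2) \<le> 1 + v"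
proof -
  have "\<bar>ln (1 + v) - v\<bar> \<le> 2 * v\<^sup>2" by (rule abs_ln_one_plus_x_minus_x_bound) (use assms in simp)
  moreover have "v\<^sup>2 \<le> w\<^sup>2" using assms by (metis abs_ge_zero power2_abs power_mono)
  ultimately have "v - 2 * w\<^sup>2 \<le> ln (1 + v)" by linarith
  then have "exp (v - 2 * w\<^sup>2) \<le> exp (ln (1 + v))" by simp
  also have "\<dots> = 1 + v" using assms by (intro exp_ln) auto
  finally show ?thesis .
qed

text \<open>Truncation spoils centring by at most \<beta> and the variance by at most \<beta>'; both
  errors are carried along. The factors exp(|l| T) and exp(-|l| T) come from the remainder in
  \<open>exp_two_sided\<close> and tend to 1 once l T does to 0, so both bounds have leading
  exponent l^2 v / 2.\<close>

lemma (in prob_space) mgf_bounds: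
  fixes Y :: "'a \<Rightarrow> real" and l :: real
  assumes rv [measurable]: "Y \<in> borel_measurable M" and bd: "\<And>\<omega>. \<bar>Y \<omega>\<bar> \<le> T"
    and mean: "\<bar>expectation Y\<bar> \<le> \<beta>"
    and var: "expectation (\<lambda>\<omega>. (Y \<omega>)\<^sup>2) \<le> v" "v - \<beta>' \<le> expectation (\<lambda>\<omega>. (Y \<omega>)\<^sup>2)"
    and v: "v \<le> 1" and \<beta>': "\<beta>' \<ge> 0"
    and small: "\<bar>l\<bar> * \<beta> + l\<^sup>2 / 2 \<le> 1 / 2"
  shows "integrable M (\<lambda>\<omega>. exp (l * Y \<omega>))"
    and "expectation (\<lambda>\<omega>. exp (l * Y \<omega>)) \<le> exp (\<bar>l\<bar> * \<beta> + l\<^sup>2 / 2 * v * exp (\<bar>l\<bar> * T))"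
    and "exp (- (\<bar>l\<bar> * \<beta>) + l\<^sup>2 / 2 * v * exp (- (\<bar>l\<bar> * T)) - l\<^sup>2 / 2 * \<beta>' - 2 * (\<bar>l\<bar> * \<beta> + l\<^sup>2 / 2)\<^sup>2)
       \<le> expectation (\<lambda>\<omega>. exp (l * Y \<omega>))"
proof -
  let ?E2 = "expectation (\<lambda>\<omega>. (Y \<omega>)\<^sup>2)"
  have lY: "\<bar>l * Y \<omega>\<bar> \<le> \<bar>l\<bar> * T" for \<omega>
    unfolding abs_mult using bd by (intro mult_left_mono) auto
  have T: "T \<ge> 0" using bd[of undefined] by linarith
  have E2: "?E2 \<ge> 0" by simp
  have i1: "integrable M Y" by (rule integrable_const_bound[where B=T]) (use bd in auto)
  have i2: "integrable M (\<lambda>\<omega>. (Y \<omega>)\<^sup>2)"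
    by (rule integrable_const_bound[where B="T\<^sup>2"]) (use bd T in \<open>auto simp: abs_le_square_iff[symmetric]\<close>)
  show ie: "integrable M (\<lambda>\<omega>. exp (l * Y \<omega>))"
    by (rule integrable_const_bound[where B="exp (\<bar>l\<bar> * T)"]) (use lY in \<open>auto intro: abs_le_D1\<close>)
  have q: "expectation (\<lambda>\<omega>. 1 + l * Y \<omega> + l\<^sup>2 / 2 * h * (Y \<omega>)\<^sup>2) = 1 + l * expectation Y + l\<^sup>2 / 2 * h * ?E2" for h
    using i1 i2 by (simp add: prob_space)
  have lb: "\<bar>l * expectation Y\<bar> \<le> \<bar>l\<bar> * \<beta>" unfolding abs_mult using mean by (intro mult_left_mono) auto
  have "expectation (\<lambda>\<omega>. exp (l * Y \<omega>)) \<le> expectation (\<lambda>\<omega>. 1 + l * Y \<omega> + l\<^sup>2 / 2 * exp (\<bar>l\<bar> * T) * (Y \<omega>)\<^sup>2)"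
  proof (intro integral_mono ie)
    fix \<omega>
    have "exp (l * Y \<omega>) \<le> 1 + l * Y \<omega> + (l * Y \<omega>)\<^sup>2 / 2 * exp \<bar>l * Y \<omega>\<bar>" by (rule exp_two_sided)
    also have "\<dots> \<le> 1 + l * Y \<omega> + (l * Y \<omega>)\<^sup>2 / 2 * exp (\<bar>l\<bar> * T)"
      using lY by (intro add_left_mono mult_left_mono) auto
    finally show "exp (l * Y \<omega>) \<le> 1 + l * Y \<omega> + l\<^sup>2 / 2 * exp (\<bar>l\<bar> * T) * (Y \<omega>)\<^sup>2"
      by (simp add: power_mult_distrib mult_ac)
  qed (use i1 i2 in auto)
  also have "\<dots> = 1 + l * expectation Y + l\<^sup>2 / 2 * exp (\<bar>l\<bar> * T) * ?E2" by (rule q)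
  also have "\<dots> \<le> 1 + (\<bar>l\<bar> * \<beta> + l\<^sup>2 / 2 * exp (\<bar>l\<bar> * T) * v)"
    using lb var(1) mult_left_mono[OF var(1), of "l\<^sup>2 / 2 * exp (\<bar>l\<bar> * T)"] by auto
  also have "\<dots> \<le> exp (\<bar>l\<bar> * \<beta> + l\<^sup>2 / 2 * exp (\<bar>l\<bar> * T) * v)" by (rule exp_ge_add_one_self)
  finally show "expectation (\<lambda>\<omega>. exp (l * Y \<omega>)) \<le> exp (\<bar>l\<bar> * \<beta> + l\<^sup>2 / 2 * v * exp (\<bar>l\<bar> * T))"
    by (simp add: mult_ac)
  define d where "d = exp (- (\<bar>l\<bar> * T))"
  have d: "0 < d" "d \<le> 1" using T by (auto simp: d_def)
  \<comment> \<open>1 + r is the expectation of the quadratic minorant of exp(l Y); r must lie in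
    the range of \<open>exp_le_one_plus\<close>.\<close>
  define r where "r = l * expectation Y + l\<^sup>2 / 2 * d * ?E2"
  have dE2: "d * ?E2 \<le> 1" using d E2 var(1) v by (meson mult_le_one order.trans)
  have dE0: "d * ?E2 \<ge> 0" using d E2 by simp
  have rbd: "\<bar>r\<bar> \<le> \<bar>l\<bar> * \<beta> + l\<^sup>2 / 2"
  proof -
    have "l\<^sup>2 / 2 * (d * ?E2) \<le> l\<^sup>2 / 2 * 1" using dE2 by (intro mult_left_mono) auto
    moreover have "0 \<le> l\<^sup>2 / 2 * (d * ?E2)" using dE0 by simp
    ultimately show ?thesis using lb unfolding r_def mult.assoc by linarith
  qed
  have "- (\<bar>l\<bar> * \<beta>) + l\<^sup>2 / 2 * v * d - l\<^sup>2 / 2 * \<beta>' \<le> r"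
  proof -
    have "d * (v - \<beta>') \<le> d * ?E2" using d var(2) by (intro mult_left_mono) auto
    moreover have "d * \<beta>' \<le> 1 * \<beta>'" using d \<beta>' by (intro mult_right_mono) auto
    ultimately have "v * d - \<beta>' \<le> d * ?E2" by (simp add: algebra_simps)
    then have "l\<^sup>2 / 2 * (v * d - \<beta>') \<le> l\<^sup>2 / 2 * (d * ?E2)" by (intro mult_left_mono) auto
    then show ?thesis using lb unfolding r_def mult.assoc right_diff_distrib by linarith
  qed
  then have "exp (- (\<bar>l\<bar> * \<beta>) + l\<^sup>2 / 2 * v * d - l\<^sup>2 / 2 * \<beta>' - 2 * (\<bar>l\<bar> * \<beta> + l\<^sup>2 / 2)\<^sup>2)
     \<le> exp (r - 2 * (\<bar>l\<bar> * \<beta> + l\<^sup>2 / 2)\<^sup>2)" by simp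
  also have "\<dots> \<le> 1 + r" by (rule exp_le_one_plus[OF rbd small])
  also have "\<dots> = expectation (\<lambda>\<omega>. 1 + l * Y \<omega> + l\<^sup>2 / 2 * d * (Y \<omega>)\<^sup>2)" unfolding r_def q by simp
  also have "\<dots> \<le> expectation (\<lambda>\<omega>. exp (l * Y \<omega>))"
  proof (intro integral_mono ie)
    fix \<omega>
    have "1 + l * Y \<omega> + (l * Y \<omega>)\<^sup>2 / 2 * d \<le> 1 + l * Y \<omega> + (l * Y \<omega>)\<^sup>2 / 2 * exp (- \<bar>l * Y \<omega>\<bar>)"
      using lY unfolding d_def by (intro add_left_mono mult_left_mono) auto
    also have "\<dots> \<le> exp (l * Y \<omega>)" by (rule exp_two_sided)
    finally show "1 + l * Y \<omega> + l\<^sup>2 / 2 * d * (Y \<omega>)\<^sup>2 \<le> exp (l * Y \<omega>)"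
      by (simp add: power_mult_distrib mult_ac)
  qed (use i1 i2 in auto)
  finally show "exp (- (\<bar>l\<bar> * \<beta>) + l\<^sup>2 / 2 * v * exp (- (\<bar>l\<bar> * T)) - l\<^sup>2 / 2 * \<beta>' - 2 * (\<bar>l\<bar> * \<beta> + l\<^sup>2 / 2)\<^sup>2)
       \<le> expectation (\<lambda>\<omega>. exp (l * Y \<omega>))" unfolding d_def .
qed

text \<open>The variances v e stay individual so that the leading exponent involves their exact sum;
  only the error terms are multiplied by the number of summands.\<close>

lemma (in prob_space) mgf_sum_bounds:
  fixes Y :: "'b \<Rightarrow> 'a \<Rightarrow> real" and l :: real
  assumes fin: "finite I" and ind: "indep_vars (\<lambda>_. borel) Y I"
    and bd: "\<And>e \<omega>. e \<in> I \<Longrightarrow> \<bar>Y e \<omega>\<bar> \<le> T"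
    and mean: "\<And>e. e \<in> I \<Longrightarrow> \<bar>expectation (Y e)\<bar> \<le> \<beta>"
    and var: "\<And>e. e \<in> I \<Longrightarrow> expectation (\<lambda>\<omega>. (Y e \<omega>)\<^sup>2) \<le> v e"
      "\<And>e. e \<in> I \<Longrightarrow> v e - \<beta>' \<le> expectation (\<lambda>\<omega>. (Y e \<omega>)\<^sup>2)"
    and v: "\<And>e. e \<in> I \<Longrightarrow> v e \<le> 1" and \<beta>': "\<beta>' \<ge> 0"
    and small: "\<bar>l\<bar> * \<beta> + l\<^sup>2 / 2 \<le> 1 / 2"
  defines "n \<equiv> real (card I)"
  shows "integrable M (\<lambda>\<omega>. exp (l * (\<Sum>e\<in>I. Y e \<omega>)))"
    and "expectation (\<lambda>\<omega>. exp (l * (\<Sum>e\<in>I. Y e \<omega>))) \<le> exp (n * (\<bar>l\<bar> * \<beta>) + l\<^sup>2 / 2 * sum v I * exp (\<bar>l\<bar> * T))"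
    and "exp (l\<^sup>2 / 2 * sum v I * exp (- (\<bar>l\<bar> * T)) - n * (\<bar>l\<bar> * \<beta> + l\<^sup>2 / 2 * \<beta>' + 2 * (\<bar>l\<bar> * \<beta> + l\<^sup>2 / 2)\<^sup>2))
       \<le> expectation (\<lambda>\<omega>. exp (l * (\<Sum>e\<in>I. Y e \<omega>)))"
proof -
  have rv: "Y e \<in> borel_measurable M" if "e \<in> I" for e
    using ind that unfolding indep_vars_def by auto
  have indl: "indep_vars (\<lambda>_. borel) (\<lambda>e \<omega>. exp (l * Y e \<omega>)) I"
    by (rule indep_vars_compose2[OF ind]) auto
  have eq: "exp (l * (\<Sum>e\<in>I. Y e \<omega>)) = (\<Prod>e\<in>I. exp (l * Y e \<omega>))" for \<omega>
    by (simp add: sum_distrib_left exp_sum fin)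
  note mb = mgf_bounds[OF rv bd mean var v \<beta>' small]
  show "integrable M (\<lambda>\<omega>. exp (l * (\<Sum>e\<in>I. Y e \<omega>)))"
    unfolding eq by (rule indep_vars_integrable[OF fin indl]) (auto intro: mb)
  have E: "expectation (\<lambda>\<omega>. exp (l * (\<Sum>e\<in>I. Y e \<omega>))) = (\<Prod>e\<in>I. expectation (\<lambda>\<omega>. exp (l * Y e \<omega>)))"
    unfolding eq by (rule indep_vars_lebesgue_integral[OF fin indl]) (auto intro: mb)
  have "(\<Prod>e\<in>I. expectation (\<lambda>\<omega>. exp (l * Y e \<omega>))) \<le> (\<Prod>e\<in>I. exp (\<bar>l\<bar> * \<beta> + l\<^sup>2 / 2 * v e * exp (\<bar>l\<bar> * T)))"
    by (intro prod_mono conjI mb) (auto intro: integral_nonneg)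
  also have "\<dots> = exp (n * (\<bar>l\<bar> * \<beta>) + l\<^sup>2 / 2 * sum v I * exp (\<bar>l\<bar> * T))"
    by (simp add: exp_sum[symmetric] fin sum.distrib n_def sum_distrib_left sum_distrib_right)
  finally show "expectation (\<lambda>\<omega>. exp (l * (\<Sum>e\<in>I. Y e \<omega>))) \<le> exp (n * (\<bar>l\<bar> * \<beta>) + l\<^sup>2 / 2 * sum v I * exp (\<bar>l\<bar> * T))"
    unfolding E .
  let ?w = "\<bar>l\<bar> * \<beta> + l\<^sup>2 / 2 * \<beta>' + 2 * (\<bar>l\<bar> * \<beta> + l\<^sup>2 / 2)\<^sup>2"
  have "exp (l\<^sup>2 / 2 * sum v I * exp (- (\<bar>l\<bar> * T)) - n * ?w) = (\<Prod>e\<in>I. exp (l\<^sup>2 / 2 * v e * exp (- (\<bar>l\<bar> * T)) - ?w))"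
    by (simp only: exp_sum[symmetric] fin sum_subtractf sum_constant n_def sum_distrib_left sum_distrib_right)
  also have "\<dots> \<le> (\<Prod>e\<in>I. expectation (\<lambda>\<omega>. exp (l * Y e \<omega>)))"
  proof (intro prod_mono conjI)
    fix e assume e: "e \<in> I"
    show "exp (l\<^sup>2 / 2 * v e * exp (- (\<bar>l\<bar> * T)) - ?w) \<le> expectation (\<lambda>\<omega>. exp (l * Y e \<omega>))"
      using mb(3)[OF e e e e e e] by (simp add: algebra_simps)
  qed simp
  finally show "exp (l\<^sup>2 / 2 * sum v I * exp (- (\<bar>l\<bar> * T)) - n * ?w)
       \<le> expectation (\<lambda>\<omega>. exp (l * (\<Sum>e\<in>I. Y e \<omega>)))" unfolding E .
qed

section \<open>Upper tails by Chernoff, lower bounds by tilting\<close>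

lemma (in prob_space) chernoff:
  fixes Z :: "'a \<Rightarrow> real"
  assumes "integrable M (\<lambda>\<omega>. exp (Z \<omega>))"
  shows "prob {\<omega>\<in>space M. Z \<omega> \<ge> t} \<le> exp (- t) * expectation (\<lambda>\<omega>. exp (Z \<omega>))"
proof -
  have "prob {\<omega>\<in>space M. exp (Z \<omega>) \<ge> exp t} \<le> expectation (\<lambda>\<omega>. exp (Z \<omega>)) / exp t"
    by (intro integral_Markov_inequality_measure[where A="{}"] assms) auto
  then show ?thesis by (simp add: exp_minus field_simps)
qed

text \<open>Exponential tilting: under the density proportional to $e^{cZ}$, the variable $Z$
  concentrates near $cv\ell$.\<close>
lemma (in prob_space) tilted_lower_bound:
  fixes Z :: "'a \<Rightarrow> real" and c v \<eta> \<zeta> l :: real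
  assumes rv [measurable]: "Z \<in> borel_measurable M"
    and int: "integrable M (\<lambda>\<omega>. exp (c * Z \<omega>))" "integrable M (\<lambda>\<omega>. exp ((c - \<eta>) * Z \<omega>))"
      "integrable M (\<lambda>\<omega>. exp ((c + \<eta>) * Z \<omega>))"
    and lo: "exp ((c\<^sup>2 / 2 * v - \<zeta>) * l) \<le> expectation (\<lambda>\<omega>. exp (c * Z \<omega>))"
    and up: "expectation (\<lambda>\<omega>. exp ((c - \<eta>) * Z \<omega>)) \<le> exp (((c - \<eta>)\<^sup>2 / 2 * v + \<zeta>) * l)"
      "expectation (\<lambda>\<omega>. exp ((c + \<eta>) * Z \<omega>)) \<le> exp (((c + \<eta>)\<^sup>2 / 2 * v + \<zeta>) * l)"
    and c: "c \<ge> 0" and \<eta>: "\<eta> \<ge> 0" and v: "v \<le> 1" and l: "l \<ge> 0"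
  shows "exp (- (c\<^sup>2 / 2 * v + c * \<eta> + \<zeta>) * l) * (1 - 2 * exp (- (\<eta>\<^sup>2 / 2 - 2 * \<zeta>) * l))
    \<le> prob {\<omega>\<in>space M. Z \<omega> \<ge> (c * v - \<eta>) * l}"
proof -
  let ?a = "(c * v - \<eta>) * l" and ?b = "(c * v + \<eta>) * l"
  let ?S = "{\<omega>\<in>space M. Z \<omega> \<ge> ?a}"
  have S [measurable]: "?S \<in> events" by measurable
  \<comment> \<open>Outside the window [?a, ?b] the tilt is moved by \<eta> towards the side where Z
    lies; this costs the constant factor evaluated at the nearer end of the window. Inside, exp(c Z)
    is at most its value at ?b.\<close>
  have pt: "exp (c * Z \<omega>) \<le> exp (c * ?b) * indicator ?S \<omega> + exp (\<eta> * ?a) * exp ((c - \<eta>) * Z \<omega>)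
      + exp (- (\<eta> * ?b)) * exp ((c + \<eta>) * Z \<omega>)" if "\<omega> \<in> space M" for \<omega>
  proof -
    consider "Z \<omega> < ?a" | "Z \<omega> > ?b" | "?a \<le> Z \<omega>" "Z \<omega> \<le> ?b" by linarith
    then show ?thesis
    proof cases
      case 1
      then have "\<eta> * Z \<omega> \<le> \<eta> * ?a" using \<eta> by (intro mult_left_mono) auto
      then have "exp (c * Z \<omega>) \<le> exp (\<eta> * ?a) * exp ((c - \<eta>) * Z \<omega>)"
        unfolding exp_add[symmetric] by (simp add: algebra_simps)
      moreover have "0 \<le> exp (c * ?b) * indicator ?S \<omega>" "0 \<le> exp (- (\<eta> * ?b)) * exp ((c + \<eta>) * Z \<omega>)" by auto
      ultimately show ?thesis by linarith
    next
      case 2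
      then have "\<eta> * ?b \<le> \<eta> * Z \<omega>" using \<eta> by (intro mult_left_mono) auto
      then have "exp (c * Z \<omega>) \<le> exp (- (\<eta> * ?b)) * exp ((c + \<eta>) * Z \<omega>)"
        unfolding exp_add[symmetric] by (simp add: algebra_simps)
      moreover have "0 \<le> exp (c * ?b) * indicator ?S \<omega>" "0 \<le> exp (\<eta> * ?a) * exp ((c - \<eta>) * Z \<omega>)" by auto
      ultimately show ?thesis by linarith
    next
      case 3
      then have "c * Z \<omega> \<le> c * ?b" using c by (intro mult_left_mono) auto
      then have "exp (c * Z \<omega>) \<le> exp (c * ?b) * indicator ?S \<omega>" using 3 that by simp
      moreover have "0 \<le> exp (- (\<eta> * ?b)) * exp ((c + \<eta>) * Z \<omega>)" "0 \<le> exp (\<eta> * ?a) * exp ((c - \<eta>) * Z \<omega>)" by auto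
      ultimately show ?thesis by linarith
    qed
  qed
  let ?m = "exp ((c\<^sup>2 / 2 * v - \<zeta>) * l)" and ?d = "exp (- (\<eta>\<^sup>2 / 2 - 2 * \<zeta>) * l)"
  \<comment> \<open>Completing the squares leaves \<eta>^2 v/2 - \<eta>^2 in both tails, which v <=
    1 turns into at most -\<eta>^2/2. The 2 \<zeta> in \<open>?d\<close> pays for comparing an upper
    bound, with +\<zeta>, to the lower bound \<open>?m\<close>, with -\<zeta>.\<close>
  have "\<eta>\<^sup>2 / 2 * v \<le> \<eta>\<^sup>2 / 2 * 1" using v by (intro mult_left_mono) auto
  then have key: "(\<eta>\<^sup>2 / 2 * v - \<eta>\<^sup>2) * l \<le> - (\<eta>\<^sup>2 / 2) * l" using l by (intro mult_right_mono) auto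
  let ?k = "(c\<^sup>2 / 2 * v - \<zeta>) * l + - (\<eta>\<^sup>2 / 2 - 2 * \<zeta>) * l"
  have "\<eta> * ?a + ((c - \<eta>)\<^sup>2 / 2 * v + \<zeta>) * l = ?k + ((\<eta>\<^sup>2 / 2 * v - \<eta>\<^sup>2) * l + \<eta>\<^sup>2 / 2 * l)"
    "- (\<eta> * ?b) + ((c + \<eta>)\<^sup>2 / 2 * v + \<zeta>) * l = ?k + ((\<eta>\<^sup>2 / 2 * v - \<eta>\<^sup>2) * l + \<eta>\<^sup>2 / 2 * l)"
    by (simp_all add: field_simps power2_eq_square)
  then have e1: "exp (\<eta> * ?a) * exp (((c - \<eta>)\<^sup>2 / 2 * v + \<zeta>) * l) \<le> ?m * ?d"
    and e2: "exp (- (\<eta> * ?b)) * exp (((c + \<eta>)\<^sup>2 / 2 * v + \<zeta>) * l) \<le> ?m * ?d"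
    unfolding exp_add[symmetric] exp_le_cancel_iff using key by linarith+
  have iS: "integrable M (indicator ?S :: 'a \<Rightarrow> real)" by (rule integrable_real_indicator) (auto simp: emeasure_eq_measure)
  have "?m \<le> expectation (\<lambda>\<omega>. exp (c * Z \<omega>))" by (rule lo)
  also have "\<dots> \<le> expectation (\<lambda>\<omega>. exp (c * ?b) * indicator ?S \<omega> + exp (\<eta> * ?a) * exp ((c - \<eta>) * Z \<omega>)
      + exp (- (\<eta> * ?b)) * exp ((c + \<eta>) * Z \<omega>))"
    by (intro integral_mono int pt Bochner_Integration.integrable_add integrable_mult_right iS)
  also have "\<dots> = exp (c * ?b) * prob ?S + exp (\<eta> * ?a) * expectation (\<lambda>\<omega>. exp ((c - \<eta>) * Z \<omega>))
      + exp (- (\<eta> * ?b)) * expectation (\<lambda>\<omega>. exp ((c + \<eta>) * Z \<omega>))"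
    using int iS by (simp add: Int_absorb1)
  also have "\<dots> \<le> exp (c * ?b) * prob ?S + exp (\<eta> * ?a) * exp (((c - \<eta>)\<^sup>2 / 2 * v + \<zeta>) * l)
      + exp (- (\<eta> * ?b)) * exp (((c + \<eta>)\<^sup>2 / 2 * v + \<zeta>) * l)"
    using up by (intro add_mono mult_left_mono) auto
  also have "\<dots> \<le> exp (c * ?b) * prob ?S + ?m * ?d + ?m * ?d" using e1 e2 by linarith
  finally have "?m * (1 - 2 * ?d) \<le> exp (c * ?b) * prob ?S" by (simp add: algebra_simps)
  then have "exp (- (c * ?b)) * (?m * (1 - 2 * ?d)) \<le> exp (- (c * ?b)) * (exp (c * ?b) * prob ?S)"
    by (intro mult_left_mono) auto
  also have "\<dots> = prob ?S" by (simp add: mult.assoc[symmetric] flip: exp_add)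
  also have "exp (- (c * ?b)) * (?m * (1 - 2 * ?d)) = exp (- (c\<^sup>2 / 2 * v + c * \<eta> + \<zeta>) * l) * (1 - 2 * ?d)"
  proof -
    have "- (c * ?b) + (c\<^sup>2 / 2 * v - \<zeta>) * l = - (c\<^sup>2 / 2 * v + c * \<eta> + \<zeta>) * l"
      by (simp add: field_simps power2_eq_square)
    then show ?thesis by (simp only: mult.assoc[symmetric] exp_add[symmetric])
  qed
  finally show ?thesis .
qed

subsection \<open>Truncated generalised Wigner matrices\<close>

text \<open>Integrability of the p-th absolute moment is assumed separately because
  \<open>expectation\<close> is 0 on non-integrable functions. In the application v1 and v2 are the
  infimum and the supremum of the variances.\<close>

locale wigner = prob_space M for M :: "'a measure" +
  fixes X :: "nat \<Rightarrow> nat \<times> nat \<Rightarrow> 'a \<Rightarrow> real" and p K v1 v2 :: real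
  assumes indep: "\<And>N. indep_vars (\<lambda>_. borel) (X N) (upper_pairs N)"
    and p_gt: "p > 6"
    and moment_int: "\<And>N e. e \<in> upper_pairs N \<Longrightarrow> integrable M (\<lambda>\<omega>. \<bar>X N e \<omega>\<bar> powr p)"
    and moment: "\<And>N e. e \<in> upper_pairs N \<Longrightarrow> expectation (\<lambda>\<omega>. \<bar>X N e \<omega>\<bar> powr p) \<le> K"
    and centred: "\<And>N e. e \<in> upper_pairs N \<Longrightarrow> expectation (X N e) = 0"
    and var_lower: "\<And>N e. e \<in> upper_pairs N \<Longrightarrow> v1 \<le> expectation (\<lambda>\<omega>. (X N e \<omega>)\<^sup>2)"
    and var_upper: "\<And>N e. e \<in> upper_pairs N \<Longrightarrow> expectation (\<lambda>\<omega>. (X N e \<omega>)\<^sup>2) \<le> v2"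
    and v1_pos: "v1 > 0" and v2_le_1: "v2 \<le> 1" and K_pos: "K > 0"
begin

lemma rv: "e \<in> upper_pairs N \<Longrightarrow> X N e \<in> borel_measurable M"
  using indep[of N] unfolding indep_vars_def by auto

lemma power_le_moment:
  fixes x T :: real
  assumes "q \<le> 2" "T > 0" "\<bar>x\<bar> > T"
  shows "\<bar>x\<bar> ^ q \<le> \<bar>x\<bar> powr p * T powr (real q - p)"
proof -
  have "\<bar>x\<bar> ^ q = \<bar>x\<bar> powr p * \<bar>x\<bar> powr (real q - p)"
    using assms by (simp add: powr_realpow flip: powr_add)
  also have "\<dots> \<le> \<bar>x\<bar> powr p * T powr (real q - p)"
    using assms p_gt by (intro mult_left_mono powr_mono2') auto
  finally show ?thesis .
qed

lemma integrable_power: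
  assumes e: "e \<in> upper_pairs N" and q: "q \<le> 2"
  shows "integrable M (\<lambda>\<omega>. X N e \<omega> ^ q)"
proof (rule Bochner_Integration.integrable_bound)
  show "integrable M (\<lambda>\<omega>. 1 + \<bar>X N e \<omega>\<bar> powr p)" using moment_int[OF e] by auto
  show "AE \<omega> in M. norm (X N e \<omega> ^ q) \<le> norm (1 + \<bar>X N e \<omega>\<bar> powr p)"
  proof (intro AE_I2)
    fix \<omega>
    show "norm (X N e \<omega> ^ q) \<le> norm (1 + \<bar>X N e \<omega>\<bar> powr p)"
    proof (cases "\<bar>X N e \<omega>\<bar> > 1")
      case True
      then show ?thesis using power_le_moment[OF q, of 1 "X N e \<omega>"] by (simp add: power_abs)
    next
      case False
      then show ?thesis using power_le_one[of "\<bar>X N e \<omega>\<bar>" q]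
        by (simp add: power_abs) (smt (verit) powr_ge_zero)
    qed
  qed
qed (use rv[OF e] in measurable)

text \<open>On |X| > T a power with the negative exponent q - p is at most its value at T. The case
  q = 0 is the tail probability, q = 1 the shift of the mean under truncation and q = 2 the loss of
  variance.\<close>

lemma tail_moment:
  assumes e: "e \<in> upper_pairs N" and q: "q \<le> 2" and T: "T > 0"
  shows "integrable M (\<lambda>\<omega>. if \<bar>X N e \<omega>\<bar> > T then \<bar>X N e \<omega>\<bar> ^ q else 0)"
    "expectation (\<lambda>\<omega>. if \<bar>X N e \<omega>\<bar> > T then \<bar>X N e \<omega>\<bar> ^ q else 0) \<le> K * T powr (real q - p)"
proof -
  note [measurable] = rv[OF e]
  show i: "integrable M (\<lambda>\<omega>. if \<bar>X N e \<omega>\<bar> > T then \<bar>X N e \<omega>\<bar> ^ q else 0)"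
    by (rule Bochner_Integration.integrable_bound[OF integrable_power[OF e q]]) (auto simp: power_abs)
  have "expectation (\<lambda>\<omega>. if \<bar>X N e \<omega>\<bar> > T then \<bar>X N e \<omega>\<bar> ^ q else 0) \<le> expectation (\<lambda>\<omega>. \<bar>X N e \<omega>\<bar> powr p * T powr (real q - p))"
    using moment_int[OF e] power_le_moment[OF q T] by (intro integral_mono i) auto
  also have "\<dots> = expectation (\<lambda>\<omega>. \<bar>X N e \<omega>\<bar> powr p) * T powr (real q - p)" by simp
  also have "\<dots> \<le> K * T powr (real q - p)" using moment[OF e] by (intro mult_right_mono) auto
  finally show "expectation (\<lambda>\<omega>. if \<bar>X N e \<omega>\<bar> > T then \<bar>X N e \<omega>\<bar> ^ q else 0) \<le> K * T powr (real q - p)" .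
qed

text \<open>Large values are set to 0 rather than clipped: the difference of two truncations is then
  X on a shell R < |X| <= T and 0 elsewhere.\<close>

definition trunc :: "real \<Rightarrow> nat \<Rightarrow> nat \<times> nat \<Rightarrow> 'a \<Rightarrow> real" where
  "trunc T N e \<omega> = (if \<bar>X N e \<omega>\<bar> \<le> T then X N e \<omega> else 0)"

lemma trunc_meas [measurable]: "e \<in> upper_pairs N \<Longrightarrow> trunc T N e \<in> borel_measurable M"
  using rv[of e N] unfolding trunc_def[abs_def] by measurable

lemma trunc_bound: "T \<ge> 0 \<Longrightarrow> \<bar>trunc T N e \<omega>\<bar> \<le> T"
  by (simp add: trunc_def)

lemma trunc_int:
  assumes "e \<in> upper_pairs N" "T \<ge> 0" shows "integrable M (trunc T N e)"
  by (rule integrable_const_bound[where B=T]) (use assms trunc_bound in auto)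

lemma trunc_int2:
  assumes "e \<in> upper_pairs N" "T \<ge> 0" shows "integrable M (\<lambda>\<omega>. (trunc T N e \<omega>)\<^sup>2)"
  by (rule integrable_const_bound[where B="T\<^sup>2"])
     (use assms trunc_bound in \<open>auto simp: abs_le_square_iff[symmetric]\<close>)

lemma trunc_indep: "indep_vars (\<lambda>_. borel) (trunc T N) (upper_pairs N)"
proof -
  have "indep_vars (\<lambda>_. borel) (\<lambda>e \<omega>. (\<lambda>x. if \<bar>x\<bar> \<le> T then x else 0) (X N e \<omega>)) (upper_pairs N)"
    by (rule indep_vars_compose2[OF indep]) measurable
  then show ?thesis unfolding trunc_def[abs_def] .
qed

lemma trunc_mean:
  assumes e: "e \<in> upper_pairs N" and T: "T > 0"
  shows "\<bar>expectation (trunc T N e)\<bar> \<le> K * T powr (1 - p)"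
proof -
  have iX: "integrable M (X N e)" using integrable_power[OF e, of 1] by simp
  have iT: "integrable M (trunc T N e)" using trunc_int[OF e] T by simp
  have "\<bar>expectation (trunc T N e)\<bar> = \<bar>expectation (\<lambda>\<omega>. X N e \<omega> - trunc T N e \<omega>)\<bar>"
    using iX iT centred[OF e] by simp
  also have "\<dots> \<le> expectation (\<lambda>\<omega>. \<bar>X N e \<omega> - trunc T N e \<omega>\<bar>)" by (rule integral_abs_bound)
  also have "\<dots> = expectation (\<lambda>\<omega>. if \<bar>X N e \<omega>\<bar> > T then \<bar>X N e \<omega>\<bar> ^ 1 else 0)"
    by (intro Bochner_Integration.integral_cong) (auto simp: trunc_def)
  also have "\<dots> \<le> K * T powr (1 - p)" using tail_moment(2)[OF e _ T, of 1] by simp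
  finally show ?thesis .
qed

lemma trunc_var:
  assumes e: "e \<in> upper_pairs N" and T: "T > 0"
  shows "expectation (\<lambda>\<omega>. (trunc T N e \<omega>)\<^sup>2) \<le> expectation (\<lambda>\<omega>. (X N e \<omega>)\<^sup>2)"
    "expectation (\<lambda>\<omega>. (X N e \<omega>)\<^sup>2) - K * T powr (2 - p) \<le> expectation (\<lambda>\<omega>. (trunc T N e \<omega>)\<^sup>2)"
proof -
  have i2: "integrable M (\<lambda>\<omega>. (X N e \<omega>)\<^sup>2)" using integrable_power[OF e, of 2] by simp
  have iT: "integrable M (\<lambda>\<omega>. (trunc T N e \<omega>)\<^sup>2)" using trunc_int2[OF e] T by simp
  show "expectation (\<lambda>\<omega>. (trunc T N e \<omega>)\<^sup>2) \<le> expectation (\<lambda>\<omega>. (X N e \<omega>)\<^sup>2)"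
    by (intro integral_mono i2 iT) (simp add: trunc_def)
  have "expectation (\<lambda>\<omega>. (X N e \<omega>)\<^sup>2) - expectation (\<lambda>\<omega>. (trunc T N e \<omega>)\<^sup>2)
     = expectation (\<lambda>\<omega>. (X N e \<omega>)\<^sup>2 - (trunc T N e \<omega>)\<^sup>2)"
    using i2 iT by simp
  also have "\<dots> = expectation (\<lambda>\<omega>. if \<bar>X N e \<omega>\<bar> > T then \<bar>X N e \<omega>\<bar> ^ 2 else 0)"
    by (intro Bochner_Integration.integral_cong) (auto simp: trunc_def)
  also have "\<dots> \<le> K * T powr (2 - p)" using tail_moment(2)[OF e _ T, of 2] by simp
  finally show "expectation (\<lambda>\<omega>. (X N e \<omega>)\<^sup>2) - K * T powr (2 - p) \<le> expectation (\<lambda>\<omega>. (trunc T N e \<omega>)\<^sup>2)" by simp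
qed

lemma v2_pos: "v2 > 0"
  using var_lower[of "(1,1)" 1] var_upper[of "(1,1)" 1] v1_pos by (simp add: upper_pairs_def)

text \<open>Any exponent strictly between $3/p$ and $1/2$ would do.\<close>
definition tau :: "nat \<Rightarrow> real" where
  "tau N = real N powr ((p + 6) / (4 * p))"

abbreviation "Y N \<equiv> trunc (tau N) N"

lemma tau_pos: "N > 0 \<Longrightarrow> tau N > 0"
  by (simp add: tau_def)

lemma tau_nonneg: "tau N \<ge> 0"
  by (simp add: tau_def)

lemma tau_exponent: "(p + 6) / (4 * p) < 1 / 2" "(p + 6) / (4 * p) > 0"
  using p_gt by (auto simp: field_simps)

text \<open>The exponent g is the midpoint of 3/p and 1/2, so g p = (p + 6)/4 > 3. Hence g (1 - p) <
  1/2 - 3 and g (2 - p) < 1 - 3.\<close>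

lemma tau_powr:
  assumes N: "N > 0"
  shows "tau N powr (1 - p) \<le> real N powr (-5/2)" "tau N powr (2 - p) \<le> real N powr (-2)"
    "tau N powr (- p) = real N powr (- (p + 6) / 4)"
proof -
  define g where "g = (p + 6) / (4 * p)"
  have tau: "tau N = real N powr g" by (simp add: tau_def g_def)
  have gp: "g * p = (p + 6) / 4" using p_gt by (simp add: g_def)
  have g: "g < 1 / 2" using tau_exponent by (simp add: g_def)
  have "g * (1 - p) \<le> -5/2" "g * (2 - p) \<le> -2"
    unfolding right_diff_distrib gp using g p_gt by (simp_all add: field_simps)
  then show "tau N powr (1 - p) \<le> real N powr (-5/2)" "tau N powr (2 - p) \<le> real N powr (-2)"
    using N unfolding tau powr_powr by (auto intro!: powr_mono)
  show "tau N powr (- p) = real N powr (- (p + 6) / 4)"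
  proof -
    have "g * (- p) = - (p + 6) / 4" using gp by simp
    then show ?thesis by (simp only: tau powr_powr)
  qed
qed

lemma trunc_tau_mean:
  assumes e: "e \<in> upper_pairs N" and N: "N > 0"
  shows "\<bar>expectation (Y N e)\<bar> \<le> K * real N powr (-5/2)"
  using trunc_mean[OF e tau_pos[OF N]] mult_left_mono[OF tau_powr(1)[OF N], of K] K_pos by linarith

lemma trunc_tau_var:
  assumes e: "e \<in> upper_pairs N" and N: "N > 0"
  shows "expectation (\<lambda>\<omega>. (X N e \<omega>)\<^sup>2) - K * real N powr (-2) \<le> expectation (\<lambda>\<omega>. (Y N e \<omega>)\<^sup>2)"
  using trunc_var(2)[OF e tau_pos[OF N]] mult_left_mono[OF tau_powr(2)[OF N], of K] K_pos by linarith

section \<open>Normalised row sums and their exponential moments\<close>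

definition vsum :: "nat \<Rightarrow> (nat \<times> nat) set \<Rightarrow> real" where
  "vsum N I = (\<Sum>e\<in>I. expectation (\<lambda>\<omega>. (X N e \<omega>)\<^sup>2)) / real N"

text \<open>In this scaling both thresholds and log-moment generating functions live on the scale ln
  N: a sum reaches y sqrt(N ln N) exactly when \<open>zsum\<close> reaches y ln N (for N >
  1).\<close>

definition zsum :: "nat \<Rightarrow> (nat \<times> nat) set \<Rightarrow> 'a \<Rightarrow> real" where
  "zsum N I \<omega> = sqrt (ln (real N) / real N) * (\<Sum>e\<in>I. Y N e \<omega>)"

lemma vsum_bounds:
  assumes "I \<subseteq> upper_pairs N"
  shows "v1 * real (card I) / real N \<le> vsum N I" "vsum N I \<le> v2 * real (card I) / real N"
proof -
  have "real (card I) * v1 \<le> (\<Sum>e\<in>I. expectation (\<lambda>\<omega>. (X N e \<omega>)\<^sup>2))"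
    using assms var_lower by (intro sum_bounded_below) auto
  then show "v1 * real (card I) / real N \<le> vsum N I"
    unfolding vsum_def by (intro divide_right_mono) (auto simp: mult.commute)
  have "(\<Sum>e\<in>I. expectation (\<lambda>\<omega>. (X N e \<omega>)\<^sup>2)) \<le> real (card I) * v2"
    using assms var_upper by (intro sum_bounded_above) auto
  then show "vsum N I \<le> v2 * real (card I) / real N"
    unfolding vsum_def by (intro divide_right_mono) (auto simp: mult.commute)
qed

lemma zsum_meas: "I \<subseteq> upper_pairs N \<Longrightarrow> zsum N I \<in> borel_measurable M"
  unfolding zsum_def[abs_def]
  by (intro borel_measurable_times borel_measurable_sum borel_measurable_const) auto

text \<open>Uniformity in I and c is the point: the estimate serves all rows at once, and the tilts
  used later depend on the variance of the row. All errors are controlled by L N, which dominates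
  the actual parameter l.\<close>

lemma mgf_zsum:
  assumes C: "C > 0" and \<zeta>: "\<zeta> > 0"
  shows "\<forall>\<^sub>F N in sequentially. \<forall>I c. I \<subseteq> upper_pairs N \<longrightarrow> card I \<le> N \<longrightarrow> \<bar>c\<bar> \<le> C \<longrightarrow>
     integrable M (\<lambda>\<omega>. exp (c * zsum N I \<omega>)) \<and>
     exp ((c\<^sup>2 / 2 * vsum N I - \<zeta>) * ln (real N)) \<le> expectation (\<lambda>\<omega>. exp (c * zsum N I \<omega>)) \<and>
     expectation (\<lambda>\<omega>. exp (c * zsum N I \<omega>)) \<le> exp ((c\<^sup>2 / 2 * vsum N I + \<zeta>) * ln (real N))"
proof -
  define g where "g = (p + 6) / (4 * p)"
  have g: "g > 0" "g < 1/2" unfolding g_def using tau_exponent by auto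
  define L where "L N = C * sqrt (ln (real N) / real N)" for N
  define \<beta> where "\<beta> N = K * real N powr (-5/2)" for N
  define \<beta>' where "\<beta>' N = K * real N powr (-2)" for N
  have ev1: "\<forall>\<^sub>F N in sequentially. L N * \<beta> N + (L N)\<^sup>2 / 2 \<le> 1 / 2"
    unfolding L_def \<beta>_def using C K_pos by real_asymp
  \<comment> \<open>Mean errors are of order N sqrt(ln N / N) N^(-5/2), variance errors of order ln
    N times N^(-2), and the square of the quadratic term contributes N (ln N / N)^2; all
    vanish.\<close>
  have ev2: "\<forall>\<^sub>F N in sequentially. real N * (L N * \<beta> N) +
      real N * (L N * \<beta> N + (L N)\<^sup>2 / 2 * \<beta>' N + 2 * (L N * \<beta> N + (L N)\<^sup>2 / 2)\<^sup>2) \<le> \<zeta> / 2 * ln (real N)"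
    unfolding L_def \<beta>_def \<beta>'_def using C K_pos \<zeta> by real_asymp
  \<comment> \<open>Here g < 1/2 enters: L N times N^g tends to 0.\<close>
  have ev3: "\<forall>\<^sub>F N in sequentially. C\<^sup>2 / 2 * (exp (L N * real N powr g) - 1) \<le> \<zeta> / 2"
    unfolding L_def using C \<zeta> g by real_asymp
  show ?thesis using ev1 ev2 ev3 eventually_gt_at_top[of 1]
  proof eventually_elim
    case (elim N)
    note ev1 = elim(1) and ev2 = elim(2) and ev3 = elim(3)
    have N: "N > 0" "real N > 1" using elim by auto
    have ln0: "ln (real N) > 0" using N by simp
    show ?case
    proof (intro allI impI)
      fix I c assume I: "I \<subseteq> upper_pairs N" and cI: "card I \<le> N" and c: "\<bar>c\<bar> \<le> C"
      define l where "l = c * sqrt (ln (real N) / real N)"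
      have finI: "finite I" by (rule finite_subset[OF I finite_upper_pairs])
      have lL: "\<bar>l\<bar> \<le> L N" unfolding l_def L_def abs_mult using c ln0 by (simp add: mult_right_mono)
      have L0: "L N \<ge> 0" using lL by linarith
      have l2: "l\<^sup>2 \<le> (L N)\<^sup>2" using lL L0 by (simp add: abs_le_square_iff[symmetric])
      have l2': "l\<^sup>2 = c\<^sup>2 * (ln (real N) / real N)" unfolding l_def using ln0 by (simp add: power_mult_distrib)
      have b0: "\<beta> N \<ge> 0" "\<beta>' N \<ge> 0" unfolding \<beta>_def \<beta>'_def using K_pos by auto
      have m: "\<bar>l\<bar> * \<beta> N \<le> L N * \<beta> N" using lL b0 by (intro mult_right_mono) auto
      define V where "V = (\<Sum>e\<in>I. expectation (\<lambda>\<omega>. (X N e \<omega>)\<^sup>2))"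
      have V: "V = real N * vsum N I" unfolding V_def vsum_def using N by simp
      have n: "real (card I) \<le> real N" using cI by simp
      have vs0: "vsum N I \<ge> 0" unfolding vsum_def by (intro divide_nonneg_nonneg sum_nonneg) auto
      have vs1: "vsum N I \<le> 1"
      proof -
        have "v2 * real (card I) \<le> 1 * real N" using v2_le_1 v2_pos cI by (intro mult_mono) auto
        then have "v2 * real (card I) / real N \<le> 1" using N by (simp add: divide_le_eq)
        then show ?thesis using vsum_bounds(2)[OF I] by linarith
      qed
      note H = mgf_sum_bounds[of I "Y N" "tau N" "\<beta> N" "\<lambda>e. expectation (\<lambda>\<omega>. (X N e \<omega>)\<^sup>2)" "\<beta>' N" l]
      have prem: "finite I" "indep_vars (\<lambda>_. borel) (Y N) I"
        "\<And>e \<omega>. e \<in> I \<Longrightarrow> \<bar>Y N e \<omega>\<bar> \<le> tau N"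
        "\<And>e. e \<in> I \<Longrightarrow> \<bar>expectation (Y N e)\<bar> \<le> \<beta> N"
        "\<And>e. e \<in> I \<Longrightarrow> expectation (\<lambda>\<omega>. (Y N e \<omega>)\<^sup>2) \<le> expectation (\<lambda>\<omega>. (X N e \<omega>)\<^sup>2)"
        "\<And>e. e \<in> I \<Longrightarrow> expectation (\<lambda>\<omega>. (X N e \<omega>)\<^sup>2) - \<beta>' N \<le> expectation (\<lambda>\<omega>. (Y N e \<omega>)\<^sup>2)"
        "\<And>e. e \<in> I \<Longrightarrow> expectation (\<lambda>\<omega>. (X N e \<omega>)\<^sup>2) \<le> 1"
        "0 \<le> \<beta>' N" "\<bar>l\<bar> * \<beta> N + l\<^sup>2 / 2 \<le> 1 / 2"
      proof -
        show "indep_vars (\<lambda>_. borel) (Y N) I" by (rule indep_vars_subset[OF trunc_indep I])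
        show "\<bar>l\<bar> * \<beta> N + l\<^sup>2 / 2 \<le> 1 / 2" using ev1 m l2 by linarith
      next
        fix e assume "e \<in> I"
        then have e: "e \<in> upper_pairs N" using I by auto
        show "\<bar>expectation (Y N e)\<bar> \<le> \<beta> N" unfolding \<beta>_def by (rule trunc_tau_mean[OF e N(1)])
        show "expectation (\<lambda>\<omega>. (Y N e \<omega>)\<^sup>2) \<le> expectation (\<lambda>\<omega>. (X N e \<omega>)\<^sup>2)" by (rule trunc_var(1)[OF e tau_pos[OF N(1)]])
        show "expectation (\<lambda>\<omega>. (X N e \<omega>)\<^sup>2) - \<beta>' N \<le> expectation (\<lambda>\<omega>. (Y N e \<omega>)\<^sup>2)"
          unfolding \<beta>'_def by (rule trunc_tau_var[OF e N(1)])
        show "expectation (\<lambda>\<omega>. (X N e \<omega>)\<^sup>2) \<le> 1" using var_upper[OF e] v2_le_1 by linarith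
      qed (use finI b0 tau_nonneg trunc_bound in auto)
      have eq: "exp (c * zsum N I \<omega>) = exp (l * (\<Sum>e\<in>I. Y N e \<omega>))" for \<omega>
        by (simp add: zsum_def l_def)
      define E where "E = exp (L N * tau N)"
      have lV: "l\<^sup>2 / 2 * V = c\<^sup>2 / 2 * vsum N I * ln (real N)" unfolding V l2' using N by simp
      have lV0: "0 \<le> l\<^sup>2 / 2 * V" unfolding V using vs0 by simp
      have "c\<^sup>2 / 2 * vsum N I \<le> C\<^sup>2 / 2 * 1"
        using c C vs0 vs1 by (intro mult_mono) (auto simp: abs_le_square_iff[symmetric])
      then have lV1: "l\<^sup>2 / 2 * V \<le> C\<^sup>2 / 2 * ln (real N)" unfolding lV using ln0 by (simp add: mult_right_mono)
      have lt: "\<bar>l\<bar> * tau N \<le> L N * tau N" using lL tau_nonneg by (intro mult_right_mono) auto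
      then have e1: "exp (\<bar>l\<bar> * tau N) \<le> E" unfolding E_def by simp
      have E1: "E \<ge> 1" unfolding E_def using L0 tau_nonneg by simp
      \<comment> \<open>From 1 - e^(-x) <= x <= e^x - 1, so one quantity E - 1 controls the
        remainder factors of both bounds.\<close>
      have e2: "1 - exp (- (\<bar>l\<bar> * tau N)) \<le> E - 1"
      proof -
        have "1 - L N * tau N \<le> exp (- (\<bar>l\<bar> * tau N))" using exp_ge_add_one_self[of "- (\<bar>l\<bar> * tau N)"] lt by linarith
        moreover have "1 + L N * tau N \<le> E" unfolding E_def by (rule exp_ge_add_one_self)
        ultimately show ?thesis by linarith
      qed
      have E2: "C\<^sup>2 / 2 * ln (real N) * (E - 1) \<le> \<zeta> / 2 * ln (real N)"
      proof -
        have "(C\<^sup>2 / 2 * (E - 1)) * ln (real N) \<le> \<zeta> / 2 * ln (real N)"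
          using ev3 ln0 unfolding E_def tau_def g_def[symmetric] by (intro mult_right_mono) auto
        then show ?thesis by (simp add: mult_ac)
      qed
      have s1: "l\<^sup>2 / 2 * V * (exp (\<bar>l\<bar> * tau N) - 1) \<le> \<zeta> / 2 * ln (real N)"
      proof -
        have "l\<^sup>2 / 2 * V * (exp (\<bar>l\<bar> * tau N) - 1) \<le> C\<^sup>2 / 2 * ln (real N) * (E - 1)"
          by (rule mult_mono) (use lV0 lV1 e1 tau_nonneg[of N] ln0 in auto)
        then show ?thesis using E2 by linarith
      qed
      have s2: "l\<^sup>2 / 2 * V * (1 - exp (- (\<bar>l\<bar> * tau N))) \<le> \<zeta> / 2 * ln (real N)"
      proof -
        have "l\<^sup>2 / 2 * V * (1 - exp (- (\<bar>l\<bar> * tau N))) \<le> C\<^sup>2 / 2 * ln (real N) * (E - 1)"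
          by (rule mult_mono) (use lV0 lV1 e2 tau_nonneg[of N] ln0 in auto)
        then show ?thesis using E2 by linarith
      qed
      let ?w = "\<bar>l\<bar> * \<beta> N + l\<^sup>2 / 2 * \<beta>' N + 2 * (\<bar>l\<bar> * \<beta> N + l\<^sup>2 / 2)\<^sup>2"
      let ?W = "L N * \<beta> N + (L N)\<^sup>2 / 2 * \<beta>' N + 2 * (L N * \<beta> N + (L N)\<^sup>2 / 2)\<^sup>2"
      have W: "?w \<le> ?W" using m l2 b0 mult_right_mono[OF l2, of "\<beta>' N"]
          power_mono[of "\<bar>l\<bar> * \<beta> N + l\<^sup>2 / 2" "L N * \<beta> N + (L N)\<^sup>2 / 2" 2] by simp
      have w0: "?w \<ge> 0" using b0 by auto
      have t1: "real (card I) * (\<bar>l\<bar> * \<beta> N) \<le> real N * (L N * \<beta> N)"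
        by (rule mult_mono) (use n m b0 L0 in auto)
      have t2: "real (card I) * ?w \<le> real N * ?W" using n W w0 by (intro mult_mono) auto
      have t0: "0 \<le> real N * (L N * \<beta> N)" "0 \<le> real N * ?W" using L0 b0 by auto
      have up: "real (card I) * (\<bar>l\<bar> * \<beta> N) + l\<^sup>2 / 2 * V * exp (\<bar>l\<bar> * tau N) \<le> (c\<^sup>2 / 2 * vsum N I + \<zeta>) * ln (real N)"
        using t1 t0 s1 ev2 lV unfolding right_diff_distrib distrib_right by linarith
      have lo: "(c\<^sup>2 / 2 * vsum N I - \<zeta>) * ln (real N) \<le> l\<^sup>2 / 2 * V * exp (- (\<bar>l\<bar> * tau N)) - real (card I) * ?w"
        using t2 t0 s2 ev2 lV unfolding right_diff_distrib left_diff_distrib by linarith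
      show "integrable M (\<lambda>\<omega>. exp (c * zsum N I \<omega>)) \<and>
        exp ((c\<^sup>2 / 2 * vsum N I - \<zeta>) * ln (real N)) \<le> expectation (\<lambda>\<omega>. exp (c * zsum N I \<omega>)) \<and>
        expectation (\<lambda>\<omega>. exp (c * zsum N I \<omega>)) \<le> exp ((c\<^sup>2 / 2 * vsum N I + \<zeta>) * ln (real N))"
      proof (intro conjI)
        show "integrable M (\<lambda>\<omega>. exp (c * zsum N I \<omega>))"
          unfolding eq by (rule H(1)) (use prem in auto)
        have "expectation (\<lambda>\<omega>. exp (l * (\<Sum>e\<in>I. Y N e \<omega>))) \<le> exp (real (card I) * (\<bar>l\<bar> * \<beta> N) + l\<^sup>2 / 2 * V * exp (\<bar>l\<bar> * tau N))"
          unfolding V_def by (rule H(2)) (use prem in auto)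
        also have "\<dots> \<le> exp ((c\<^sup>2 / 2 * vsum N I + \<zeta>) * ln (real N))" using up by simp
        finally show "expectation (\<lambda>\<omega>. exp (c * zsum N I \<omega>)) \<le> exp ((c\<^sup>2 / 2 * vsum N I + \<zeta>) * ln (real N))"
          unfolding eq .
        have "exp ((c\<^sup>2 / 2 * vsum N I - \<zeta>) * ln (real N)) \<le> exp (l\<^sup>2 / 2 * V * exp (- (\<bar>l\<bar> * tau N)) - real (card I) * ?w)"
          using lo by simp
        also have "\<dots> \<le> expectation (\<lambda>\<omega>. exp (l * (\<Sum>e\<in>I. Y N e \<omega>)))"
          unfolding V_def by (rule H(3)) (use prem in auto)
        finally show "exp ((c\<^sup>2 / 2 * vsum N I - \<zeta>) * ln (real N)) \<le> expectation (\<lambda>\<omega>. exp (c * zsum N I \<omega>))"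
          unfolding eq .
      qed
    qed
  qed
qed

end

subsection \<open>Almost sure asymptotics\<close>

text \<open>Only a measurable set covering the failures of Q is required, not measurability of Q
  itself. The sets are picked by choice, with the empty set at the sizes where none is
  provided.\<close>

lemma (in prob_space) borel_cantelli_eventually:
  assumes ev: "\<forall>\<^sub>F N in sequentially. \<exists>B\<in>events. prob B \<le> f N \<and> (\<forall>\<omega>\<in>space M - B. Q N \<omega>)"
    and f: "summable f"
  shows "AE \<omega> in M. \<forall>\<^sub>F N in sequentially. Q N \<omega>"
proof -
  let ?good = "\<lambda>N B. B \<in> events \<and> prob B \<le> f N \<and> (\<forall>\<omega>\<in>space M - B. Q N \<omega>)"
  define B where "B N = (if \<exists>B. ?good N B then SOME B. ?good N B else {})" for N
  have good: "?good N (B N)" if "\<exists>B. ?good N B" for N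
    using someI_ex[OF that] that by (simp add: B_def)
  have ev': "\<forall>\<^sub>F N in sequentially. ?good N (B N)"
    using ev by eventually_elim (rule good, blast)
  have Bm: "B N \<in> events" for N using good[of N] by (cases "\<exists>B. ?good N B") (auto simp: B_def)
  have "AE \<omega> in M. \<forall>\<^sub>F N in sequentially. \<omega> \<in> space M - B N"
  proof (rule borel_cantelli_AE1[OF Bm])
    show "summable (\<lambda>N. measure M (B N))"
      by (rule summable_comparison_test_ev[OF _ f]) (use ev' in eventually_elim, simp)
  qed (simp add: emeasure_eq_measure)
  then show ?thesis
  proof eventually_elim
    case (elim \<omega>)
    from elim ev' show ?case by eventually_elim auto
  qed
qed

section \<open>Removing the truncation; extreme row sums\<close>

context wigner
begin

text \<open>N^2 entries exceed the level with probability at most K N^(-(p+6)/4) each; the total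
  exponent 2 - (p+6)/4 lies below -1 exactly when p > 6.\<close>

lemma eventually_no_truncation:
  "AE \<omega> in M. \<forall>\<^sub>F N in sequentially. \<forall>e\<in>upper_pairs N. Y N e \<omega> = X N e \<omega>"
proof (rule borel_cantelli_eventually)
  show "summable (\<lambda>N. K * real N powr (2 + - (p + 6) / 4))"
    using p_gt by (intro summable_mult) (simp add: summable_real_powr_iff field_simps)
  show "\<forall>\<^sub>F N in sequentially. \<exists>B\<in>events. prob B \<le> K * real N powr (2 + - (p + 6) / 4) \<and>
     (\<forall>\<omega>\<in>space M - B. \<forall>e\<in>upper_pairs N. Y N e \<omega> = X N e \<omega>)"
    using eventually_gt_at_top[of 0]
  proof eventually_elim
    case (elim N)
    define E where "E e = {\<omega>\<in>space M. \<bar>X N e \<omega>\<bar> > tau N}" for e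
    define B where "B = (\<Union>e\<in>upper_pairs N. E e)"
    have Em: "E e \<in> events" if "e \<in> upper_pairs N" for e
      unfolding E_def using rv[OF that] by measurable
    have PE: "prob (E e) \<le> K * tau N powr (- p)" if e: "e \<in> upper_pairs N" for e
    proof -
      have "prob (E e) = expectation (indicator (E e))" using Em[OF e] by simp
      also have "\<dots> = expectation (\<lambda>\<omega>. if \<bar>X N e \<omega>\<bar> > tau N then \<bar>X N e \<omega>\<bar> ^ 0 else 0)"
        by (intro Bochner_Integration.integral_cong) (auto simp: E_def)
      also have "\<dots> \<le> K * tau N powr (- p)" using tail_moment(2)[OF e _ tau_pos[OF elim], of 0] by simp
      finally show ?thesis .
    qed
    have "prob B \<le> (\<Sum>e\<in>upper_pairs N. prob (E e))"
      unfolding B_def using Em by (intro finite_measure_subadditive_finite) auto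
    also have "\<dots> \<le> real (card (upper_pairs N)) * (K * tau N powr (- p))"
      using PE by (intro sum_bounded_above) auto
    also have "\<dots> \<le> real (N * N) * (K * tau N powr (- p))"
      using card_upper_pairs[of N] K_pos by (intro mult_right_mono) (auto simp only: of_nat_le_iff mult_nonneg_nonneg powr_ge_zero less_imp_le)
    also have "real (N * N) = real N powr 2" by (simp add: power2_eq_square)
    also have "real N powr 2 * (K * tau N powr (- p)) = K * real N powr (2 + - (p + 6) / 4)"
      unfolding tau_powr(3)[OF elim] powr_add by simp
    finally have "prob B \<le> K * real N powr (2 + - (p + 6) / 4)" .
    moreover have "B \<in> events" unfolding B_def using Em by auto
    moreover have "Y N e \<omega> = X N e \<omega>" if "\<omega> \<in> space M - B" "e \<in> upper_pairs N" for \<omega> e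
      using that by (auto simp: B_def E_def trunc_def)
    ultimately show ?case by blast
  qed
qed

text \<open>One row exceeds the level with probability about N^(-y^2/(2w)). The union over N rows
  and summability in N together require an exponent above 2, which is y^2 > 4 w. The index sets are
  left free because the bound is applied to full rows and also to the few columns dropped in the
  lower bound.\<close>

lemma rows_upper:
  assumes I: "\<forall>\<^sub>F N in sequentially. \<forall>i\<in>{1..N}. I N i \<subseteq> upper_pairs N \<and> card (I N i) \<le> N \<and> vsum N (I N i) \<le> w"
    and w: "w > 0" and y: "y > 0" "y\<^sup>2 > 4 * w"
  shows "AE \<omega> in M. \<forall>\<^sub>F N in sequentially. \<forall>i\<in>{1..N}. \<bar>zsum N (I N i) \<omega>\<bar> \<le> y * ln (real N)"
proof -
  \<comment> \<open>c minimises -c y + c^2 w/2, with minimum -y^2/(2w) = -2 - 2 \<zeta>; half of the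
    slack is spent on the error \<zeta> of \<open>mgf_zsum\<close>.\<close>
  define c where "c = y / w"
  define \<zeta> where "\<zeta> = (y\<^sup>2 / (2 * w) - 2) / 2"
  have \<zeta>: "\<zeta> > 0" using w y by (simp add: \<zeta>_def field_simps)
  have c: "c > 0" using w y by (simp add: c_def)
  have cy: "- (c * y) + (c\<^sup>2 / 2 * w + \<zeta>) = - 2 - \<zeta>"
    using w by (simp add: c_def \<zeta>_def field_simps power2_eq_square)
  show ?thesis
  proof (rule borel_cantelli_eventually)
    show "summable (\<lambda>N. 2 * real N powr (- 1 - \<zeta>))"
      using \<zeta> by (intro summable_mult) (simp add: summable_real_powr_iff)
    show "\<forall>\<^sub>F N in sequentially. \<exists>B\<in>events. prob B \<le> 2 * real N powr (- 1 - \<zeta>) \<and>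
       (\<forall>\<omega>\<in>space M - B. \<forall>i\<in>{1..N}. \<bar>zsum N (I N i) \<omega>\<bar> \<le> y * ln (real N))"
      using I mgf_zsum[OF c \<zeta>] eventually_gt_at_top[of 1]
    proof eventually_elim
      case (elim N)
      have N: "real N > 1" using elim by simp
      have ln0: "ln (real N) > 0" using N by simp
      define E where "E i = {\<omega>\<in>space M. \<bar>zsum N (I N i) \<omega>\<bar> > y * ln (real N)}" for i
      define B where "B = (\<Union>i\<in>{1..N}. E i)"
      have Em: "E i \<in> events" if "i \<in> {1..N}" for i
      proof -
        have "I N i \<subseteq> upper_pairs N" using elim(1) that by blast
        note [measurable] = zsum_meas[OF this]
        show ?thesis unfolding E_def by measurable
      qed
      have PE: "prob (E i) \<le> 2 * real N powr (- 2 - \<zeta>)" if i: "i \<in> {1..N}" for i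
      proof -
        have Ii: "I N i \<subseteq> upper_pairs N" "card (I N i) \<le> N" "vsum N (I N i) \<le> w" using elim(1) i by auto
        note [measurable] = zsum_meas[OF Ii(1)]
        have one: "prob {\<omega>\<in>space M. s * zsum N (I N i) \<omega> \<ge> y * ln (real N) * c} \<le> real N powr (- 2 - \<zeta>)"
          if s: "\<bar>s\<bar> = c" for s
        proof -
          have m: "integrable M (\<lambda>\<omega>. exp (s * zsum N (I N i) \<omega>))"
            "expectation (\<lambda>\<omega>. exp (s * zsum N (I N i) \<omega>)) \<le> exp ((s\<^sup>2 / 2 * vsum N (I N i) + \<zeta>) * ln (real N))"
            using elim(2) Ii s by auto
          have s2: "s\<^sup>2 = c\<^sup>2" using s by (metis power2_abs)
          have "prob {\<omega>\<in>space M. s * zsum N (I N i) \<omega> \<ge> y * ln (real N) * c}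
             \<le> exp (- (y * ln (real N) * c)) * expectation (\<lambda>\<omega>. exp (s * zsum N (I N i) \<omega>))"
            by (rule chernoff[OF m(1)])
          also have "\<dots> \<le> exp (- (y * ln (real N) * c)) * exp ((c\<^sup>2 / 2 * w + \<zeta>) * ln (real N))"
          proof (intro mult_left_mono order.trans[OF m(2)])
            have "c\<^sup>2 / 2 * vsum N (I N i) \<le> c\<^sup>2 / 2 * w" using Ii by (intro mult_left_mono) auto
            then show "exp ((s\<^sup>2 / 2 * vsum N (I N i) + \<zeta>) * ln (real N)) \<le> exp ((c\<^sup>2 / 2 * w + \<zeta>) * ln (real N))"
              unfolding s2 using ln0 by (simp add: mult_right_mono)
          qed simp
          also have "\<dots> = exp ((- (c * y) + (c\<^sup>2 / 2 * w + \<zeta>)) * ln (real N))"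
            by (simp add: exp_add[symmetric] algebra_simps)
          also have "\<dots> = real N powr (- 2 - \<zeta>)" unfolding cy using N by (simp add: powr_def)
          finally show ?thesis .
        qed
        have "prob (E i) \<le> prob ({\<omega>\<in>space M. c * zsum N (I N i) \<omega> \<ge> y * ln (real N) * c} \<union> {\<omega>\<in>space M. - c * zsum N (I N i) \<omega> \<ge> y * ln (real N) * c})"
        proof (rule finite_measure_mono)
          show "E i \<subseteq> {\<omega>\<in>space M. c * zsum N (I N i) \<omega> \<ge> y * ln (real N) * c} \<union> {\<omega>\<in>space M. - c * zsum N (I N i) \<omega> \<ge> y * ln (real N) * c}"
          proof
            fix \<omega> assume "\<omega> \<in> E i"
            then have \<omega>: "\<omega> \<in> space M" "\<bar>zsum N (I N i) \<omega>\<bar> > y * ln (real N)" by (auto simp: E_def)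
            have "c * (y * ln (real N)) \<le> c * \<bar>zsum N (I N i) \<omega>\<bar>" using \<omega> c by (intro mult_left_mono) auto
            then show "\<omega> \<in> {\<omega>\<in>space M. c * zsum N (I N i) \<omega> \<ge> y * ln (real N) * c} \<union> {\<omega>\<in>space M. - c * zsum N (I N i) \<omega> \<ge> y * ln (real N) * c}"
              using \<omega>(1) by (cases "zsum N (I N i) \<omega> \<ge> 0") (auto simp: mult_ac)
          qed
        qed measurable
        also have "\<dots> \<le> prob {\<omega>\<in>space M. c * zsum N (I N i) \<omega> \<ge> y * ln (real N) * c} + prob {\<omega>\<in>space M. - c * zsum N (I N i) \<omega> \<ge> y * ln (real N) * c}"
          by (intro measure_Un_le) measurable
        also have "\<dots> \<le> real N powr (- 2 - \<zeta>) + real N powr (- 2 - \<zeta>)"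
          using c by (intro add_mono one) auto
        finally show ?thesis by simp
      qed
      have "prob B \<le> (\<Sum>i\<in>{1..N}. prob (E i))"
        unfolding B_def using Em by (intro finite_measure_subadditive_finite) auto
      also have "\<dots> \<le> real (card {1..N}) * (2 * real N powr (- 2 - \<zeta>))"
        using PE by (intro sum_bounded_above) auto
      also have "\<dots> = 2 * (real N powr 1 * real N powr (- 2 - \<zeta>))" by simp
      also have "\<dots> = 2 * real N powr (- 1 - \<zeta>)" unfolding powr_add[symmetric] by simp
      finally have "prob B \<le> 2 * real N powr (- 1 - \<zeta>)" .
      moreover have "B \<in> events" unfolding B_def using Em by auto
      moreover have "\<bar>zsum N (I N i) \<omega>\<bar> \<le> y * ln (real N)" if "\<omega> \<in> space M - B" "i \<in> {1..N}" for \<omega> i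
        using that by (auto simp: B_def E_def not_less)
      ultimately show ?case by blast
    qed
  qed
qed

text \<open>The cost of tilting the mean to slightly above y is close to y^2/(2a) < 1 in the
  exponent of N; \<xi> is the remaining gap and does not depend on the index set.\<close>

lemma zsum_lower_tail:
  assumes y: "y > 0" and a: "a > 0" "y\<^sup>2 < 2 * a"
  shows "\<exists>\<xi>>0. \<forall>\<^sub>F N in sequentially. \<forall>I. I \<subseteq> upper_pairs N \<longrightarrow> card I \<le> N \<longrightarrow> a \<le> vsum N I \<longrightarrow>
     real N powr (\<xi> - 1) / 2 \<le> prob {\<omega>\<in>space M. zsum N I \<omega> \<ge> y * ln (real N)}"
proof -
  \<comment> \<open>This is the exponent of the tilting bound with variance a. At \<eta> = 0 it
    equals y^2/(2a) < 1, so continuity yields an admissible \<eta> > 0.\<close>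
  have "((\<lambda>\<eta>. (y + \<eta>)\<^sup>2 / (2 * a) + (y + \<eta>) * \<eta> / a + \<eta>\<^sup>2 / 8) \<longlongrightarrow> (y + 0)\<^sup>2 / (2 * a) + (y + 0) * 0 / a + 0\<^sup>2 / 8) (at_right 0)"
    using a by (intro tendsto_intros) auto
  moreover have "(y + 0)\<^sup>2 / (2 * a) + (y + 0) * 0 / a + 0\<^sup>2 / 8 < 1" using a by (simp add: field_simps)
  ultimately have "\<forall>\<^sub>F \<eta> in at_right 0. (y + \<eta>)\<^sup>2 / (2 * a) + (y + \<eta>) * \<eta> / a + \<eta>\<^sup>2 / 8 < 1"
    by (rule order_tendstoD)
  then have "\<forall>\<^sub>F \<eta> in at_right 0. \<eta> > 0 \<and> (y + \<eta>)\<^sup>2 / (2 * a) + (y + \<eta>) * \<eta> / a + \<eta>\<^sup>2 / 8 < 1"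
    using eventually_at_right_less by eventually_elim auto
  then obtain \<eta> where \<eta>: "\<eta> > 0" "(y + \<eta>)\<^sup>2 / (2 * a) + (y + \<eta>) * \<eta> / a + \<eta>\<^sup>2 / 8 < 1"
    by (metis (no_types, lifting) eventually_happens trivial_limit_at_right_real)
  \<comment> \<open>With \<eta>^2/8 the rate \<eta>^2/2 - 2 \<zeta> equals \<eta>^2/4 > 0, so the
    two discarded tails become negligible.\<close>
  define \<zeta> where "\<zeta> = \<eta>\<^sup>2 / 8"
  define \<xi> where "\<xi> = 1 - ((y + \<eta>)\<^sup>2 / (2 * a) + (y + \<eta>) * \<eta> / a + \<zeta>)"
  define C where "C = (y + \<eta>) / a + \<eta>"
  have pos: "\<zeta> > 0" "\<xi> > 0" "C > 0" using \<eta> y a by (auto simp: \<zeta>_def \<xi>_def C_def intro!: add_pos_pos)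
  have ev: "\<forall>\<^sub>F N in sequentially. 2 * exp (- (\<eta>\<^sup>2 / 2 - 2 * \<zeta>) * ln (real N)) \<le> 1 / 2"
    unfolding \<zeta>_def using \<eta>(1) by real_asymp
  have "\<forall>\<^sub>F N in sequentially. \<forall>I. I \<subseteq> upper_pairs N \<longrightarrow> card I \<le> N \<longrightarrow> a \<le> vsum N I \<longrightarrow>
     real N powr (\<xi> - 1) / 2 \<le> prob {\<omega>\<in>space M. zsum N I \<omega> \<ge> y * ln (real N)}"
    using ev mgf_zsum[OF pos(3,1)] eventually_gt_at_top[of 1]
  proof eventually_elim
    case (elim N)
    have N: "real N > 1" using elim by simp
    have ln0: "ln (real N) > 0" using N by simp
    show ?case
    proof (intro allI impI)
      fix I assume I: "I \<subseteq> upper_pairs N" "card I \<le> N" "a \<le> vsum N I"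
      define v where "v = vsum N I"
      \<comment> \<open>The tilt is matched to the variance of this index set so that the lower end
        c v - \<eta> of the window is exactly y; since v >= a, all three tilts stay within
        C.\<close>
      define c where "c = (y + \<eta>) / v"
      have v: "v \<ge> a" "v > 0" using I a by (auto simp: v_def)
      have v1: "v \<le> 1"
      proof -
        have "v2 * real (card I) \<le> 1 * real N" using v2_le_1 v2_pos I by (intro mult_mono) auto
        then have "v2 * real (card I) / real N \<le> 1" using N by (simp add: divide_le_eq)
        then show ?thesis using vsum_bounds(2)[OF I(1)] by (simp add: v_def)
      qed
      have c: "c > 0" using v y \<eta> by (simp add: c_def)
      have cC: "c \<le> (y + \<eta>) / a" unfolding c_def using v a y \<eta> by (intro divide_left_mono) auto
      have absC: "\<bar>c\<bar> \<le> C" "\<bar>c - \<eta>\<bar> \<le> C" "\<bar>c + \<eta>\<bar> \<le> C" using c cC \<eta> y unfolding C_def by auto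
      have H: "integrable M (\<lambda>\<omega>. exp (d * zsum N I \<omega>)) \<and>
         exp ((d\<^sup>2 / 2 * v - \<zeta>) * ln (real N)) \<le> expectation (\<lambda>\<omega>. exp (d * zsum N I \<omega>)) \<and>
         expectation (\<lambda>\<omega>. exp (d * zsum N I \<omega>)) \<le> exp ((d\<^sup>2 / 2 * v + \<zeta>) * ln (real N))" if "\<bar>d\<bar> \<le> C" for d
        unfolding v_def using elim(2) I that by blast
      have cv: "c * v - \<eta> = y" unfolding c_def using v by simp
      have "exp (- (c\<^sup>2 / 2 * v + c * \<eta> + \<zeta>) * ln (real N)) * (1 - 2 * exp (- (\<eta>\<^sup>2 / 2 - 2 * \<zeta>) * ln (real N)))
        \<le> prob {\<omega>\<in>space M. zsum N I \<omega> \<ge> (c * v - \<eta>) * ln (real N)}"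
        by (rule tilted_lower_bound[OF zsum_meas[OF I(1)]]) (use H[OF absC(1)] H[OF absC(2)] H[OF absC(3)] c \<eta> v1 ln0 in auto)
      moreover have "real N powr (\<xi> - 1) * (1 / 2) \<le> exp (- (c\<^sup>2 / 2 * v + c * \<eta> + \<zeta>) * ln (real N)) * (1 - 2 * exp (- (\<eta>\<^sup>2 / 2 - 2 * \<zeta>) * ln (real N)))"
      proof (rule mult_mono)
        have "c\<^sup>2 / 2 * v = (y + \<eta>)\<^sup>2 / (2 * v)" unfolding c_def using v by (simp add: field_simps power2_eq_square)
        also have "\<dots> \<le> (y + \<eta>)\<^sup>2 / (2 * a)" using v a by (intro divide_left_mono) auto
        finally have "c\<^sup>2 / 2 * v \<le> (y + \<eta>)\<^sup>2 / (2 * a)" .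
        moreover have "c * \<eta> \<le> (y + \<eta>) / a * \<eta>" using cC \<eta> by (intro mult_right_mono) auto
        ultimately have "c\<^sup>2 / 2 * v + c * \<eta> + \<zeta> \<le> 1 - \<xi>" unfolding \<xi>_def by simp
        then have "(\<xi> - 1) * ln (real N) \<le> - (c\<^sup>2 / 2 * v + c * \<eta> + \<zeta>) * ln (real N)"
          using ln0 by (intro mult_right_mono) auto
        then show "real N powr (\<xi> - 1) \<le> exp (- (c\<^sup>2 / 2 * v + c * \<eta> + \<zeta>) * ln (real N))"
          using N by (simp add: powr_def)
        show "1 / 2 \<le> 1 - 2 * exp (- (\<eta>\<^sup>2 / 2 - 2 * \<zeta>) * ln (real N))" using elim(1) by linarith
      qed auto
      ultimately show "real N powr (\<xi> - 1) / 2 \<le> prob {\<omega>\<in>space M. zsum N I \<omega> \<ge> y * ln (real N)}"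
        unfolding cv by simp
    qed
  qed
  then show ?thesis using pos by blast
qed

lemma zsum_indep:
  assumes K: "\<And>i. i \<in> L \<Longrightarrow> I i \<subseteq> upper_pairs N" and d: "disjoint_family_on I L"
  shows "indep_vars (\<lambda>_. borel) (\<lambda>i. zsum N (I i)) L"
proof -
  have "indep_vars (\<lambda>_. borel) (\<lambda>i \<omega>. (\<lambda>f. sqrt (ln (real N) / real N) * (\<Sum>e\<in>I i. f e)) (restrict (\<lambda>e. Y N e \<omega>) (I i))) L"
    by (rule indep_vars_compose2[OF indep_vars_restrict[OF trunc_indep K d]]) measurable
  also have "?this \<longleftrightarrow> ?thesis"
    by (intro indep_vars_cong) (auto simp: zsum_def fun_eq_iff)
  finally show ?thesis .
qed

text \<open>Each of about \<kappa> N independent sums succeeds with probability at least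
  N^(\<xi>-1)/2, so all fail with probability at most about exp(-\<kappa> N^\<xi> / 2). This beats
  every power of N, so summability costs nothing in the constant.\<close>

lemma rows_lower:
  assumes I: "\<forall>\<^sub>F N in sequentially. (\<forall>i\<in>{1..m N}. I N i \<subseteq> upper_pairs N \<and> card (I N i) \<le> N \<and> a \<le> vsum N (I N i))
       \<and> disjoint_family_on (I N) {1..m N} \<and> real (m N) \<ge> \<kappa> * real N - 1"
    and a: "a > 0" and y: "y > 0" "y\<^sup>2 < 2 * a" and \<kappa>: "\<kappa> > 0"
  shows "AE \<omega> in M. \<forall>\<^sub>F N in sequentially. \<exists>i\<in>{1..m N}. zsum N (I N i) \<omega> \<ge> y * ln (real N)"
proof -
  from zsum_lower_tail[OF y(1) a y(2)] obtain \<xi> where \<xi>: "\<xi> > 0"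
    "\<forall>\<^sub>F N in sequentially. \<forall>I. I \<subseteq> upper_pairs N \<longrightarrow> card I \<le> N \<longrightarrow> a \<le> vsum N I \<longrightarrow>
     real N powr (\<xi> - 1) / 2 \<le> prob {\<omega>\<in>space M. zsum N I \<omega> \<ge> y * ln (real N)}" by blast
  have ev1: "\<forall>\<^sub>F N in sequentially. exp (- ((\<kappa> * real N - 1) * (real N powr (\<xi> - 1) / 2))) \<le> real N powr (-2)"
    using \<kappa> \<xi>(1) by real_asymp
  have ev2: "\<forall>\<^sub>F N in sequentially. \<kappa> * real N - 1 > 0" using \<kappa> by real_asymp
  show ?thesis
  proof (rule borel_cantelli_eventually)
    show "summable (\<lambda>N. real N powr (-2))" by (simp add: summable_real_powr_iff)
    show "\<forall>\<^sub>F N in sequentially. \<exists>B\<in>events. prob B \<le> real N powr (-2) \<and>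
       (\<forall>\<omega>\<in>space M - B. \<exists>i\<in>{1..m N}. zsum N (I N i) \<omega> \<ge> y * ln (real N))"
      using I \<xi>(2) ev1 ev2
    proof eventually_elim
      case (elim N)
      let ?L = "{1..m N}"
      have IN: "I N i \<subseteq> upper_pairs N" "card (I N i) \<le> N" "a \<le> vsum N (I N i)" if "i \<in> ?L" for i
        using elim(1) that by auto
      have m0: "m N > 0" using elim(1,4) by (metis gr0I less_le_trans of_nat_0 less_irrefl)
      define q where "q = real N powr (\<xi> - 1) / 2"
      define B where "B = (\<Inter>i\<in>?L. zsum N (I N i) -` {..<y * ln (real N)} \<inter> space M)"
      have ind: "indep_vars (\<lambda>_. borel) (\<lambda>i. zsum N (I N i)) ?L"
        by (rule zsum_indep) (use elim(1) in auto)
      have one: "prob (zsum N (I N i) -` {..<y * ln (real N)} \<inter> space M) \<le> exp (- q)" if i: "i \<in> ?L" for i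
      proof -
        note [measurable] = zsum_meas[OF IN(1)[OF i]]
        have "zsum N (I N i) -` {..<y * ln (real N)} \<inter> space M = space M - {\<omega>\<in>space M. zsum N (I N i) \<omega> \<ge> y * ln (real N)}"
          by auto
        then have "prob (zsum N (I N i) -` {..<y * ln (real N)} \<inter> space M) = 1 - prob {\<omega>\<in>space M. zsum N (I N i) \<omega> \<ge> y * ln (real N)}"
          by (simp add: prob_compl)
        also have "\<dots> \<le> 1 - q" using elim(2) IN[OF i] unfolding q_def by auto
        also have "\<dots> \<le> exp (- q)" using exp_ge_add_one_self[of "- q"] by simp
        finally show ?thesis .
      qed
      have "prob B = (\<Prod>i\<in>?L. prob (zsum N (I N i) -` {..<y * ln (real N)} \<inter> space M))"
        unfolding B_def by (rule indep_varsD_finite[OF ind]) (use m0 in auto)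
      also have "\<dots> \<le> (\<Prod>i\<in>?L. exp (- q))" using one by (intro prod_mono) auto
      also have "\<dots> = exp (- (real (m N) * q))" by (simp add: exp_of_nat_mult[symmetric])
      also have "\<dots> \<le> exp (- ((\<kappa> * real N - 1) * q))"
        using elim(1) by (simp add: mult_right_mono q_def)
      also have "\<dots> \<le> real N powr (-2)" using elim(3) unfolding q_def .
      finally have "prob B \<le> real N powr (-2)" .
      moreover have "B \<in> events" unfolding B_def
        using m0 measurable_sets[OF zsum_meas[OF IN(1)]] by (intro sets.finite_INT) auto
      moreover have "\<exists>i\<in>?L. zsum N (I N i) \<omega> \<ge> y * ln (real N)" if "\<omega> \<in> space M - B" for \<omega>
        using that m0 by (auto simp: B_def not_less)
      ultimately show ?case by blast
    qed
  qed
qed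

end

subsection \<open>The norm of the off-diagonal part\<close>

lemma matvec_add: "matvec N (\<lambda>i j. A i j + B i j) x i = matvec N A x i + matvec N B x i"
  by (simp add: matvec_def distrib_right sum.distrib)

lemma L2_set_matvec_add:
  "L2_set (matvec N (\<lambda>i j. A i j + B i j) x) {1..N} \<le> L2_set (matvec N A x) {1..N} + L2_set (matvec N B x) {1..N}"
  unfolding matvec_add[abs_def] by (rule L2_set_triangle_ineq)

text \<open>A crude N^2 b suffices for both uses: the means left by truncation are O(N^(-5/2)), and
  boundedness of the set defining the spectral norm needs no good constant.\<close>

lemma L2_set_matvec_entrywise:
  assumes A: "\<And>i j. i \<in> {1..N} \<Longrightarrow> j \<in> {1..N} \<Longrightarrow> \<bar>A i j\<bar> \<le> b" and x: "L2_set x {1..N} = 1"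
  shows "L2_set (matvec N A x) {1..N} \<le> real N * (real N * b)"
proof -
  have x1: "\<bar>x j\<bar> \<le> 1" if "j \<in> {1..N}" for j
  proof -
    have "(x j)\<^sup>2 \<le> (L2_set x {1..N})\<^sup>2" unfolding L2_set_sq using that by (intro member_le_sum) auto
    then show ?thesis using x by (simp add: abs_square_le_1)
  qed
  have "L2_set (matvec N A x) {1..N} \<le> (\<Sum>i\<in>{1..N}. \<bar>matvec N A x i\<bar>)" by (rule L2_set_le_sum_abs)
  also have "\<dots> \<le> (\<Sum>i\<in>{1..N}. real N * b)"
  proof (intro sum_mono)
    fix i assume i: "i \<in> {1..N}"
    have "\<bar>matvec N A x i\<bar> \<le> (\<Sum>j\<in>{1..N}. \<bar>A i j * x j\<bar>)" unfolding matvec_def by (rule sum_abs)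
    also have "\<dots> \<le> (\<Sum>j\<in>{1..N}. b * 1)"
    proof (intro sum_mono)
      fix j assume j: "j \<in> {1..N}"
      show "\<bar>A i j * x j\<bar> \<le> b * 1" unfolding abs_mult using A[OF i j] x1[OF j]
        by (intro mult_mono) auto
    qed
    finally show "\<bar>matvec N A x i\<bar> \<le> real N * b" by simp
  qed
  finally show ?thesis by simp
qed

section \<open>Bounded entries, large entries and their recombination\<close>

context wigner
begin

text \<open>Centring doubles the bound R. The Hoeffding exponent \<epsilon>^2 N ln N / (256 R^2)
  eventually beats the entropy 12 N for any fixed R and \<epsilon>.\<close>

lemma norm_bounded_part:
  assumes R: "R > 0" and \<epsilon>: "\<epsilon> > 0"
  shows "AE \<omega> in M. \<forall>\<^sub>F N in sequentially. \<forall>x. L2_set x {1..N} = 1 \<longrightarrow>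
     L2_set (matvec N (\<lambda>i j. trunc R N (upair i j) \<omega> - expectation (trunc R N (upair i j))) x) {1..N} \<le> \<epsilon> * sqrt (real N * ln (real N))"
proof (rule borel_cantelli_eventually)
  show "summable (\<lambda>N. real N powr (-2))" by (simp add: summable_real_powr_iff)
  have "\<forall>\<^sub>F N in sequentially. exp (12 * real N - (\<epsilon> * sqrt (real N * ln (real N)))\<^sup>2 / (64 * (2 * R)\<^sup>2)) \<le> real N powr (-2)"
    using R \<epsilon> by real_asymp
  then show "\<forall>\<^sub>F N in sequentially. \<exists>B\<in>events. prob B \<le> real N powr (-2) \<and>
     (\<forall>\<omega>\<in>space M - B. \<forall>x. L2_set x {1..N} = 1 \<longrightarrow>
     L2_set (matvec N (\<lambda>i j. trunc R N (upair i j) \<omega> - expectation (trunc R N (upair i j))) x) {1..N} \<le> \<epsilon> * sqrt (real N * ln (real N)))"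
    using eventually_gt_at_top[of 1]
  proof eventually_elim
    case (elim N)
    define b where "b e \<omega> = trunc R N e \<omega> - expectation (trunc R N e)" for e \<omega>
    have ind: "indep_vars (\<lambda>_. borel) b (upper_pairs N)"
      unfolding b_def[abs_def] by (rule indep_vars_compose2[OF trunc_indep]) measurable
    have bd: "\<bar>b e \<omega>\<bar> \<le> 2 * R" if "e \<in> upper_pairs N" for e \<omega>
    proof -
      have "\<bar>expectation (trunc R N e)\<bar> \<le> expectation (\<lambda>\<omega>. \<bar>trunc R N e \<omega>\<bar>)" by (rule integral_abs_bound)
      also have "\<dots> \<le> R" using trunc_int[OF that] R trunc_bound[of R]
        by (intro integral_le_const) auto
      finally show ?thesis using trunc_bound[of R N e \<omega>] R unfolding b_def by linarith
    qed
    have ctr: "expectation (b e) = 0" if "e \<in> upper_pairs N" for e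
      unfolding b_def[abs_def] using trunc_int[OF that] R by (simp add: prob_space)
    have t: "\<epsilon> * sqrt (real N * ln (real N)) > 0" using elim \<epsilon> by simp
    have R2: "2 * R > 0" and N: "N > 0" using R elim by auto
    obtain B where B: "B \<in> events"
      "prob B \<le> exp (12 * real N - (\<epsilon> * sqrt (real N * ln (real N)))\<^sup>2 / (64 * (2 * R)\<^sup>2))"
      "\<forall>\<omega>\<in>space M - B. \<forall>x. L2_set x {1..N} = 1 \<longrightarrow>
        L2_set (matvec N (\<lambda>i j. b (upair i j) \<omega>) x) {1..N} \<le> \<epsilon> * sqrt (real N * ln (real N))"
      using bounded_norm_tail[OF ind bd ctr R2 t N] by blast
    have "prob B \<le> real N powr (-2)" using B(2) elim(1) by linarith
    then show ?case using B(1,3) unfolding b_def by blast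
  qed
qed

text \<open>The trace bound N s + 2 k u under the constraint s u = h is balanced at order sqrt(h N
  ln N). The hypothesis \<open>small\<close> makes this at most e^(-2) times the target, and a power
  of order ln N turns that ratio into a negative power of N.\<close>

lemma norm_tail_part:
  assumes R: "R > 0" and \<epsilon>: "\<epsilon> > 0" and small: "K * R powr (2 - p) \<le> (\<epsilon> * exp (-2) / 4)\<^sup>2"
  shows "AE \<omega> in M. \<forall>\<^sub>F N in sequentially. \<forall>x. L2_set x {1..N} = 1 \<longrightarrow>
     L2_set (matvec N (\<lambda>i j. (Y N (upair i j) \<omega> - trunc R N (upair i j) \<omega>) -
       expectation (\<lambda>\<omega>. Y N (upair i j) \<omega> - trunc R N (upair i j) \<omega>)) x) {1..N} \<le> \<epsilon> * sqrt (real N * ln (real N))"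
proof (rule borel_cantelli_eventually)
  define h where "h = K * R powr (2 - p)"
  have h: "h > 0" using K_pos R by (simp add: h_def)
  show "summable (\<lambda>N. real N powr (-2))" by (simp add: summable_real_powr_iff)
  \<comment> \<open>The balancing u is of order sqrt(N / ln N) and must dominate the centred
    entries, which are bounded by 2 N^g; again g < 1/2.\<close>
  have ev1: "\<forall>\<^sub>F N in sequentially. 2 * real N powr ((p + 6) / (4 * p)) \<le> sqrt (h * real N * ln (real N)) / (2 * ln (real N))"
    using h tau_exponent by real_asymp
  have ev2: "\<forall>\<^sub>F N in sequentially. R \<le> real N powr ((p + 6) / (4 * p))"
    using R tau_exponent by real_asymp
  have ev3: "\<forall>\<^sub>F N in sequentially. ln (real N) \<ge> 1" by real_asymp
  show "\<forall>\<^sub>F N in sequentially. \<exists>B\<in>events. prob B \<le> real N powr (-2) \<and>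
     (\<forall>\<omega>\<in>space M - B. \<forall>x. L2_set x {1..N} = 1 \<longrightarrow>
     L2_set (matvec N (\<lambda>i j. (Y N (upair i j) \<omega> - trunc R N (upair i j) \<omega>) -
       expectation (\<lambda>\<omega>. Y N (upair i j) \<omega> - trunc R N (upair i j) \<omega>)) x) {1..N} \<le> \<epsilon> * sqrt (real N * ln (real N)))"
    using ev1 ev2 ev3 eventually_gt_at_top[of 1]
  proof eventually_elim
    case (elim N)
    define l where "l = ln (real N)"
    have l: "l \<ge> 1" using elim by (simp add: l_def)
    have N: "real N > 1" using elim by simp
    have RT: "R \<le> tau N" using elim by (simp add: tau_def)
    \<comment> \<open>With u = q/(2 l) and s = h/u one gets N s = 2 q, and also 2 k u <= 4 l u = 2
      q.\<close>
    define q where "q = sqrt (h * real N * l)"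
    have q: "q > 0" "q\<^sup>2 = h * real N * l" using h N l by (auto simp: q_def)
    define u where "u = q / (2 * l)"
    define s where "s = h / u"
    have u: "u > 0" "2 * tau N \<le> u" using q l elim(1) by (auto simp: u_def q_def l_def tau_def)
    have s: "s > 0" "s * u = h" using u h by (auto simp: s_def)
    \<comment> \<open>k >= ln N makes e^(-4k) at most N^(-3), leaving N^(-2) after the factor N of
      the trace; k <= 2 ln N keeps 2 k u within budget.\<close>
    define k where "k = nat \<lceil>l\<rceil>"
    have k: "l \<le> real k" "real k \<le> 2 * l" using l unfolding k_def by linarith+
    define t where "t = \<epsilon> * sqrt (real N * l)"
    have t: "t > 0" using \<epsilon> N l by (simp add: t_def)
    define D where "D e \<omega> = Y N e \<omega> - trunc R N e \<omega>" for e \<omega>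
    define b where "b e \<omega> = D e \<omega> - expectation (D e)" for e \<omega>
    have D_eq: "D e \<omega> = (\<lambda>x. if R < \<bar>x\<bar> \<and> \<bar>x\<bar> \<le> tau N then x else 0) (X N e \<omega>)" for e \<omega>
      using RT by (auto simp: D_def trunc_def)
    have D_bd: "\<bar>D e \<omega>\<bar> \<le> tau N" for e \<omega> unfolding D_eq using tau_nonneg by auto
    have D_int: "integrable M (D e)" if "e \<in> upper_pairs N" for e
      unfolding D_def[abs_def] using trunc_int[OF that] R tau_nonneg by auto
    have D_int2: "integrable M (\<lambda>\<omega>. (D e \<omega>)\<^sup>2)" if "e \<in> upper_pairs N" for e
      by (rule integrable_const_bound[where B="(tau N)\<^sup>2"])
         (use D_bd D_int[OF that] tau_nonneg in \<open>auto simp: abs_le_square_iff[symmetric]\<close>)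
    have D2: "expectation (\<lambda>\<omega>. (D e \<omega>)\<^sup>2) \<le> h" if e: "e \<in> upper_pairs N" for e
    proof -
      have "expectation (\<lambda>\<omega>. (D e \<omega>)\<^sup>2) \<le> expectation (\<lambda>\<omega>. if \<bar>X N e \<omega>\<bar> > R then \<bar>X N e \<omega>\<bar> ^ 2 else 0)"
        using D_int2[OF e] tail_moment(1)[OF e _ R, of 2] by (intro integral_mono) (auto simp: D_eq)
      also have "\<dots> \<le> h" unfolding h_def using tail_moment(2)[OF e _ R, of 2] by simp
      finally show ?thesis .
    qed
    have "indep_vars (\<lambda>_. borel) (\<lambda>e \<omega>. (\<lambda>x. (if R < \<bar>x\<bar> \<and> \<bar>x\<bar> \<le> tau N then x else 0) - expectation (D e)) (X N e \<omega>)) (upper_pairs N)"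
      by (rule indep_vars_compose2[OF indep]) measurable
    then have ind: "indep_vars (\<lambda>_. borel) b (upper_pairs N)" unfolding b_def[abs_def] D_eq[abs_def] .
    have bd: "\<bar>b e \<omega>\<bar> \<le> u" if "e \<in> upper_pairs N" for e \<omega>
    proof -
      have "\<bar>expectation (D e)\<bar> \<le> expectation (\<lambda>\<omega>. \<bar>D e \<omega>\<bar>)" by (rule integral_abs_bound)
      also have "\<dots> \<le> tau N" using D_int[OF that] D_bd by (intro integral_le_const) auto
      finally show ?thesis using D_bd[of e \<omega>] u unfolding b_def by linarith
    qed
    have ctr: "expectation (b e) = 0" if "e \<in> upper_pairs N" for e
      unfolding b_def[abs_def] using D_int[OF that] by (simp add: prob_space)
    have var: "expectation (\<lambda>\<omega>. (b e \<omega>)\<^sup>2) \<le> s * u" if e: "e \<in> upper_pairs N" for e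
    proof -
      have "expectation (\<lambda>\<omega>. (b e \<omega>)\<^sup>2) = expectation (\<lambda>\<omega>. (D e \<omega>)\<^sup>2) - (expectation (D e))\<^sup>2"
        unfolding b_def by (rule variance_eq[OF D_int[OF e] D_int2[OF e]])
      also have "\<dots> \<le> h" using D2[OF e] by (smt (verit) zero_le_power2)
      finally show ?thesis using s by simp
    qed
    obtain B where B: "B \<in> events" "prob B \<le> real N * ((real N * s + real (2 * k) * u) / t) ^ (2 * k)"
      "\<forall>\<omega>\<in>space M - B. \<forall>x. L2_set x {1..N} = 1 \<longrightarrow> L2_set (matvec N (\<lambda>i j. b (upair i j) \<omega>) x) {1..N} \<le> t"
      using trace_tail[OF ind bd ctr var _ _ t, of k] s u by auto
    have "real N * s = 2 * q"
    proof -
      have "real N * s = 2 * (h * real N * l) / q" unfolding s_def u_def using q l by (simp add: field_simps)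
      then show ?thesis using q unfolding q(2)[symmetric] by (simp add: power2_eq_square)
    qed
    moreover have "real (2 * k) * u \<le> 2 * q"
    proof -
      have "real (2 * k) * u \<le> (4 * l) * u" using k u by (intro mult_right_mono) auto
      also have "\<dots> = 2 * q" unfolding u_def using l by simp
      finally show ?thesis .
    qed
    ultimately have "real N * s + real (2 * k) * u \<le> 4 * q" by simp
    also have "q = sqrt h * sqrt (real N * l)" unfolding q_def by (simp add: real_sqrt_mult mult.assoc)
    also have "4 * (sqrt h * sqrt (real N * l)) \<le> exp (-2) * t"
    proof -
      have "sqrt h \<le> \<epsilon> * exp (-2) / 4"
        using small \<epsilon> unfolding h_def[symmetric] by (intro real_le_lsqrt) (auto simp: less_imp_le h)
      then have "(4 * sqrt h) * sqrt (real N * l) \<le> (exp (-2) * \<epsilon>) * sqrt (real N * l)"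
        using N l by (intro mult_right_mono) (auto simp: mult.commute)
      then show ?thesis by (simp only: t_def mult.assoc)
    qed
    finally have ratio: "(real N * s + real (2 * k) * u) / t \<le> exp (-2)" using t by (simp add: divide_le_eq)
    have "((real N * s + real (2 * k) * u) / t) ^ (2 * k) \<le> exp (-2) ^ (2 * k)"
      using ratio s u t by (intro power_mono divide_nonneg_pos) auto
    also have "\<dots> = exp (- (4 * real k))" by (simp add: exp_of_nat_mult[symmetric])
    also have "\<dots> \<le> exp (-3 * l)" using k l by simp
    also have "\<dots> = real N powr (-3)" using N by (simp add: powr_def l_def)
    finally have "real N * ((real N * s + real (2 * k) * u) / t) ^ (2 * k) \<le> real N powr 1 * real N powr (-3)"
      by (simp add: mult_left_mono)
    also have "\<dots> = real N powr (-2)" unfolding powr_add[symmetric] by simp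
    finally have "prob B \<le> real N powr (-2)" using B(2) by simp
    then show ?case using B(1,3) unfolding b_def D_def t_def l_def by blast
  qed
qed

text \<open>Three pieces receive \<epsilon>/3 each: the centred part below R, the centred part above
  R, and the matrix of means, whose norm is O(N^(-1/2)).\<close>

lemma norm_trunc_small:
  assumes \<epsilon>: "\<epsilon> > 0"
  shows "AE \<omega> in M. \<forall>\<^sub>F N in sequentially. \<forall>x. L2_set x {1..N} = 1 \<longrightarrow>
     L2_set (matvec N (\<lambda>i j. Y N (upair i j) \<omega>) x) {1..N} \<le> \<epsilon> * sqrt (real N * ln (real N))"
proof -
  define h where "h = (\<epsilon> / 3 * exp (-2) / 4)\<^sup>2"
  \<comment> \<open>R solves K R^(2-p) = h; the exponent 2 - p is negative, so a small h means a
    large R.\<close>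
  define R where "R = (h / K) powr (1 / (2 - p))"
  have h: "h > 0" using \<epsilon> by (simp add: h_def)
  have R: "R > 0" using h K_pos by (simp add: R_def)
  have Rh: "K * R powr (2 - p) \<le> (\<epsilon> / 3 * exp (-2) / 4)\<^sup>2"
    unfolding h_def[symmetric] R_def powr_powr using p_gt h K_pos by simp
  have \<epsilon>3: "\<epsilon> / 3 > 0" using \<epsilon> by simp
  have ev: "\<forall>\<^sub>F N in sequentially. real N * (real N * (K * real N powr (-5/2))) \<le> \<epsilon> / 3 * sqrt (real N * ln (real N))"
    using \<epsilon> K_pos by real_asymp
  from norm_bounded_part[OF R \<epsilon>3] norm_tail_part[OF R \<epsilon>3 Rh] show ?thesis
  proof eventually_elim
    case (elim \<omega>)
    from elim ev eventually_gt_at_top[of 0] show ?case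
    proof eventually_elim
      case (elim N)
      show ?case
      proof (intro allI impI)
        fix x assume x: "L2_set x {1..N} = 1"
        let ?A = "\<lambda>i j. trunc R N (upair i j) \<omega> - expectation (trunc R N (upair i j))"
        let ?B = "\<lambda>i j. (Y N (upair i j) \<omega> - trunc R N (upair i j) \<omega>) - expectation (\<lambda>\<omega>. Y N (upair i j) \<omega> - trunc R N (upair i j) \<omega>)"
        let ?C = "\<lambda>i j. expectation (Y N (upair i j))"
        have eq: "matvec N (\<lambda>i j. Y N (upair i j) \<omega>) x i = matvec N (\<lambda>i j. (?A i j + ?B i j) + ?C i j) x i" if "i \<in> {1..N}" for i
          unfolding matvec_def
        proof (intro sum.cong refl)
          fix j assume "j \<in> {1..N}"
          then have "upair i j \<in> upper_pairs N" using that by simp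
          from trunc_int[OF this] show "Y N (upair i j) \<omega> * x j = ((?A i j + ?B i j) + ?C i j) * x j"
            using R tau_nonneg by simp
        qed
        have "L2_set (matvec N (\<lambda>i j. Y N (upair i j) \<omega>) x) {1..N} = L2_set (matvec N (\<lambda>i j. (?A i j + ?B i j) + ?C i j) x) {1..N}"
          using eq by (intro L2_set_cong) auto
        also have "\<dots> \<le> L2_set (matvec N (\<lambda>i j. ?A i j + ?B i j) x) {1..N} + L2_set (matvec N ?C x) {1..N}"
          by (rule L2_set_matvec_add)
        also have "L2_set (matvec N (\<lambda>i j. ?A i j + ?B i j) x) {1..N} \<le> L2_set (matvec N ?A x) {1..N} + L2_set (matvec N ?B x) {1..N}"
          by (rule L2_set_matvec_add)
        also have "L2_set (matvec N ?A x) {1..N} \<le> \<epsilon> / 3 * sqrt (real N * ln (real N))" using elim(1) x by blast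
        also have "L2_set (matvec N ?B x) {1..N} \<le> \<epsilon> / 3 * sqrt (real N * ln (real N))" using elim(2) x by blast
        also have "L2_set (matvec N ?C x) {1..N} \<le> real N * (real N * (K * real N powr (-5/2)))"
          by (rule L2_set_matvec_entrywise[OF _ x]) (use trunc_tau_mean elim(4) in auto)
        also have "\<dots> \<le> \<epsilon> / 3 * sqrt (real N * ln (real N))" by (rule elim(3))
        finally show "L2_set (matvec N (\<lambda>i j. Y N (upair i j) \<omega>) x) {1..N} \<le> \<epsilon> * sqrt (real N * ln (real N))"
          by (simp add: field_simps)
      qed
    qed
  qed
qed

end

subsection \<open>The Laplacian\<close>

lemma spec_norm_eq: "spec_norm N B = Sup {L2_set (matvec N B x) {1..N} | x. L2_set x {1..N} = 1}"
  by (simp add: spec_norm_def L2_set_def matvec_def)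

lemma L2_set_basis: "i \<in> {1..N::nat} \<Longrightarrow> L2_set (\<lambda>j. if j = i then 1 else 0) {1..N} = 1"
proof -
  assume i: "i \<in> {1..N}"
  have "(\<Sum>j\<in>{1..N}. (if j = i then 1 else 0 :: real)\<^sup>2) = (\<Sum>j\<in>{1..N}. if j = i then 1 else 0)"
    by (intro sum.cong) auto
  then show ?thesis using i by (simp add: L2_set_def)
qed

lemma spec_norm_le:
  assumes "N > 0" "\<And>x. L2_set x {1..N} = 1 \<Longrightarrow> L2_set (matvec N B x) {1..N} \<le> c"
  shows "spec_norm N B \<le> c"
  unfolding spec_norm_eq
proof (rule cSup_least)
  have "L2_set (\<lambda>j. if j = 1 then 1 else 0) {1..N} = 1" by (rule L2_set_basis) (use assms in auto)
  then show "{L2_set (matvec N B x) {1..N} | x. L2_set x {1..N} = 1} \<noteq> {}" by blast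
qed (use assms in auto)

text \<open>Tests the norm on a basis vector. Since \<open>Sup\<close> on reals is informative only
  for bounded sets, boundedness is established through the sum of all entries.\<close>

lemma abs_diag_le_spec_norm:
  assumes i: "i \<in> {1..N}"
  shows "\<bar>B i i\<bar> \<le> spec_norm N B"
proof -
  define b where "b = (\<Sum>p\<in>{1..N} \<times> {1..N}. \<bar>B (fst p) (snd p)\<bar>)"
  have b: "\<bar>B k l\<bar> \<le> b" if "k \<in> {1..N}" "l \<in> {1..N}" for k l
    using that member_le_sum[of "(k, l)" "{1..N} \<times> {1..N}" "\<lambda>p. \<bar>B (fst p) (snd p)\<bar>"] by (simp add: b_def)
  let ?S = "{L2_set (matvec N B x) {1..N} | x. L2_set x {1..N} = 1}"
  let ?e = "\<lambda>j. if j = i then 1 else (0::real)"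
  have "bdd_above ?S"
    by (rule bdd_aboveI[of _ "real N * (real N * b)"]) (use L2_set_matvec_entrywise[of N B b] b in auto)
  moreover have "L2_set (matvec N B ?e) {1..N} \<in> ?S" using L2_set_basis[OF i] by blast
  ultimately have "L2_set (matvec N B ?e) {1..N} \<le> spec_norm N B" unfolding spec_norm_eq by (rule cSup_upper[rotated])
  moreover have "\<bar>matvec N B ?e i\<bar> \<le> L2_set (matvec N B ?e) {1..N}"
    using i member_le_L2_set[of "{1..N}" i "\<lambda>j. \<bar>matvec N B ?e j\<bar>"] by (simp add: L2_set_def)
  moreover have "matvec N B ?e i = B i i" using i by (simp add: matvec_def if_distrib cong: if_cong)
  ultimately show ?thesis by simp
qed

text \<open>The diagonal of $\Delta$ is that of $A$ minus the full row sums, including $A_{ii}$.\<close>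
lemma matvec_laplacian:
  assumes i: "i \<in> {1..N}"
  shows "matvec N (laplacian N A) x i = matvec N A x i - (\<Sum>k\<in>{1..N}. A i k) * x i"
proof -
  have "laplacian N A i j = A i j - (if j = i then (\<Sum>k\<in>{1..N}. A i k) else 0)" for j
    using i sum.remove[of "{1..N}" i "A i"] by (auto simp: laplacian_def)
  then have "matvec N (laplacian N A) x i = (\<Sum>j\<in>{1..N}. A i j * x j - (if j = i then (\<Sum>k\<in>{1..N}. A i k) * x j else 0))"
    unfolding matvec_def by (intro sum.cong) (auto simp: left_diff_distrib)
  also have "\<dots> = matvec N A x i - (\<Sum>k\<in>{1..N}. A i k) * x i"
    using i by (simp add: sum_subtractf matvec_def)
  finally show ?thesis .
qed

text \<open>Triangle inequality for A - D; the diagonal matrix D of row sums has norm at most the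
  largest row sum in modulus.\<close>

lemma spec_norm_laplacian_le:
  assumes N: "N > 0" and A: "\<And>x. L2_set x {1..N} = 1 \<Longrightarrow> L2_set (matvec N A x) {1..N} \<le> a"
    and r: "\<And>i. i \<in> {1..N} \<Longrightarrow> \<bar>\<Sum>k\<in>{1..N}. A i k\<bar> \<le> r"
  shows "spec_norm N (laplacian N A) \<le> a + r"
proof (rule spec_norm_le[OF N])
  fix x assume x: "L2_set x {1..N} = 1"
  have r0: "r \<ge> 0" using r[of 1] N by (auto intro: order.trans[OF abs_ge_zero])
  have "L2_set (matvec N (laplacian N A) x) {1..N} = L2_set (\<lambda>i. matvec N A x i + - (\<Sum>k\<in>{1..N}. A i k) * x i) {1..N}"
    by (intro L2_set_cong) (auto simp: matvec_laplacian)
  also have "\<dots> \<le> L2_set (matvec N A x) {1..N} + L2_set (\<lambda>i. - (\<Sum>k\<in>{1..N}. A i k) * x i) {1..N}"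
    by (rule L2_set_triangle_ineq)
  also have "L2_set (\<lambda>i. - (\<Sum>k\<in>{1..N}. A i k) * x i) {1..N} = L2_set (\<lambda>i. \<bar>\<Sum>k\<in>{1..N}. A i k\<bar> * \<bar>x i\<bar>) {1..N}"
    by (simp add: L2_set_def power_mult_distrib)
  also have "\<dots> \<le> L2_set (\<lambda>i. r * \<bar>x i\<bar>) {1..N}"
    using r by (intro L2_set_mono mult_right_mono) auto
  also have "\<dots> = r * L2_set (\<lambda>i. \<bar>x i\<bar>) {1..N}" using r0 by (rule L2_set_right_distrib[symmetric])
  also have "L2_set (\<lambda>i. \<bar>x i\<bar>) {1..N} = 1" using x by (simp add: L2_set_def)
  finally show "L2_set (matvec N (laplacian N A) x) {1..N} \<le> a + r" using A[OF x] by simp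
qed

section \<open>Norm of the Laplacian of a generalised Wigner matrix\<close>

context wigner
begin

lemma zsum_upair: "zsum N (upair i ` S) \<omega> = sqrt (ln (real N) / real N) * (\<Sum>k\<in>S. Y N (upair i k) \<omega>)"
  unfolding zsum_def by (subst sum.reindex[OF inj_upair]) simp

lemma sqrt_scaling:
  assumes "N > 1"
  shows "sqrt (ln (real N) / real N) * sqrt (real N * ln (real N)) = ln (real N)" "sqrt (ln (real N) / real N) > 0"
proof -
  have "sqrt (ln (real N) / real N) * sqrt (real N * ln (real N)) = sqrt (ln (real N) * ln (real N))"
    unfolding real_sqrt_mult[symmetric] using assms by simp
  then show "sqrt (ln (real N) / real N) * sqrt (real N * ln (real N)) = ln (real N)" using assms by simp
qed (use assms in simp)

text \<open>Half of \<epsilon> goes to the matrix itself and half to the row sums, for which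
  \<open>rows_upper\<close> with w = v2 asks for y > 2 sqrt v2.\<close>

lemma laplacian_norm_upper:
  assumes \<epsilon>: "\<epsilon> > 0"
  shows "AE \<omega> in M. \<forall>\<^sub>F N in sequentially.
    spec_norm N (laplacian N (\<lambda>i j. X N (upair i j) \<omega>)) \<le> (2 * sqrt v2 + \<epsilon>) * sqrt (real N * ln (real N))"
proof -
  define y where "y = 2 * sqrt v2 + \<epsilon> / 2"
  have y: "y > 0" using \<epsilon> v2_pos by (simp add: y_def add_pos_pos)
  have "(2 * sqrt v2)\<^sup>2 < y\<^sup>2" using \<epsilon> v2_pos by (intro power_strict_mono) (auto simp: y_def)
  then have y2: "y\<^sup>2 > 4 * v2" using v2_pos by (simp add: power_mult_distrib)
  have "AE \<omega> in M. \<forall>\<^sub>F N in sequentially. \<forall>i\<in>{1..N}. \<bar>zsum N (upair i ` {1..N}) \<omega>\<bar> \<le> y * ln (real N)"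
  proof (rule rows_upper[OF _ v2_pos y y2])
    show "\<forall>\<^sub>F N in sequentially. \<forall>i\<in>{1..N}. upair i ` {1..N} \<subseteq> upper_pairs N \<and> card (upair i ` {1..N}) \<le> N \<and> vsum N (upair i ` {1..N}) \<le> v2"
      using eventually_gt_at_top[of 0]
    proof eventually_elim
      case (elim N)
      show ?case
      proof (intro ballI conjI)
        fix i assume i: "i \<in> {1..N}"
        show sub: "upair i ` {1..N} \<subseteq> upper_pairs N" using i by auto
        have c: "card (upair i ` {1..N}) = N" by (simp add: card_image[OF inj_upair])
        then show "card (upair i ` {1..N}) \<le> N" by simp
        show "vsum N (upair i ` {1..N}) \<le> v2" using vsum_bounds(2)[OF sub] elim unfolding c by simp
      qed
    qed
  qed
  moreover have "\<epsilon> / 2 > 0" using \<epsilon> by simp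
  note norm_trunc_small[OF this]
  ultimately show ?thesis using eventually_no_truncation
  proof eventually_elim
    case (elim \<omega>)
    from elim eventually_gt_at_top[of 1] show ?case
    proof eventually_elim
      case (elim N)
      have eq: "X N (upair i j) \<omega> = Y N (upair i j) \<omega>" if "i \<in> {1..N}" "j \<in> {1..N}" for i j
        using elim(3) that by auto
      let ?s = "sqrt (real N * ln (real N))"
      have "spec_norm N (laplacian N (\<lambda>i j. X N (upair i j) \<omega>)) \<le> \<epsilon> / 2 * ?s + y * ?s"
      proof (rule spec_norm_laplacian_le)
        show "N > 0" using elim by simp
        fix x assume x: "L2_set x {1..N} = 1"
        have "L2_set (matvec N (\<lambda>i j. X N (upair i j) \<omega>) x) {1..N} = L2_set (matvec N (\<lambda>i j. Y N (upair i j) \<omega>) x) {1..N}"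
          using eq by (intro L2_set_cong refl) (auto simp: matvec_def)
        then show "L2_set (matvec N (\<lambda>i j. X N (upair i j) \<omega>) x) {1..N} \<le> \<epsilon> / 2 * ?s" using elim(2) x by simp
      next
        fix i assume i: "i \<in> {1..N}"
        let ?r = "sqrt (ln (real N) / real N)"
        have "?r * \<bar>\<Sum>k\<in>{1..N}. Y N (upair i k) \<omega>\<bar> = \<bar>zsum N (upair i ` {1..N}) \<omega>\<bar>"
          unfolding zsum_upair abs_mult using sqrt_scaling[OF elim(4)] by simp
        also have "\<dots> \<le> y * ln (real N)" using elim(1) i by blast
        also have "\<dots> = ?r * (y * ?s)" using sqrt_scaling(1)[OF elim(4)] by (simp add: mult.left_commute)
        finally have "\<bar>\<Sum>k\<in>{1..N}. Y N (upair i k) \<omega>\<bar> \<le> y * ?s" using sqrt_scaling(2)[OF elim(4)] by simp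
        then show "\<bar>\<Sum>k\<in>{1..N}. X N (upair i k) \<omega>\<bar> \<le> y * ?s" using eq[OF i] by simp
      qed
      also have "\<dots> = (2 * sqrt v2 + \<epsilon>) * ?s" by (simp add: y_def algebra_simps)
      finally show ?case .
    qed
  qed
qed

text \<open>The rows $i \le \kappa N$ are made independent by keeping only the columns $j > \kappa N$.\<close>
lemma laplacian_norm_lower:
  assumes y: "y > 0" "y\<^sup>2 < 2 * v1"
  shows "AE \<omega> in M. \<forall>\<^sub>F N in sequentially.
    y * sqrt (real N * ln (real N)) \<le> spec_norm N (laplacian N (\<lambda>i j. X N (upair i j) \<omega>))"
proof -
  have "y < sqrt (2 * v1)" using y v1_pos by (intro real_less_rsqrt) auto
  \<comment> \<open>The kept columns are to reach level z, so that the dropped columns may destroy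
    up to z - y.\<close>
  then obtain z where z: "y < z" "z < sqrt (2 * v1)" using dense by blast
  have z2: "z\<^sup>2 < 2 * v1" using z y v1_pos power_strict_mono[of z "sqrt (2 * v1)" 2] by simp
  define \<epsilon> where "\<epsilon> = z - y"
  have \<epsilon>: "\<epsilon> > 0" using z by (simp add: \<epsilon>_def)
  \<comment> \<open>Two constraints, both made strict by the final halving: \<epsilon>^2 > 4
    \<kappa> lets \<open>rows_upper\<close> control the dropped columns, and z^2 < 2 v1 (1 -
    \<kappa>) leaves enough variance in the kept ones.\<close>
  define \<kappa> where "\<kappa> = min (\<epsilon>\<^sup>2 / 4) (1 - z\<^sup>2 / (2 * v1)) / 2"
  have \<kappa>: "\<kappa> > 0" "\<epsilon>\<^sup>2 > 4 * \<kappa>" "\<kappa> < 1 - z\<^sup>2 / (2 * v1)"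
  proof -
    have "\<epsilon>\<^sup>2 > 0" "1 - z\<^sup>2 / (2 * v1) > 0" using \<epsilon> z2 v1_pos by auto
    then show "\<kappa> > 0" "\<epsilon>\<^sup>2 > 4 * \<kappa>" "\<kappa> < 1 - z\<^sup>2 / (2 * v1)" unfolding \<kappa>_def by (auto simp: min_def)
  qed
  have \<kappa>1: "\<kappa> < 1" using \<kappa>(3) v1_pos by (smt (verit) divide_nonneg_pos zero_le_power2)
  define a where "a = v1 * (1 - \<kappa>)"
  have a: "a > 0" using \<kappa>1 v1_pos by (simp add: a_def)
  have za: "z\<^sup>2 < 2 * a" using \<kappa>(3) v1_pos by (simp add: a_def field_simps)
  define m where "m N = nat \<lfloor>\<kappa> * real N\<rfloor>" for N
  have m: "real (m N) \<le> \<kappa> * real N" "real (m N) \<ge> \<kappa> * real N - 1" for N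
  proof -
    have "\<kappa> * real N \<ge> 0" using \<kappa> by simp
    then show "real (m N) \<le> \<kappa> * real N" "real (m N) \<ge> \<kappa> * real N - 1" unfolding m_def by linarith+
  qed
  have mN: "m N \<le> N" for N
  proof -
    have "\<kappa> * real N \<le> 1 * real N" using \<kappa>1 by (intro mult_right_mono) auto
    then show ?thesis using m(1)[of N] by linarith
  qed
  have far: "AE \<omega> in M. \<forall>\<^sub>F N in sequentially. \<exists>i\<in>{1..m N}. zsum N (upair i ` {Suc (m N)..N}) \<omega> \<ge> z * ln (real N)"
  proof (rule rows_lower[OF _ a _ za \<kappa>(1)])
    show "z > 0" using z y by simp
    show "\<forall>\<^sub>F N in sequentially. (\<forall>i\<in>{1..m N}. upair i ` {Suc (m N)..N} \<subseteq> upper_pairs N \<and> card (upair i ` {Suc (m N)..N}) \<le> N \<and>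
        a \<le> vsum N (upair i ` {Suc (m N)..N})) \<and> disjoint_family_on (\<lambda>i. upair i ` {Suc (m N)..N}) {1..m N} \<and> \<kappa> * real N - 1 \<le> real (m N)"
      using eventually_gt_at_top[of 0]
    proof eventually_elim
      case (elim N)
      show ?case
      proof (intro ballI conjI m)
        fix i assume i: "i \<in> {1..m N}"
        have iN: "i \<in> {1..N}" using i mN[of N] by auto
        show sub: "upair i ` {Suc (m N)..N} \<subseteq> upper_pairs N"
        proof
          fix e assume "e \<in> upair i ` {Suc (m N)..N}"
          then obtain k where "e = upair i k" "k \<in> {1..N}" by auto
          then show "e \<in> upper_pairs N" using iN by simp
        qed
        have c: "card (upair i ` {Suc (m N)..N}) = N - m N" by (simp add: card_image[OF inj_upair])
        then show "card (upair i ` {Suc (m N)..N}) \<le> N" by simp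
        have "(1 - \<kappa>) * real N \<le> real (N - m N)" using m(1)[of N] mN[of N] by (simp add: of_nat_diff algebra_simps)
        then have "v1 * ((1 - \<kappa>) * real N) / real N \<le> v1 * real (N - m N) / real N"
          using v1_pos by (intro divide_right_mono mult_left_mono) auto
        then show "a \<le> vsum N (upair i ` {Suc (m N)..N})"
          using vsum_bounds(1)[OF sub] elim unfolding c a_def by simp
      next
        \<comment> \<open>For i <= m N < k the smaller index of the pair is i, so different rows use
          different entries.\<close>
        show "disjoint_family_on (\<lambda>i. upair i ` {Suc (m N)..N}) {1..m N}"
          by (auto simp: disjoint_family_on_def upair_def min_def max_def split: if_splits)
      qed
    qed
  qed
  \<comment> \<open>The successful row is random, so the dropped columns are bounded for all rows
    simultaneously. Column i is left out because the diagonal of the Laplacian sums over k different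
    from i.\<close>
  have near: "AE \<omega> in M. \<forall>\<^sub>F N in sequentially. \<forall>i\<in>{1..N}. \<bar>zsum N (upair i ` ({1..m N} - {i})) \<omega>\<bar> \<le> \<epsilon> * ln (real N)"
  proof (rule rows_upper[OF _ \<kappa>(1) \<epsilon> \<kappa>(2)])
    show "\<forall>\<^sub>F N in sequentially. \<forall>i\<in>{1..N}. upair i ` ({1..m N} - {i}) \<subseteq> upper_pairs N \<and> card (upair i ` ({1..m N} - {i})) \<le> N \<and>
        vsum N (upair i ` ({1..m N} - {i})) \<le> \<kappa>"
      using eventually_gt_at_top[of 0]
    proof eventually_elim
      case (elim N)
      show ?case
      proof (intro ballI conjI)
        fix i assume i: "i \<in> {1..N}"
        show sub: "upair i ` ({1..m N} - {i}) \<subseteq> upper_pairs N"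
        proof
          fix e assume "e \<in> upair i ` ({1..m N} - {i})"
          then obtain k where "e = upair i k" "k \<in> {1..m N}" by blast
          then show "e \<in> upper_pairs N" using i mN[of N] by simp
        qed
        have "card (upair i ` ({1..m N} - {i})) \<le> card ({1..m N} - {i})" by (rule card_image_le) simp
        also have "\<dots> \<le> card {1..m N}" by (rule card_mono) auto
        finally have c: "card (upair i ` ({1..m N} - {i})) \<le> m N" by simp
        then show "card (upair i ` ({1..m N} - {i})) \<le> N" using mN[of N] by simp
        have "v2 * real (card (upair i ` ({1..m N} - {i}))) \<le> 1 * (\<kappa> * real N)"
          using v2_le_1 v2_pos c m(1)[of N] by (intro mult_mono) auto
        then have "v2 * real (card (upair i ` ({1..m N} - {i}))) / real N \<le> \<kappa>"
          using elim by (simp add: divide_le_eq)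
        then show "vsum N (upair i ` ({1..m N} - {i})) \<le> \<kappa>" using vsum_bounds(2)[OF sub] by linarith
      qed
    qed
  qed
  from far near eventually_no_truncation show ?thesis
  proof eventually_elim
    case (elim \<omega>)
    from elim eventually_gt_at_top[of 1] show ?case
    proof eventually_elim
      case (elim N)
      let ?s = "sqrt (real N * ln (real N))" and ?r = "sqrt (ln (real N) / real N)"
      note sc = sqrt_scaling[OF elim(4)]
      obtain i where i: "i \<in> {1..m N}" "zsum N (upair i ` {Suc (m N)..N}) \<omega> \<ge> z * ln (real N)" using elim(1) by blast
      have iN: "i \<in> {1..N}" using i mN[of N] by auto
      let ?F = "\<Sum>k\<in>{Suc (m N)..N}. Y N (upair i k) \<omega>" and ?G = "\<Sum>k\<in>{1..m N} - {i}. Y N (upair i k) \<omega>"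
      have "?r * (z * ?s) = z * ln (real N)" using sc(1) by (simp add: mult.left_commute)
      also have "\<dots> \<le> ?r * ?F" using i(2) unfolding zsum_upair .
      finally have F: "z * ?s \<le> ?F" using sc(2) by simp
      have "?r * \<bar>?G\<bar> = \<bar>zsum N (upair i ` ({1..m N} - {i})) \<omega>\<bar>"
        unfolding zsum_upair abs_mult using sc(2) by simp
      also have "\<dots> \<le> \<epsilon> * ln (real N)" using elim(2) iN by blast
      also have "\<dots> = ?r * (\<epsilon> * ?s)" using sc(1) by (simp add: mult.left_commute)
      finally have G: "\<bar>?G\<bar> \<le> \<epsilon> * ?s" using sc(2) by simp
      have set: "{1..N} - {i} = ({1..m N} - {i}) \<union> {Suc (m N)..N}" using i mN[of N] by auto
      have "(\<Sum>k\<in>{1..N} - {i}. X N (upair i k) \<omega>) = (\<Sum>k\<in>{1..N} - {i}. Y N (upair i k) \<omega>)"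
        using elim(3) iN by (intro sum.cong) auto
      also have "\<dots> = ?G + ?F" unfolding set by (rule sum.union_disjoint) auto
      finally have "\<bar>laplacian N (\<lambda>i j. X N (upair i j) \<omega>) i i\<bar> = \<bar>?G + ?F\<bar>" by (simp add: laplacian_def)
      moreover have "y * ?s = z * ?s - \<epsilon> * ?s" by (simp add: \<epsilon>_def algebra_simps)
      ultimately have "y * ?s \<le> \<bar>laplacian N (\<lambda>i j. X N (upair i j) \<omega>) i i\<bar>" using F G by linarith
      also have "\<dots> \<le> spec_norm N (laplacian N (\<lambda>i j. X N (upair i j) \<omega>))" by (rule abs_diag_le_spec_norm[OF iN])
      finally show ?case .
    qed
  qed
qed

text \<open>Taking \<epsilon> = 1/(n+1) gives one null set for all n. The factor sqrt 2 in the
  normalisation turns 2 sqrt v2 into sqrt(2 v2).\<close>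

lemma laplacian_limsup:
  "AE \<omega> in M. limsup (\<lambda>N. ereal (spec_norm N (laplacian N (\<lambda>i j. X N (upair i j) \<omega>)) / sqrt (2 * real N * ln (real N)))) \<le> ereal (sqrt (2 * v2))"
proof -
  have "AE \<omega> in M. \<forall>n. \<forall>\<^sub>F N in sequentially.
    spec_norm N (laplacian N (\<lambda>i j. X N (upair i j) \<omega>)) \<le> (2 * sqrt v2 + 1 / real (Suc n)) * sqrt (real N * ln (real N))"
    unfolding AE_all_countable by (intro allI laplacian_norm_upper) simp
  then show ?thesis
  proof eventually_elim
    case (elim \<omega>)
    let ?L = "limsup (\<lambda>N. ereal (spec_norm N (laplacian N (\<lambda>i j. X N (upair i j) \<omega>)) / sqrt (2 * real N * ln (real N))))"
    have bd: "?L \<le> ereal ((2 * sqrt v2 + 1 / real (Suc n)) / sqrt 2)" for n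
    proof (rule Limsup_bounded)
      show "\<forall>\<^sub>F N in sequentially. ereal (spec_norm N (laplacian N (\<lambda>i j. X N (upair i j) \<omega>)) / sqrt (2 * real N * ln (real N)))
         \<le> ereal ((2 * sqrt v2 + 1 / real (Suc n)) / sqrt 2)"
        using elim[rule_format, of n] eventually_gt_at_top[of 1]
      proof eventually_elim
        case (elim N)
        have "sqrt (2 * real N * ln (real N)) = sqrt 2 * sqrt (real N * ln (real N))"
          by (simp add: real_sqrt_mult mult.assoc)
        moreover have "sqrt (real N * ln (real N)) > 0" using elim by simp
        ultimately show ?case using elim(1) by (simp add: divide_simps mult_ac)
      qed
    qed
    have lim: "(\<lambda>n. ereal ((2 * sqrt v2 + 1 / real (Suc n)) / sqrt 2)) \<longlonglongrightarrow> ereal ((2 * sqrt v2 + 0) / sqrt 2)"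
      by (intro tendsto_intros lim_inverse_n' LIMSEQ_Suc) auto
    have "?L \<le> ereal ((2 * sqrt v2 + 0) / sqrt 2)" by (rule LIMSEQ_le_const[OF lim]) (use bd in blast)
    also have "(2 * sqrt v2 + 0) / sqrt 2 = sqrt (2 * v2)"
      by (simp add: real_sqrt_mult field_simps)
    finally show ?case .
  qed
qed

lemma laplacian_liminf:
  "AE \<omega> in M. ereal (sqrt v1) \<le> liminf (\<lambda>N. ereal (spec_norm N (laplacian N (\<lambda>i j. X N (upair i j) \<omega>)) / sqrt (2 * real N * ln (real N))))"
proof -
  \<comment> \<open>Increases to the critical level sqrt(2 v1); the offset 2 in the denominator
    keeps y 0 positive.\<close>
  define y where "y n = sqrt (2 * v1) * (1 - 1 / real (Suc (Suc n)))" for n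
  have y: "y n > 0" "(y n)\<^sup>2 < 2 * v1" for n
  proof -
    have q: "0 < 1 - 1 / real (Suc (Suc n))" "1 - 1 / real (Suc (Suc n)) < 1" by (auto simp: field_simps)
    then show "y n > 0" using v1_pos by (simp add: y_def)
    have "(1 - 1 / real (Suc (Suc n)))\<^sup>2 < 1" using q power_strict_mono[of "1 - 1 / real (Suc (Suc n))" 1 2] by simp
    then show "(y n)\<^sup>2 < 2 * v1" using v1_pos by (simp add: y_def power_mult_distrib)
  qed
  have "AE \<omega> in M. \<forall>n. \<forall>\<^sub>F N in sequentially.
    y n * sqrt (real N * ln (real N)) \<le> spec_norm N (laplacian N (\<lambda>i j. X N (upair i j) \<omega>))"
    unfolding AE_all_countable by (intro allI laplacian_norm_lower y)
  then show ?thesis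
  proof eventually_elim
    case (elim \<omega>)
    let ?L = "liminf (\<lambda>N. ereal (spec_norm N (laplacian N (\<lambda>i j. X N (upair i j) \<omega>)) / sqrt (2 * real N * ln (real N))))"
    have bd: "ereal (y n / sqrt 2) \<le> ?L" for n
    proof (rule Liminf_bounded)
      show "\<forall>\<^sub>F N in sequentially. ereal (y n / sqrt 2) \<le> ereal (spec_norm N (laplacian N (\<lambda>i j. X N (upair i j) \<omega>)) / sqrt (2 * real N * ln (real N)))"
        using elim[rule_format, of n] eventually_gt_at_top[of 1]
      proof eventually_elim
        case (elim N)
        have "sqrt (2 * real N * ln (real N)) = sqrt 2 * sqrt (real N * ln (real N))"
          by (simp add: real_sqrt_mult mult.assoc)
        moreover have "sqrt (real N * ln (real N)) > 0" using elim by simp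
        ultimately show ?case using elim(1) by (simp add: divide_simps mult_ac)
      qed
    qed
    have lim: "(\<lambda>n. ereal (y n / sqrt 2)) \<longlonglongrightarrow> ereal (sqrt (2 * v1) * (1 - 0) / sqrt 2)"
      unfolding y_def by (intro tendsto_intros LIMSEQ_Suc[OF LIMSEQ_Suc[OF lim_1_over_n]]) auto
    have "ereal (sqrt (2 * v1) * (1 - 0) / sqrt 2) \<le> ?L" by (rule LIMSEQ_le_const2[OF lim]) (use bd in blast)
    also have "sqrt (2 * v1) * (1 - 0) / sqrt 2 = sqrt v1" by (simp add: real_sqrt_mult)
    finally show ?case .
  qed
qed

end

theorem mainTheorem5:
  fixes M :: "'a measure" and X :: "nat \<Rightarrow> nat \<Rightarrow> nat \<Rightarrow> 'a \<Rightarrow> real"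
    and W :: "real \<Rightarrow> real \<Rightarrow> real"
  defines "sig2 \<equiv> \<lambda>N i j. LINT \<omega>|M. (X N (min i j) (max i j) \<omega>
                      - (LINT \<omega>'|M. X N (min i j) (max i j) \<omega>'))\<^sup>2"
  defines "A1 \<equiv> INF (N,i,j)\<in>{(N,i,j). 1 \<le> i \<and> i \<le> j \<and> j \<le> N}. sig2 N i j"
  defines "A2 \<equiv> SUP (N,i,j)\<in>{(N,i,j). 1 \<le> i \<and> i \<le> j \<and> j \<le> N}. sig2 N i j"
  assumes "prob_space M"
    and rv: "\<And>N i j. 1 \<le> i \<Longrightarrow> i \<le> j \<Longrightarrow> j \<le> N \<Longrightarrow> X N i j \<in> borel_measurable M"
    and indep: "\<And>N. prob_space.indep_vars M (\<lambda>_. borel) (\<lambda>(i,j). X N i j)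
                       {(i,j). 1 \<le> i \<and> i \<le> j \<and> j \<le> N}"
    and centered: "\<And>N i j. 1 \<le> i \<Longrightarrow> i \<le> j \<Longrightarrow> j \<le> N \<Longrightarrow>
                     integrable M (X N i j) \<and> (LINT \<omega>|M. X N i j \<omega>) = 0"
    and S1a: "A1 > 0"
    and S1b: "\<And>N i j. 1 \<le> i \<Longrightarrow> i \<le> j \<Longrightarrow> j \<le> N \<Longrightarrow> sig2 N i j \<le> 1"
    and S2: "\<exists>\<delta>>0. \<exists>K::real. \<forall>N i j. 1 \<le> i \<and> i \<le> j \<and> j \<le> N \<longrightarrow>
               (\<integral>\<^sup>+\<omega>. ennreal (\<bar>X N i j \<omega> - (LINT \<omega>'|M. X N i j \<omega>')\<bar> powr (6 + \<delta>)) \<partial>M)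
                 \<le> ennreal K"
    and S3: "graphon W" "(\<lambda>N. cut_dist (emp_graphon N (sig2 N)) W) \<longlonglongrightarrow> 0"
  shows "AE \<omega> in M. ereal (sqrt A1) \<le> liminf (\<lambda>N. ereal
            (spec_norm N (laplacian N (sym_mat (\<lambda>i j. X N i j \<omega>)))
               / sqrt (2 * real N * ln (real N))))
       \<and> (AE \<omega> in M. limsup (\<lambda>N. ereal
            (spec_norm N (laplacian N (sym_mat (\<lambda>i j. X N i j \<omega>)))
               / sqrt (2 * real N * ln (real N)))) \<le> ereal (sqrt (2 * A2)))"
proof -
  interpret prob_space M by fact
  let ?T = "{(N,i,j). 1 \<le> i \<and> i \<le> j \<and> j \<le> (N::nat)}"
  obtain \<delta> K where \<delta>: "\<delta> > 0" and K: "\<And>N i j. 1 \<le> i \<Longrightarrow> i \<le> j \<Longrightarrow> j \<le> N \<Longrightarrow>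
      (\<integral>\<^sup>+\<omega>. ennreal (\<bar>X N i j \<omega> - (LINT \<omega>'|M. X N i j \<omega>')\<bar> powr (6 + \<delta>)) \<partial>M) \<le> ennreal K"
    using S2 by blast
  have sig: "sig2 N i j = expectation (\<lambda>\<omega>. (X N i j \<omega>)\<^sup>2)" if "1 \<le> i" "i \<le> j" "j \<le> N" for N i j
    using centered[OF that] that by (simp add: sig2_def min_def max_def)
  have A1_le: "A1 \<le> sig2 N i j" if "1 \<le> i" "i \<le> j" "j \<le> N" for N i j
  proof -
    \<comment> \<open>Infima of reals are lower bounds only for sets bounded below; non-negativity
      of variances supplies this, as S1b does for the supremum.\<close>
    have "bdd_below ((\<lambda>(N,i,j). sig2 N i j) ` ?T)" by (rule bdd_belowI[of _ 0]) (auto simp: sig2_def)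
    then have "A1 \<le> (\<lambda>(N,i,j). sig2 N i j) (N, i, j)" unfolding A1_def by (rule cINF_lower) (use that in auto)
    then show ?thesis by simp
  qed
  have le_A2: "sig2 N i j \<le> A2" if "1 \<le> i" "i \<le> j" "j \<le> N" for N i j
  proof -
    have "bdd_above ((\<lambda>(N,i,j). sig2 N i j) ` ?T)" by (rule bdd_aboveI[of _ 1]) (auto intro: S1b)
    then have "(\<lambda>(N,i,j). sig2 N i j) (N, i, j) \<le> A2" unfolding A2_def by (intro cSUP_upper) (use that in auto)
    then show ?thesis by simp
  qed
  have "(1::nat, 1::nat, 1::nat) \<in> ?T" by simp
  then have "?T \<noteq> {}" by blast
  then have A2_1: "A2 \<le> 1" unfolding A2_def by (intro cSUP_least) (auto intro: S1b)
  \<comment> \<open>A finite non-negative integral gives integrability. Replacing K by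
    \<open>max K 1\<close> makes the constant positive, which \<open>ennreal K\<close> alone does
    not ensure since it sends negative K to 0.\<close>
  have mom: "integrable M (\<lambda>\<omega>. \<bar>X N i j \<omega>\<bar> powr (6 + \<delta>)) \<and> expectation (\<lambda>\<omega>. \<bar>X N i j \<omega>\<bar> powr (6 + \<delta>)) \<le> max K 1"
    if ij: "1 \<le> i" "i \<le> j" "j \<le> N" for N i j
  proof -
    note [measurable] = rv[OF ij]
    have b: "(\<integral>\<^sup>+\<omega>. ennreal (\<bar>X N i j \<omega>\<bar> powr (6 + \<delta>)) \<partial>M) \<le> ennreal (max K 1)"
      using K[OF ij] centered[OF ij] by (auto intro: order.trans simp: ennreal_leI)
    then have "integrable M (\<lambda>\<omega>. \<bar>X N i j \<omega>\<bar> powr (6 + \<delta>))"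
      by (intro integrableI_bounded) (auto intro: le_less_trans)
    moreover from this have "ennreal (expectation (\<lambda>\<omega>. \<bar>X N i j \<omega>\<bar> powr (6 + \<delta>))) \<le> ennreal (max K 1)"
      using b by (subst nn_integral_eq_integral[symmetric]) auto
    ultimately show ?thesis by (simp add: ennreal_le_iff)
  qed
  interpret wigner M "\<lambda>N e. X N (fst e) (snd e)" "6 + \<delta>" "max K 1" A1 A2
  proof
    show "indep_vars (\<lambda>_. borel) (\<lambda>e. X N (fst e) (snd e)) (upper_pairs N)" for N
      using indep[of N] by (simp add: upper_pairs_def case_prod_unfold)
  next
    fix N e assume "e \<in> upper_pairs N"
    then have e: "1 \<le> fst e" "fst e \<le> snd e" "snd e \<le> N" by (auto simp: upper_pairs_def)
    show "integrable M (\<lambda>\<omega>. \<bar>X N (fst e) (snd e) \<omega>\<bar> powr (6 + \<delta>))"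
      "expectation (\<lambda>\<omega>. \<bar>X N (fst e) (snd e) \<omega>\<bar> powr (6 + \<delta>)) \<le> max K 1"
      using mom[OF e] by blast+
    show "expectation (X N (fst e) (snd e)) = 0" using centered[OF e] by blast
    show "A1 \<le> expectation (\<lambda>\<omega>. (X N (fst e) (snd e) \<omega>)\<^sup>2)" "expectation (\<lambda>\<omega>. (X N (fst e) (snd e) \<omega>)\<^sup>2) \<le> A2"
      using A1_le[OF e] le_A2[OF e] unfolding sig[OF e] .
  qed (use \<delta> S1a A2_1 in simp_all)
  have eq: "sym_mat (\<lambda>i j. X N i j \<omega>) = (\<lambda>i j. X N (fst (upair i j)) (snd (upair i j)) \<omega>)" for N \<omega>
    by (simp add: sym_mat_def upair_def fun_eq_iff)
  \<comment> \<open>The second conjunct carries its own almost sure quantifier and does not depend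
    on the outer sample point, so only the liminf statement is used for the outer one.\<close>
  show ?thesis unfolding eq
    by (rule eventually_mono[OF laplacian_liminf]) (rule conjI, assumption, rule laplacian_limsup)
qed

end
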